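(* Let $[S,T]\subseteq\mathbb{R}$ be an interval and let $n\in\mathbb{N}$. Let $p\in[1,3)$, let $\omega$ be a control function on $[S,T]$, and let $X$ be an $n$-dimensional branched rough path on $[S,T]$ with regularity $p$ and control $\omega$. Let $M$ be a manifold and let $f:M\to R_n^2M$ be a compactly supported admissible rough velocity field. Then for each $Y_0\in M$ there exists an integral curve $Y:[S,T]\to M$ of $f$ driven by $X$ such that $Y(S)=Y_0$.
   Context: Smooth means $C^\infty$; manifolds are smooth and finite-dimensional; superscripts $i$ denote coordinates. For $I\subseteq\mathbb{R}$, $\Delta I:=\{(s,t)\in I^2: s\le t\}$. A control function on $[S,T]$ is a continuous function $\omega:\Delta[S,T]\to[0,\infty)$ with $\omega(s,s)=0$ for all $s$ and $\omega(s,t)\ge\omega(s,u)+\omega(u,t)$ for all $S\le s\le u\le t\le T$. $\mathcal{F}_n^2$ is the set of non-empty forests of rooted trees with at most two vertices, with vertices labeled by $\{1,\dots,n\}$. Its elements are: the one-vertex trees, written $\alpha$; the forests made of two one-vertex trees, written $\alpha\cdot\beta=\beta\cdot\alpha$ (unordered, $\alpha=\beta$ allowed); and the two-vertex trees, written $\alpha|\beta$ (top vertex $\alpha$, bottom vertex $\beta$). The symmetry factor is $\sigma(\alpha)=1$, $\sigma(\alpha|\beta)=1$, $\sigma(\alpha\cdot\beta)=1$ if $\alpha\ne\beta$, and $\sigma(\alpha\cdot\alpha)=2$. For $p\in[1,3)$, an $n$-dimensional branched rough path on $[S,T]$ with regularity $p$ and control $\omega$ is a tuple $X=(X^\tau)_{\tau\in\mathcal{F}_n^2}$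 of functions $X^\tau:\Delta[S,T]\to\mathbb{R}$ such that for all $\alpha,\beta$ and all $S\le s\le u\le t\le T$: $X^\alpha(s,t)=X^\alpha(s,u)+X^\alpha(u,t)$; $X^{\alpha\cdot\beta}(s,t)=X^\alpha(s,t)X^\beta(s,t)$; $X^{\alpha|\beta}(s,t)=X^{\alpha|\beta}(s,u)+X^{\alpha|\beta}(u,t)+X^\alpha(s,u)X^\beta(u,t)$; and such that for some $C\in(0,\infty)$, $|X^\alpha(s,t)|\le C\omega(s,t)^{1/p}$, $|X^{\alpha\cdot\beta}(s,t)|\le C\omega(s,t)^{2/p}$, $|X^{\alpha|\beta}(s,t)|\le C\omega(s,t)^{2/p}$ for all $\alpha,\beta$ and $(s,t)\in\Delta[S,T]$. Rough velocity bundle. $F_{mn}^2$ is the real vector space of tuples $(f^i_\tau)$, $i\in\{1,\dots,m\}$, $\tau\in\mathcal{F}_n^2$. $G_m^2$ is the Lie group of invertible $2$-jets of smooth maps $\mathbb{R}^m\to\mathbb{R}^m$ with source and target $0$; a jet $a$ is written $(a^i_j,a^i_{jk})$ with $a^i_{jk}=a^i_{kj}$ (first and second partial derivatives at $0$). It acts on $F_{mn}^2$ from the left by $af=g$, $g^i_\alpha=\sum_j a^i_jf^j_\alpha$, $g^i_{\alpha\cdot\beta}=\sum_j a^i_jf^j_{\alpha\cdot\beta}+\sum_{j,k}a^i_{jk}f^j_\alpha f^k_\beta$, $g^i_{\alpha|\beta}=\sum_j a^i_jf^j_{\alpha|\beta}$. For an $m$-dimensional manifold $M$, let $P^2M$ be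 the second-order frame bundle ($2$-jets $j^2_0\psi$ at $0$ of local diffeomorphisms $\psi:\mathbb{R}^m\to M$), a principal $G_m^2$-bundle; $R_n^2M$ is the associated bundle with fiber $F_{mn}^2$, i.e. the set of classes $[(j_0^2\psi,f)]$ under $(j^2_0\psi,f)\sim(j^2_0(\psi\circ a),a^{-1}f)$, with projection $\pi[(j_0^2\psi,f)]=\psi(0)$. A chart $(U,x)$ on $M$ induces coordinates $(x^i,f^i_\tau)$ on $\pi^{-1}(U)$: the class $[(j_0^2\psi,f)]$ has base coordinates $x(\psi(0))$ and fiber coordinates $af$, where $a\in G_m^2$ consists of the first and second derivatives of $x\circ\psi$ at $0$. Under a change of charts from $(U,x)$ to $(V,y)$ the fiber coordinates at $p$ change by the action of the jet with $a^i_j=\frac{\partial y^i}{\partial x^j}(p)$, $a^i_{jk}=\frac{\partial^2y^i}{\partial x^j\partial x^k}(p)$. A rough velocity field on $M$ is a smooth section $f:M\to R_n^2M$; in a chart $(U,x)$ it is represented by smooth functions $f^i_\tau:U\to\mathbb{R}$. Its support is the closure of the set of points $p$ at which the fiber coordinates $(f^i_\tau(p))$ are not all zero (this is chart-independent). It is admissible if for every $p\in M$ there is a chart $(U,x)$ around $p$ in which $\sum_j\frac{\partial f^i_\beta}{\partial x^j}(p)f^j_\alpha(p)=f^i_{\alpha\cdot\beta}(p)+f^i_{\alpha|\beta}(p)$ for all $i,\alpha,\beta$ (this condition does not depend on the chart). A function $Y:[S,T]\to M$ is an integral curve of $f$ driven by $X$ if it is continuous and if for every compact interval $I\subseteq[S,T]$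 and every chart $(U,x)$ with $Y(I)\subseteq U$ there exists $C\in(0,\infty)$ such that $\left|Y^i(t)-Y^i(s)-\sum_{\tau\in\mathcal{F}_n^2}\frac{1}{\sigma(\tau)}f^i_\tau(Y(s))X^\tau(s,t)\right|\le C\omega(s,t)^{3/p}$ for every $i$ and $(s,t)\in\Delta I$, where $Y^i=x^i\circ Y$ and $(f^i_\tau)$ represents $f$ in the chart induced by $(U,x)$. *)

theory Defs
  imports "HOL-Analysis.Analysis" "HOL-Library.Uprod"
begin

section \<open>Branched rough paths\<close>

text \<open>
  \<^verbatim>\<open>Vertex a\<close> is the one-vertex tree, \<^verbatim>\<open>Dots (Upair a b)\<close> the forest $a \cdot b = b \cdot a$
  of two one-vertex trees, and \<^verbatim>\<open>Stack a b\<close> the tree $a|b$ with top vertex \<^verbatim>\<open>a\<close> and bottom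
  vertex \<^verbatim>\<open>b\<close>. Labels range over \<^verbatim>\<open>{1..n}\<close>; families indexed by forests are functions on
  the whole type, of which only the values on \<^verbatim>\<open>forests n\<close> matter.
\<close>

datatype forest = Vertex nat | Dots "nat uprod" | Stack nat nat

definition forests :: "nat \<Rightarrow> forest set" where
  "forests n = Vertex ` {1..n}
     \<union> {Dots (Upair \<alpha> \<beta>) |\<alpha> \<beta>. \<alpha> \<in> {1..n} \<and> \<beta> \<in> {1..n}}
     \<union> {Stack \<alpha> \<beta> |\<alpha> \<beta>. \<alpha> \<in> {1..n} \<and> \<beta> \<in> {1..n}}"

lemma finite_forests: "finite (forests n)"
  unfolding forests_def by (intro finite_UnI finite_imageI finite_image_set2) auto

fun sym_factor :: "forest \<Rightarrow> real" where
  "sym_factor (Vertex \<alpha>) = 1"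
| "sym_factor (Dots P) = (if proper_uprod P then 1 else 2)"
| "sym_factor (Stack \<alpha> \<beta>) = 1"

definition time_simplex :: "real set \<Rightarrow> (real \<times> real) set" where
  "time_simplex I = {(s, t). s \<in> I \<and> t \<in> I \<and> s \<le> t}"

definition control_function :: "real \<Rightarrow> real \<Rightarrow> (real \<Rightarrow> real \<Rightarrow> real) \<Rightarrow> bool" where
  "control_function S T \<omega> \<longleftrightarrow>
     continuous_on (time_simplex {S..T}) (\<lambda>(s, t). \<omega> s t) \<and>
     (\<forall>(s, t) \<in> time_simplex {S..T}. 0 \<le> \<omega> s t) \<and>
     (\<forall>s \<in> {S..T}. \<omega> s s = 0) \<and>
     (\<forall>s u t. S \<le> s \<and> s \<le> u \<and> u \<le> t \<and> t \<le> T \<longrightarrow> \<omega> s u + \<omega> u t \<le> \<omega> s t)"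

definition branched_rough_path ::
  "nat \<Rightarrow> real \<Rightarrow> real \<Rightarrow> real \<Rightarrow> (real \<Rightarrow> real \<Rightarrow> real) \<Rightarrow> (forest \<Rightarrow> real \<Rightarrow> real \<Rightarrow> real) \<Rightarrow> bool"
where
  "branched_rough_path n S T p \<omega> X \<longleftrightarrow>
     (\<forall>\<alpha> \<in> {1..n}. \<forall>\<beta> \<in> {1..n}. \<forall>s u t. S \<le> s \<and> s \<le> u \<and> u \<le> t \<and> t \<le> T \<longrightarrow>
        X (Vertex \<alpha>) s t = X (Vertex \<alpha>) s u + X (Vertex \<alpha>) u t \<and>
        X (Dots (Upair \<alpha> \<beta>)) s t = X (Vertex \<alpha>) s t * X (Vertex \<beta>) s t \<and>
        X (Stack \<alpha> \<beta>) s t =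
          X (Stack \<alpha> \<beta>) s u + X (Stack \<alpha> \<beta>) u t + X (Vertex \<alpha>) s u * X (Vertex \<beta>) u t) \<and>
     (\<exists>C>0. \<forall>\<alpha> \<in> {1..n}. \<forall>\<beta> \<in> {1..n}. \<forall>(s, t) \<in> time_simplex {S..T}.
        \<bar>X (Vertex \<alpha>) s t\<bar> \<le> C * \<omega> s t powr (1 / p) \<and>
        \<bar>X (Dots (Upair \<alpha> \<beta>)) s t\<bar> \<le> C * \<omega> s t powr (2 / p) \<and>
        \<bar>X (Stack \<alpha> \<beta>) s t\<bar> \<le> C * \<omega> s t powr (2 / p))"


section \<open>Calculus in coordinates and smooth manifolds\<close>

text \<open>
  $\mathbb{R}^m$ is \<^const>\<open>Euclidean_space\<close> \<^verbatim>\<open>m\<close>: functions \<^verbatim>\<open>nat \<Rightarrow> real\<close> that vanish at all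
  indices \<^verbatim>\<open>\<ge> m\<close>, so coordinates are indexed by \<^verbatim>\<open>i < m\<close> and \<^verbatim>\<open>m = 0\<close> is allowed.
\<close>

type_synonym vec = "nat \<Rightarrow> real"

abbreviation origin :: vec where
  "origin \<equiv> \<lambda>_. 0"

definition partial :: "nat \<Rightarrow> (vec \<Rightarrow> real) \<Rightarrow> vec \<Rightarrow> real" where
  "partial j F v = deriv (\<lambda>t. F (v(j := t))) (v j)"

text \<open>\<^verbatim>\<open>Ck_on\<close> and \<^verbatim>\<open>smooth_on\<close> are meant for sets \<^verbatim>\<open>V\<close> that are open in $\mathbb{R}^m$.\<close>

primrec Ck_on :: "nat \<Rightarrow> nat \<Rightarrow> vec set \<Rightarrow> (vec \<Rightarrow> real) \<Rightarrow> bool" where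
  "Ck_on m 0 V F \<longleftrightarrow> continuous_map (subtopology (Euclidean_space m) V) euclideanreal F"
| "Ck_on m (Suc k) V F \<longleftrightarrow>
     continuous_map (subtopology (Euclidean_space m) V) euclideanreal F \<and>
     (\<forall>j<m. (\<forall>v\<in>V. (\<lambda>t. F (v(j := t))) differentiable (at (v j))) \<and> Ck_on m k V (partial j F))"

definition smooth_on :: "nat \<Rightarrow> vec set \<Rightarrow> (vec \<Rightarrow> real) \<Rightarrow> bool" where
  "smooth_on m V F \<longleftrightarrow> (\<forall>k. Ck_on m k V F)"

text \<open>A chart is a pair \<^verbatim>\<open>(U, x)\<close>; the values of \<^verbatim>\<open>x\<close> outside \<^verbatim>\<open>U\<close> are irrelevant.\<close>

type_synonym 'a chart = "'a set \<times> ('a \<Rightarrow> vec)"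

definition is_chart :: "nat \<Rightarrow> 'a topology \<Rightarrow> 'a chart \<Rightarrow> bool" where
  "is_chart m M = (\<lambda>(U, x). openin M U \<and> openin (Euclidean_space m) (x ` U) \<and>
     homeomorphic_map (subtopology M U) (subtopology (Euclidean_space m) (x ` U)) x)"

definition smooth_transition :: "nat \<Rightarrow> 'a chart \<Rightarrow> 'a chart \<Rightarrow> bool" where
  "smooth_transition m = (\<lambda>(U, x) (V, y).
     \<forall>i<m. smooth_on m (x ` (U \<inter> V)) (\<lambda>v. y (inv_into U x v) i))"

definition compatible_charts :: "nat \<Rightarrow> 'a chart \<Rightarrow> 'a chart \<Rightarrow> bool" where
  "compatible_charts m c d \<longleftrightarrow> smooth_transition m c d \<and> smooth_transition m d c"

text \<open>The atlas \<^verbatim>\<open>A\<close> is the maximal one, i.e. the set of all charts of the manifold.\<close>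

definition smooth_manifold :: "nat \<Rightarrow> 'a topology \<Rightarrow> 'a chart set \<Rightarrow> bool" where
  "smooth_manifold m M A \<longleftrightarrow>
     Hausdorff_space M \<and> second_countable M \<and>
     (\<forall>c\<in>A. is_chart m M c) \<and> (\<Union>(U, x)\<in>A. U) = topspace M \<and>
     (\<forall>c\<in>A. \<forall>d\<in>A. compatible_charts m c d) \<and>
     (\<forall>c. is_chart m M c \<and> (\<forall>d\<in>A. compatible_charts m c d) \<longrightarrow> c \<in> A)"


section \<open>Second-order jets and frames\<close>

type_synonym jet2 = "(nat \<Rightarrow> nat \<Rightarrow> real) \<times> (nat \<Rightarrow> nat \<Rightarrow> nat \<Rightarrow> real)"

text \<open>
  The first and second partial derivatives at the origin of a map defined near the origin of
  $\mathbb{R}^m$. Entries with an index outside \<^verbatim>\<open>{..<m}\<close> are set to \<^verbatim>\<open>0\<close>, so that equality of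
  jets is equality of functions.
\<close>

definition jet2_at_0 :: "nat \<Rightarrow> (vec \<Rightarrow> vec) \<Rightarrow> jet2" where
  "jet2_at_0 m h =
     (\<lambda>i j. if i < m \<and> j < m then partial j (\<lambda>v. h v i) origin else 0,
      \<lambda>i j k. if i < m \<and> j < m \<and> k < m then partial j (partial k (\<lambda>v. h v i)) origin else 0)"

definition pointed_smooth_maps :: "nat \<Rightarrow> (vec \<Rightarrow> vec) set" where
  "pointed_smooth_maps m = {h. h origin = origin \<and>
     (\<exists>V. openin (Euclidean_space m) V \<and> origin \<in> V \<and> h ` V \<subseteq> topspace (Euclidean_space m) \<and>
       (\<forall>i<m. smooth_on m V (\<lambda>v. h v i)))}"

definition jet_group :: "nat \<Rightarrow> jet2 set" where
  "jet_group m = {jet2_at_0 m h |h. h \<in> pointed_smooth_maps m \<and>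
     (\<exists>h' \<in> pointed_smooth_maps m.
        jet2_at_0 m (h \<circ> h') = jet2_at_0 m id \<and> jet2_at_0 m (h' \<circ> h) = jet2_at_0 m id)}"

text \<open>A map is a diffeomorphism from \<^verbatim>\<open>V\<close> onto an open subset iff its inverse is a chart.\<close>

definition local_diffeo_at_0 :: "nat \<Rightarrow> 'a chart set \<Rightarrow> (vec \<Rightarrow> 'a) \<Rightarrow> bool" where
  "local_diffeo_at_0 m A \<psi> \<longleftrightarrow>
     (\<exists>V. openin (Euclidean_space m) V \<and> origin \<in> V \<and> inj_on \<psi> V \<and> (\<psi> ` V, inv_into V \<psi>) \<in> A)"

definition same_2jet :: "nat \<Rightarrow> 'a chart set \<Rightarrow> (vec \<Rightarrow> 'a) \<Rightarrow> (vec \<Rightarrow> 'a) \<Rightarrow> bool" where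
  "same_2jet m A \<psi> \<phi> \<longleftrightarrow> \<psi> origin = \<phi> origin \<and>
     (\<forall>(U, x)\<in>A. \<psi> origin \<in> U \<longrightarrow> jet2_at_0 m (x \<circ> \<psi>) = jet2_at_0 m (x \<circ> \<phi>))"

text \<open>The jet $j^2_0\psi$, as the class of all local diffeomorphisms with the same 2-jet at the origin.\<close>

definition frame_jet :: "nat \<Rightarrow> 'a chart set \<Rightarrow> (vec \<Rightarrow> 'a) \<Rightarrow> (vec \<Rightarrow> 'a) set" where
  "frame_jet m A \<psi> = {\<phi>. local_diffeo_at_0 m A \<phi> \<and> same_2jet m A \<psi> \<phi>}"

definition frame_bundle2 :: "nat \<Rightarrow> 'a chart set \<Rightarrow> (vec \<Rightarrow> 'a) set set" where
  "frame_bundle2 m A = {frame_jet m A \<psi> |\<psi>. local_diffeo_at_0 m A \<psi>}"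


section \<open>The rough velocity bundle\<close>

text \<open>The value \<^verbatim>\<open>f \<tau> i\<close> is the entry $f^i_\tau$ of a tuple.\<close>

type_synonym fibre = "forest \<Rightarrow> vec"

definition velocity_fibre :: "nat \<Rightarrow> nat \<Rightarrow> fibre set" where
  "velocity_fibre m n = {f. \<forall>\<tau> i. \<tau> \<notin> forests n \<or> m \<le> i \<longrightarrow> f \<tau> i = 0}"

text \<open>
  The two labels of $\alpha \cdot \beta$ are recovered as the minimum and the maximum of the pair;
  since $a^i_{jk} = a^i_{kj}$ their order is immaterial (see \<^verbatim>\<open>jet_act_Dots\<close> below).
\<close>

fun jet_act :: "nat \<Rightarrow> jet2 \<Rightarrow> fibre \<Rightarrow> fibre" where
  "jet_act m (a1, a2) f (Vertex \<alpha>) i =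
     (if i < m then \<Sum>j<m. a1 i j * f (Vertex \<alpha>) j else 0)"
| "jet_act m (a1, a2) f (Dots P) i =
     (if i < m then (\<Sum>j<m. a1 i j * f (Dots P) j)
        + (\<Sum>j<m. \<Sum>k<m. a2 i j k * f (Vertex (Min (set_uprod P))) j
                                       * f (Vertex (Max (set_uprod P))) k) else 0)"
| "jet_act m (a1, a2) f (Stack \<alpha> \<beta>) i =
     (if i < m then \<Sum>j<m. a1 i j * f (Stack \<alpha> \<beta>) j else 0)"

lemma jet_act_Dots:
  assumes "\<And>i j k. a2 i j k = a2 i k j" and "i < m"
  shows "jet_act m (a1, a2) f (Dots (Upair \<alpha> \<beta>)) i =
    (\<Sum>j<m. a1 i j * f (Dots (Upair \<alpha> \<beta>)) j)
      + (\<Sum>j<m. \<Sum>k<m. a2 i j k * f (Vertex \<alpha>) j * f (Vertex \<beta>) k)"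
proof (cases "\<alpha> \<le> \<beta>")
  case True
  then show ?thesis using assms(2) by (simp add: min_def max_def)
next
  case False
  have "(\<Sum>j<m. \<Sum>k<m. a2 i j k * f (Vertex \<beta>) j * f (Vertex \<alpha>) k)
      = (\<Sum>k<m. \<Sum>j<m. a2 i j k * f (Vertex \<beta>) j * f (Vertex \<alpha>) k)"
    by (rule sum.swap)
  also have "\<dots> = (\<Sum>j<m. \<Sum>k<m. a2 i j k * f (Vertex \<alpha>) j * f (Vertex \<beta>) k)"
    by (intro sum.cong refl) (subst assms(1), simp add: mult_ac)
  finally show ?thesis using False assms(2) by (simp add: min_def max_def)
qed

text \<open>
  The relation $(j^2_0\psi, af) \sim (j^2_0(\psi \circ a), f)$ for $a$ in the jet group, where on the
  right-hand side $a$ is represented by a map \<^verbatim>\<open>h\<close>.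
\<close>

definition bundle_rel ::
  "nat \<Rightarrow> nat \<Rightarrow> 'a chart set \<Rightarrow> (((vec \<Rightarrow> 'a) set \<times> fibre) \<times> ((vec \<Rightarrow> 'a) set \<times> fibre)) set"
where
  "bundle_rel m n A = {((P, f), (P', f')).
     P \<in> frame_bundle2 m A \<and> f \<in> velocity_fibre m n \<and>
     P' \<in> frame_bundle2 m A \<and> f' \<in> velocity_fibre m n \<and>
     (\<exists>\<psi> h. local_diffeo_at_0 m A \<psi> \<and> h \<in> pointed_smooth_maps m \<and> jet2_at_0 m h \<in> jet_group m \<and>
        P = frame_jet m A \<psi> \<and> P' = frame_jet m A (\<psi> \<circ> h) \<and> f = jet_act m (jet2_at_0 m h) f')}"

type_synonym 'a velocity = "((vec \<Rightarrow> 'a) set \<times> fibre) set"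

definition velocity_bundle :: "nat \<Rightarrow> nat \<Rightarrow> 'a chart set \<Rightarrow> 'a velocity set" where
  "velocity_bundle m n A = (frame_bundle2 m A \<times> velocity_fibre m n) // bundle_rel m n A"

definition base_point :: "nat \<Rightarrow> 'a chart set \<Rightarrow> 'a velocity \<Rightarrow> 'a" where
  "base_point m A c =
     (THE q. \<exists>\<psi> g. local_diffeo_at_0 m A \<psi> \<and> (frame_jet m A \<psi>, g) \<in> c \<and> q = \<psi> origin)"

text \<open>
  The fibre coordinates of a class in the chart with coordinate map \<^verbatim>\<open>x\<close>; they do not depend on
  the representative.
\<close>

definition fibre_coords :: "nat \<Rightarrow> 'a chart set \<Rightarrow> ('a \<Rightarrow> vec) \<Rightarrow> 'a velocity \<Rightarrow> fibre" where
  "fibre_coords m A x c =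
     (THE g. \<exists>\<psi> f. local_diffeo_at_0 m A \<psi> \<and> (frame_jet m A \<psi>, f) \<in> c \<and>
        g = jet_act m (jet2_at_0 m (x \<circ> \<psi>)) f)"


section \<open>Rough velocity fields and their integral curves\<close>

text \<open>
  Smoothness of a section is smoothness of its coordinate representation in the charts
  $(x^i, f^i_\tau)$ of the bundle, in which the base coordinates of a section are the identity.
\<close>

definition rough_velocity_field ::
  "nat \<Rightarrow> nat \<Rightarrow> 'a topology \<Rightarrow> 'a chart set \<Rightarrow> ('a \<Rightarrow> 'a velocity) \<Rightarrow> bool"
where
  "rough_velocity_field m n M A f \<longleftrightarrow>
     (\<forall>q \<in> topspace M. f q \<in> velocity_bundle m n A \<and> base_point m A (f q) = q) \<and>
     (\<forall>(U, x)\<in>A. \<forall>\<tau>\<in>forests n. \<forall>i<m.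
        smooth_on m (x ` U) (\<lambda>v. fibre_coords m A x (f (inv_into U x v)) \<tau> i))"

definition field_support ::
  "nat \<Rightarrow> nat \<Rightarrow> 'a topology \<Rightarrow> 'a chart set \<Rightarrow> ('a \<Rightarrow> 'a velocity) \<Rightarrow> 'a set"
where
  "field_support m n M A f = M closure_of
     {q. \<exists>(U, x)\<in>A. q \<in> U \<and> (\<exists>\<tau>\<in>forests n. \<exists>i<m. fibre_coords m A x (f q) \<tau> i \<noteq> 0)}"

definition admissible ::
  "nat \<Rightarrow> nat \<Rightarrow> 'a topology \<Rightarrow> 'a chart set \<Rightarrow> ('a \<Rightarrow> 'a velocity) \<Rightarrow> bool"
where
  "admissible m n M A f \<longleftrightarrow>
     (\<forall>q \<in> topspace M. \<exists>(U, x)\<in>A. q \<in> U \<and>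
        (\<forall>i<m. \<forall>\<alpha>\<in>{1..n}. \<forall>\<beta>\<in>{1..n}.
           (\<Sum>j<m. partial j (\<lambda>v. fibre_coords m A x (f (inv_into U x v)) (Vertex \<beta>) i) (x q)
                     * fibre_coords m A x (f q) (Vertex \<alpha>) j)
           = fibre_coords m A x (f q) (Dots (Upair \<alpha> \<beta>)) i
             + fibre_coords m A x (f q) (Stack \<alpha> \<beta>) i))"

definition integral_curve ::
  "nat \<Rightarrow> nat \<Rightarrow> 'a topology \<Rightarrow> 'a chart set \<Rightarrow> ('a \<Rightarrow> 'a velocity) \<Rightarrow>
   real \<Rightarrow> real \<Rightarrow> real \<Rightarrow> (real \<Rightarrow> real \<Rightarrow> real) \<Rightarrow> (forest \<Rightarrow> real \<Rightarrow> real \<Rightarrow> real) \<Rightarrow> (real \<Rightarrow> 'a) \<Rightarrow> bool"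
where
  "integral_curve m n M A f S T p \<omega> X Y \<longleftrightarrow>
     continuous_map (top_of_set {S..T}) M Y \<and>
     (\<forall>a b. {a..b} \<subseteq> {S..T} \<longrightarrow> (\<forall>(U, x)\<in>A. Y ` {a..b} \<subseteq> U \<longrightarrow>
        (\<exists>C>0. \<forall>i<m. \<forall>(s, t) \<in> time_simplex {a..b}.
           \<bar>x (Y t) i - x (Y s) i
              - (\<Sum>\<tau>\<in>forests n. 1 / sym_factor \<tau> * fibre_coords m A x (f (Y s)) \<tau> i * X \<tau> s t)\<bar>
           \<le> C * \<omega> s t powr (3 / p))))"

end

theory Submission
  imports Defs
begin

text \<open>
  In a chart, let $\mu_{st}(y) = y + \sum_\tau \sigma(\tau)^{-1} f_\tau(y) X^\tau(s,t)$ be the Euler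
  step of the field. Admissibility and Chen's relation make it an almost flow: $\mu_{ut} \circ \mu_{su}$
  differs from $\mu_{st}$ by $O(\omega(s,t)^{3/p})$, and $3/p > 1$. Davie's induction then shows that
  the Euler scheme over any finite set of times satisfies
  $|y_t - \mu_{st}(y_s)| \le L \omega(s,t)^{3/p}$ with $L$ independent of the times, as long as the
  total control is small; compactness of a product of balls yields a path satisfying this for all
  pairs of times. A second-order Taylor expansion transfers the estimate to any other chart, since
  the second derivatives of the transition map enter exactly as in the action of the jet group, and
  the almost flow property lets one concatenate paths. By compactness of the support the
  smallness required of the control is uniform in the starting point; off the support the constant
  path is a solution.
\<close>

section \<open>Coordinate calculus in the $l^1$ distance\<close>

text \<open>Admissibility is what gains the third order: expanding the second of two consecutive
  steps leaves a term of order h^2 with the derivative of the \<beta> component along the \<alpha>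
  component, Chen's relation leaves the sum of the coefficients of the two-vertex forests, and the
  field equates them. The exponent 3/p > 1 then gives 2 * 2^(-3/p) < 1, so two halves of an interval
  cost less than the whole. The obstacle is that an integral curve is tested in every chart and on
  every compact interval, whereas Euler steps make sense in one chart and only while they stay in
  its image. The working notion therefore demands the estimate only for increments below a threshold
  depending on the path. This weak form survives concatenation and change of chart, and on a compact
  image it yields the estimate for all increments with a larger constant. A path chosen by
  compactness carries no regularity a priori; its continuity is read off the estimate.\<close>

definition l1_dist :: "nat \<Rightarrow> vec \<Rightarrow> vec \<Rightarrow> real" where
  "l1_dist m v w = (\<Sum>i<m. \<bar>v i - w i\<bar>)"

lemma l1_dist_nonneg [simp]: "0 \<le> l1_dist m v w"
  by (simp add: l1_dist_def sum_nonneg)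

lemma l1_dist_refl [simp]: "l1_dist m v v = 0"
  by (simp add: l1_dist_def)

lemma l1_dist_commute: "l1_dist m v w = l1_dist m w v"
  by (simp add: l1_dist_def abs_minus_commute)

lemma l1_dist_triangle: "l1_dist m u w \<le> l1_dist m u v + l1_dist m v w"
  unfolding l1_dist_def sum.distrib[symmetric] by (intro sum_mono) auto

lemma coord_le_l1_dist: "i < m \<Longrightarrow> \<bar>v i - w i\<bar> \<le> l1_dist m v w"
  unfolding l1_dist_def by (rule member_le_sum[where f = "\<lambda>i. \<bar>v i - w i\<bar>"]) auto

text \<open>Coordinates beyond \<open>m\<close> are frozen at zero, so only finitely many factors of
  a basic open box of the product topology matter, and the smallest of their radii serves. This ties
  the topology of \<open>Euclidean_space m\<close> to the distance in which all estimates are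
  stated.\<close>

lemma openin_Euclidean_space_l1_ball:
  assumes "openin (Euclidean_space m) V" and "v \<in> V"
  obtains r where "r > 0"
    "\<And>w. w \<in> topspace (Euclidean_space m) \<Longrightarrow> l1_dist m v w \<le> r \<Longrightarrow> w \<in> V"
proof -
  have vE: "v \<in> topspace (Euclidean_space m)"
    using assms openin_subset by blast
  obtain W where W: "openin (powertop_real UNIV) W" "V = W \<inter> {x. \<forall>i\<ge>m. x i = 0}"
    using assms(1) unfolding Euclidean_space_def openin_subtopology by auto
  have "v \<in> W" using W assms by auto
  then obtain U where U: "\<And>i. open (U i)" "v \<in> PiE UNIV U" "PiE UNIV U \<subseteq> W"
    using W(1) unfolding openin_product_topology_alt by (auto simp: Ball_def) blast
  have "\<exists>r>0. \<forall>y. dist y (v i) < r \<longrightarrow> y \<in> U i" for i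
    using U(1,2) by (metis PiE_mem UNIV_I open_dist)
  then obtain r where r: "\<And>i. r i > 0" "\<And>i y. dist y (v i) < r i \<Longrightarrow> y \<in> U i"
    by metis
  \<comment> \<open>The inserted 1 keeps the minimum defined for \<open>m = 0\<close>; halving makes
    the inequality \<open>\<rho> < r i\<close> strict.\<close>
  define \<rho> where "\<rho> = Min (insert 1 (r ` {..<m})) / 2"
  have rho: "\<rho> > 0" using r(1) by (auto simp: \<rho>_def)
  have rho2: "\<rho> < r i" if "i < m" for i
  proof -
    have "Min (insert 1 (r ` {..<m})) \<le> r i" using that by (intro Min_le) auto
    then show ?thesis using r(1)[of i] unfolding \<rho>_def by linarith
  qed
  show thesis
  proof (rule that[OF rho])
    fix w assume w: "w \<in> topspace (Euclidean_space m)" "l1_dist m v w \<le> \<rho>"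
    have "w i \<in> U i" for i
    proof (cases "i < m")
      case True
      show ?thesis
        using coord_le_l1_dist[OF True, of v w] w(2) rho2[OF True]
        by (intro r(2)) (auto simp: dist_real_def)
    next
      case False
      then have "w i = v i" using w(1) vE by (auto simp: topspace_Euclidean_space)
      then show ?thesis using r by auto
    qed
    then have "w \<in> W" using U(3) by auto
    then show "w \<in> V" using W w(1) by (auto simp: topspace_Euclidean_space)
  qed
qed

text \<open>Bridge from the abstract topology to the type-class topology of functions, so that
  \<open>continuous_on\<close>, \<open>compact\<close> and \<open>closed\<close> become
  available.\<close>

lemma subtopology_Euclidean_space_eq:
  "V \<subseteq> topspace (Euclidean_space m) \<Longrightarrow> subtopology (Euclidean_space m) V = top_of_set V"
  by (simp add: Euclidean_space_def subtopology_subtopology euclidean_product_topology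
      topspace_Euclidean_space Int_absorb1)

lemma continuous_map_Euclidean_subspace_iff:
  assumes "V \<subseteq> topspace (Euclidean_space m)"
  shows "continuous_map (subtopology (Euclidean_space m) V) euclideanreal F \<longleftrightarrow> continuous_on V F"
  using assms by (simp add: subtopology_Euclidean_space_eq)

lemma continuous_l1_ball:
  assumes V: "openin (Euclidean_space m) V" and "v \<in> V" and F: "continuous_on V F" and "e > (0::real)"
  obtains r where "r > 0"
    "\<And>w. w \<in> topspace (Euclidean_space m) \<Longrightarrow> l1_dist m v w \<le> r \<Longrightarrow> w \<in> V \<and> \<bar>F w - F v\<bar> < e"
proof -
  have VE: "V \<subseteq> topspace (Euclidean_space m)" using V openin_subset by blast
  have "continuous_map (subtopology (Euclidean_space m) V) euclideanreal F"
    using F continuous_map_Euclidean_subspace_iff[OF VE] by blast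
  then have "openin (subtopology (Euclidean_space m) V)
      {w \<in> topspace (subtopology (Euclidean_space m) V). F w \<in> ball (F v) e}"
    by (rule openin_continuous_map_preimage) simp
  then have "openin (Euclidean_space m) {w \<in> V. F w \<in> ball (F v) e}"
    using V VE by (auto simp: openin_open_subtopology Int_absorb1)
  moreover have "v \<in> {w \<in> V. F w \<in> ball (F v) e}" using assms by auto
  ultimately show thesis
    by (rule openin_Euclidean_space_l1_ball)
       (use that in \<open>auto simp: dist_real_def abs_minus_commute\<close>)
qed

section \<open>Compactness in product spaces and closed tubes around compact sets\<close>

lemma compact_imp_bounded_real:
  fixes F :: "'a::topological_space \<Rightarrow> real"
  assumes "compact Z" "continuous_on Z F"
  obtains K where "K > 0" "\<And>z. z \<in> Z \<Longrightarrow> \<bar>F z\<bar> \<le> K"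
proof -
  have "bounded (F ` Z)"
    using assms compact_continuous_image compact_imp_bounded by blast
  then show thesis using that unfolding bounded_pos by auto
qed

text \<open>One continuous function, the sum of all absolute values, dominates the whole finite
  family.\<close>

lemma compact_finite_bounded_real:
  fixes F :: "'i \<Rightarrow> 'a::topological_space \<Rightarrow> real"
  assumes "compact Z" "finite J" "\<And>j. j \<in> J \<Longrightarrow> continuous_on Z (F j)"
  obtains K where "K > 0" "\<And>j z. j \<in> J \<Longrightarrow> z \<in> Z \<Longrightarrow> \<bar>F j z\<bar> \<le> K"
proof -
  have "continuous_on Z (\<lambda>z. \<Sum>j\<in>J. \<bar>F j z\<bar>)"
    using assms(3) by (intro continuous_intros) auto
  then obtain K where K: "K > 0" "\<And>z. z \<in> Z \<Longrightarrow> \<bar>\<Sum>j\<in>J. \<bar>F j z\<bar>\<bar> \<le> K"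
    using compact_imp_bounded_real[OF assms(1)] by metis
  show thesis
  proof (rule that[OF K(1)])
    fix j z assume "j \<in> J" "z \<in> Z"
    then have "\<bar>F j z\<bar> \<le> (\<Sum>j\<in>J. \<bar>F j z\<bar>)"
      by (intro member_le_sum) (auto simp: assms)
    then show "\<bar>F j z\<bar> \<le> K" using K(2)[OF \<open>z \<in> Z\<close>] by simp
  qed
qed

text \<open>Tychonoff's theorem for the type-class topology. It is used at two levels: for boxes of
  coordinates, and later for paths as points of a product over all times.\<close>

lemma compact_PiE_UNIV:
  fixes B :: "'i \<Rightarrow> 'a::topological_space set"
  assumes "\<And>i. compact (B i)"
  shows "compact {f. \<forall>i. f i \<in> B i}"
proof -
  have "compactin (product_topology (\<lambda>i. euclidean) UNIV) (PiE UNIV B)"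
    using assms by (subst compactin_PiE) auto
  moreover have "PiE UNIV B = {f. \<forall>i. f i \<in> B i}" by (auto simp: PiE_def)
  ultimately show ?thesis by (simp add: euclidean_product_topology)
qed

lemma closed_Euclidean_space: "closed (topspace (Euclidean_space m))"
  using closedin_Euclidean_imp_closed[of m] by blast

definition l1_tube :: "nat \<Rightarrow> vec set \<Rightarrow> real \<Rightarrow> vec set" where
  "l1_tube m Z r = {w \<in> topspace (Euclidean_space m). \<exists>z\<in>Z. l1_dist m z w \<le> r}"

text \<open>The tube is the image of \<open>Z \<times> D\<close> under addition, with
  \<open>D\<close> the closed l1 ball around the origin, which is a closed subset of a compact
  cube.\<close>

lemma compact_l1_tube:
  assumes "compact Z" "Z \<subseteq> topspace (Euclidean_space m)"
  shows "compact (l1_tube m Z r)"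
proof -
  define D where "D = {h \<in> topspace (Euclidean_space m). l1_dist m (\<lambda>_. 0) h \<le> r}"
  have "compact {h::vec. \<forall>i. h i \<in> cball 0 \<bar>r\<bar>}"
    by (rule compact_PiE_UNIV) simp
  moreover have "closed D"
  proof -
    have "D = topspace (Euclidean_space m) \<inter> {h. l1_dist m (\<lambda>_. 0) h \<le> r}" by (auto simp: D_def)
    moreover have "closed {h. l1_dist m (\<lambda>_. 0) h \<le> r}"
      unfolding l1_dist_def by (intro closed_Collect_le continuous_intros) auto
    ultimately show ?thesis using closed_Euclidean_space by auto
  qed
  moreover have "D \<subseteq> {h. \<forall>i. h i \<in> cball 0 \<bar>r\<bar>}"
  proof (clarsimp simp: D_def)
    fix h :: vec and i
    assume h: "h \<in> topspace (Euclidean_space m)" "l1_dist m (\<lambda>_. 0) h \<le> r"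
    show "\<bar>h i\<bar> \<le> \<bar>r\<bar>"
    proof (cases "i < m")
      case True then show ?thesis using coord_le_l1_dist[OF True, of "\<lambda>_. 0" h] h by simp
    next
      case False then show ?thesis using h by (simp add: topspace_Euclidean_space)
    qed
  qed
  ultimately have "compact D"
    by (metis Int_absorb1 compact_Int_closed Int_commute)
  with assms(1) have "compact (Z \<times> D)" by (rule compact_Times)
  moreover have "continuous_on (Z \<times> D) (\<lambda>p i. fst p i + snd p i)"
    by (rule continuous_on_coordinatewise_then_product, rule continuous_on_add;
        rule continuous_on_product_then_coordinatewise, intro continuous_intros)
  ultimately have "compact ((\<lambda>(z, h). \<lambda>i. z i + h i) ` (Z \<times> D))"
    unfolding case_prod_beta by (rule compact_continuous_image[rotated])
  moreover have "(\<lambda>(z, h). \<lambda>i. z i + h i) ` (Z \<times> D) = l1_tube m Z r"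
  proof (intro equalityI subsetI)
    fix w assume "w \<in> l1_tube m Z r"
    then obtain z where z: "w \<in> topspace (Euclidean_space m)" "z \<in> Z" "l1_dist m z w \<le> r"
      by (auto simp: l1_tube_def)
    then have "(\<lambda>i. w i - z i) \<in> D"
      using assms(2) by (auto simp: D_def topspace_Euclidean_space l1_dist_def abs_minus_commute)
    then show "w \<in> (\<lambda>(z, h). \<lambda>i. z i + h i) ` (Z \<times> D)"
      using z(2) by (intro image_eqI[of _ _ "(z, \<lambda>i. w i - z i)"]) auto
  next
    fix w assume "w \<in> (\<lambda>(z, h). \<lambda>i. z i + h i) ` (Z \<times> D)"
    then obtain z h where "z \<in> Z" "h \<in> D" "w = (\<lambda>i. z i + h i)" by auto
    then show "w \<in> l1_tube m Z r" using assms(2)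
      by (auto simp: l1_tube_def D_def topspace_Euclidean_space l1_dist_def subset_iff intro!: bexI[of _ z])
  qed
  ultimately show ?thesis by simp
qed

text \<open>Lebesgue number argument: finitely many balls centred in \<open>Z\<close> cover it, and
  the smallest radius is a common margin.\<close>

lemma compact_l1_tube_in_open:
  assumes Z: "compact Z" "Z \<subseteq> V" and V: "openin (Euclidean_space m) V"
  obtains r where "r > 0" "l1_tube m Z r \<subseteq> V"
proof -
  have VE: "V \<subseteq> topspace (Euclidean_space m)" using V openin_subset by blast
  \<comment> \<open>The double radius is spent twice: one \<open>r z\<close> on covering
    \<open>Z\<close>, one on the distance from \<open>Z\<close> to a point of the tube.\<close>
  have "\<exists>r>0. \<forall>w\<in>topspace (Euclidean_space m). l1_dist m z w \<le> 2 * r \<longrightarrow> w \<in> V" if z: "z \<in> Z" for z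
  proof -
    obtain r where "r > 0" "\<And>w. w \<in> topspace (Euclidean_space m) \<Longrightarrow> l1_dist m z w \<le> r \<Longrightarrow> w \<in> V"
      using openin_Euclidean_space_l1_ball[OF V subsetD[OF Z(2) z]] by metis
    then show ?thesis by (intro exI[of _ "r/2"]) auto
  qed
  then obtain r where r: "\<And>z. z \<in> Z \<Longrightarrow> r z > 0"
    "\<And>z w. z \<in> Z \<Longrightarrow> w\<in>topspace (Euclidean_space m) \<Longrightarrow> l1_dist m z w \<le> 2 * r z \<Longrightarrow> w \<in> V"
    by metis
  have "open {w. l1_dist m z w < r z}" for z
    unfolding l1_dist_def by (intro open_Collect_less continuous_intros) auto
  moreover have "Z \<subseteq> (\<Union>z\<in>Z. {w. l1_dist m z w < r z})" using r(1) by auto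
  ultimately obtain F where F: "F \<subseteq> Z" "finite F" "Z \<subseteq> (\<Union>z\<in>F. {w. l1_dist m z w < r z})"
    by (rule compactE_image[OF Z(1), of Z "\<lambda>z. {w. l1_dist m z w < r z}"])
  define \<rho> where "\<rho> = Min (insert 1 (r ` F))"
  have "\<rho> > 0" using F(1,2) r(1) by (auto simp: \<rho>_def)
  moreover have "l1_tube m Z \<rho> \<subseteq> V"
  proof
    fix w assume "w \<in> l1_tube m Z \<rho>"
    then obtain z where z: "w \<in> topspace (Euclidean_space m)" "z \<in> Z" "l1_dist m z w \<le> \<rho>"
      by (auto simp: l1_tube_def)
    then obtain y where y: "y \<in> F" "l1_dist m y z < r y" using F(3) by auto
    have "\<rho> \<le> r y" unfolding \<rho>_def using F(2) y(1) by (intro Min_le) auto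
    then have "l1_dist m y w \<le> 2 * r y" using l1_dist_triangle[of m y w z] y z by linarith
    then show "w \<in> V" using r(2) y F z by blast
  qed
  ultimately show thesis by (rule that)
qed

section \<open>Differentiability and chain rules from partial derivatives\<close>

lemma smooth_on_continuous:
  assumes "smooth_on m V F" "openin (Euclidean_space m) V"
  shows "continuous_on V F"
proof -
  have "Ck_on m 0 V F" using assms(1) unfolding smooth_on_def by blast
  then show ?thesis
    using continuous_map_Euclidean_subspace_iff[OF openin_subset[OF assms(2)]] by simp
qed

lemma smooth_on_partial:
  assumes "smooth_on m V F" "j < m"
  shows "smooth_on m V (partial j F)"
  unfolding smooth_on_def
proof
  fix k
  have "Ck_on m (Suc k) V F" using assms(1) unfolding smooth_on_def by blast
  then show "Ck_on m k V (partial j F)" using assms(2) by simp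
qed

lemma smooth_on_has_partial:
  assumes "smooth_on m V F" "j < m" "v \<in> V"
  shows "((\<lambda>t. F (v(j := t))) has_real_derivative partial j F v) (at (v j))"
proof -
  have "Ck_on m (Suc 0) V F" using assms(1) unfolding smooth_on_def by blast
  then have "(\<lambda>t. F (v(j := t))) differentiable (at (v j))" using assms(2,3) by simp
  then show ?thesis
    unfolding partial_def
    using DERIV_deriv_iff_real_differentiable by blast
qed

lemma Ck_on_subset:
  assumes "Ck_on m k V F" "V' \<subseteq> V"
  shows "Ck_on m k V' F"
  using assms(1)
proof (induction k arbitrary: F)
  case 0
  then show ?case using assms(2) continuous_map_from_subtopology_mono by auto
next
  case (Suc k)
  then show ?case using assms(2) continuous_map_from_subtopology_mono by auto
qed

lemma smooth_on_subset: "smooth_on m V F \<Longrightarrow> V' \<subseteq> V \<Longrightarrow> smooth_on m V' F"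
  unfolding smooth_on_def using Ck_on_subset by blast

lemma fun_upd_Euclidean_space:
  "v \<in> topspace (Euclidean_space m) \<Longrightarrow> j < m \<Longrightarrow> v(j := t) \<in> topspace (Euclidean_space m)"
  by (auto simp: topspace_Euclidean_space)

text \<open>Continuous partial derivatives give total differentiability: pass from \<open>v\<close>
  to \<open>w\<close> one coordinate at a time and apply the mean value inequality on each leg,
  where the partial derivative differs from its value at \<open>v\<close> by less than
  \<open>e\<close>.\<close>

lemma smooth_on_linear_approximation:
  assumes F: "smooth_on m V F" and V: "openin (Euclidean_space m) V" and v: "v \<in> V" and e: "e > 0"
  obtains r where "r > 0"
    "\<And>w. w \<in> topspace (Euclidean_space m) \<Longrightarrow> l1_dist m v w \<le> r \<Longrightarrow>
       w \<in> V \<and> \<bar>F w - F v - (\<Sum>j<m. partial j F v * (w j - v j))\<bar> \<le> e * l1_dist m v w"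
proof -
  have vE: "v \<in> topspace (Euclidean_space m)" using v V openin_subset by blast
  have "\<exists>r>0. \<forall>w\<in>topspace (Euclidean_space m). l1_dist m v w \<le> r \<longrightarrow>
          w \<in> V \<and> \<bar>partial j F w - partial j F v\<bar> < e" if "j < m" for j
    using continuous_l1_ball[OF V v smooth_on_continuous[OF smooth_on_partial[OF F that] V] e]
    by metis
  then obtain r where r: "\<And>j. j < m \<Longrightarrow> r j > 0"
    "\<And>j w. j < m \<Longrightarrow> w \<in> topspace (Euclidean_space m) \<Longrightarrow> l1_dist m v w \<le> r j \<Longrightarrow>
          w \<in> V \<and> \<bar>partial j F w - partial j F v\<bar> < e"
    by metis
  obtain r0 where r0: "r0 > 0"
    "\<And>w. w \<in> topspace (Euclidean_space m) \<Longrightarrow> l1_dist m v w \<le> r0 \<Longrightarrow> w \<in> V"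
    using openin_Euclidean_space_l1_ball[OF V v] by metis
  define \<rho> where "\<rho> = Min (insert r0 (r ` {..<m}))"
  have rho: "\<rho> > 0" using r(1) r0(1) by (auto simp: \<rho>_def)
  have rho0: "\<rho> \<le> r0" unfolding \<rho>_def by (intro Min_le) auto
  have rhoj: "\<rho> \<le> r j" if "j < m" for j unfolding \<rho>_def using that by (intro Min_le) auto
  show thesis
  proof (rule that[OF rho])
    fix w assume w: "w \<in> topspace (Euclidean_space m)" "l1_dist m v w \<le> \<rho>"
    have "w \<in> V" using r0(2) w rho0 by auto
    moreover have "\<bar>F w - F v - (\<Sum>j<m. partial j F v * (w j - v j))\<bar> \<le> e * l1_dist m v w"
    proof -
      \<comment> \<open>Staircase from \<open>v\<close> to \<open>w\<close>: the first
        \<open>k\<close> coordinates are already those of \<open>w\<close>. All its legs stay within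
        \<open>l1_dist m v w\<close> of \<open>v\<close>.\<close>
      define p where "p k = (\<lambda>i. if i < k then w i else v i)" for k
      have p0: "p 0 = v" by (simp add: p_def)
      have pm: "p m = w"
        using w(1) vE by (auto simp: p_def topspace_Euclidean_space fun_eq_iff)
      have step: "\<bar>F (p (Suc k)) - F (p k) - partial k F v * (w k - v k)\<bar> \<le> e * \<bar>w k - v k\<bar>"
        if k: "k < m" for k
      proof -
        define g where "g t = F ((p k)(k := t)) - partial k F v * t" for t
        define S where "S = closed_segment (v k) (w k)"
        have inS: "(p k)(k := t) \<in> V \<and> \<bar>partial k F ((p k)(k := t)) - partial k F v\<bar> < e"
          if "t \<in> S" for t
        proof (rule r(2)[OF k])
          show "(p k)(k := t) \<in> topspace (Euclidean_space m)"
            using k w(1) vE by (auto simp: p_def topspace_Euclidean_space)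
          have "l1_dist m v ((p k)(k := t)) \<le> l1_dist m v w"
            unfolding l1_dist_def
          proof (rule sum_mono)
            fix i assume "i \<in> {..<m}"
            show "\<bar>v i - ((p k)(k := t)) i\<bar> \<le> \<bar>v i - w i\<bar>"
              using that by (auto simp: p_def S_def closed_segment_eq_real_ivl split: if_splits)
          qed
          then show "l1_dist m v ((p k)(k := t)) \<le> r k" using w(2) rhoj[OF k] by linarith
        qed
        have "(g has_real_derivative (partial k F ((p k)(k := t)) - partial k F v)) (at t within S)"
          if "t \<in> S" for t
        proof -
          have "((\<lambda>s. F (((p k)(k := t))(k := s))) has_real_derivative partial k F ((p k)(k := t)))
             (at (((p k)(k := t)) k))"
            using inS[OF that] by (intro smooth_on_has_partial[OF F k]) auto
          then have "((\<lambda>s. F ((p k)(k := s))) has_real_derivative partial k F ((p k)(k := t))) (at t)"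
            by simp
          then have "(g has_real_derivative (partial k F ((p k)(k := t)) - partial k F v)) (at t)"
            unfolding g_def by (auto intro!: derivative_eq_intros)
          then show ?thesis by (rule has_field_derivative_at_within)
        qed
        moreover have "norm (partial k F ((p k)(k := t)) - partial k F v) \<le> e" if "t \<in> S" for t
          using inS[OF that] by auto
        ultimately have "norm (g (w k) - g (v k)) \<le> e * norm (w k - v k)"
          by (intro field_differentiable_bound[of S]) (auto simp: S_def)
        moreover have "(p k)(k := w k) = p (Suc k)" "(p k)(k := v k) = p k"
          by (auto simp: p_def fun_eq_iff)
        ultimately show ?thesis by (simp add: g_def algebra_simps)
      qed
      have "F w - F v = (\<Sum>k<m. F (p (Suc k)) - F (p k))"
        using sum_lessThan_telescope[of "\<lambda>k. F (p k)" m] p0 pm by simp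
      then have "F w - F v - (\<Sum>j<m. partial j F v * (w j - v j))
          = (\<Sum>k<m. F (p (Suc k)) - F (p k) - partial k F v * (w k - v k))"
        by (simp add: sum_subtractf)
      also have "\<bar>\<dots>\<bar> \<le> (\<Sum>k<m. e * \<bar>w k - v k\<bar>)"
        using step by (intro order_trans[OF sum_abs sum_mono]) auto
      also have "\<dots> = e * l1_dist m v w"
        by (simp add: l1_dist_def sum_distrib_left abs_minus_commute)
      finally show ?thesis .
    qed
    ultimately show "w \<in> V \<and> \<bar>F w - F v - (\<Sum>j<m. partial j F v * (w j - v j))\<bar> \<le> e * l1_dist m v w" ..
  qed
qed

lemma l1_dist_tendsto_0:
  fixes c :: "real \<Rightarrow> vec"
  assumes "\<And>j. j < m \<Longrightarrow> isCont (\<lambda>t. c t j) t0"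
  shows "((\<lambda>t. l1_dist m (c t0) (c t)) \<longlongrightarrow> 0) (at t0)"
proof -
  have "((\<lambda>t. \<bar>c t0 j - c t j\<bar>) \<longlongrightarrow> 0) (at t0)" if "j < m" for j
  proof -
    have "((\<lambda>t. \<bar>c t0 j - c t j\<bar>) \<longlongrightarrow> \<bar>c t0 j - c t0 j\<bar>) (at t0)"
      using assms[OF that] by (intro tendsto_intros) (simp add: isCont_def)
    then show ?thesis by simp
  qed
  then have "((\<lambda>t. \<Sum>j<m. \<bar>c t0 j - c t j\<bar>) \<longlongrightarrow> (\<Sum>j<m. 0)) (at t0)"
    by (intro tendsto_sum) auto
  then show ?thesis by (simp add: l1_dist_def)
qed

lemma eventually_curve_in_open:
  fixes c :: "real \<Rightarrow> vec"
  assumes "\<And>j. j < m \<Longrightarrow> isCont (\<lambda>t. c t j) t0"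
    and "\<forall>\<^sub>F t in at t0. c t \<in> topspace (Euclidean_space m)"
    and "openin (Euclidean_space m) V" "c t0 \<in> V"
  shows "\<forall>\<^sub>F t in at t0. c t \<in> V"
proof -
  obtain r where r: "r > 0" "\<And>w. w \<in> topspace (Euclidean_space m) \<Longrightarrow> l1_dist m (c t0) w \<le> r \<Longrightarrow> w \<in> V"
    using openin_Euclidean_space_l1_ball[OF assms(3,4)] by metis
  have "((\<lambda>t. l1_dist m (c t0) (c t)) \<longlongrightarrow> 0) (at t0)"
    by (rule l1_dist_tendsto_0) (rule assms(1))
  from assms(2) order_tendstoD(2)[OF this r(1)] show ?thesis
    by eventually_elim (use r(2) in auto)
qed

text \<open>The linear approximation at \<open>c t0\<close> is divided by \<open>t - t0\<close>; its
  error vanishes because the difference quotients of the coordinates converge and hence stay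
  bounded. Lying in \<open>Euclidean_space m\<close> is asked of the curve near \<open>t0\<close>
  only, which suits compositions defined on open sets.\<close>

lemma smooth_on_chain_rule_curve:
  assumes F: "smooth_on m V F" and V: "openin (Euclidean_space m) V" and c0: "c t0 \<in> V"
    and cE: "\<forall>\<^sub>F t in at t0. c t \<in> topspace (Euclidean_space m)"
    and d: "\<And>j. j < m \<Longrightarrow> ((\<lambda>t. c t j) has_real_derivative d j) (at t0)"
  shows "((\<lambda>t. F (c t)) has_real_derivative (\<Sum>j<m. partial j F (c t0) * d j)) (at t0)"
proof -
  let ?q = "\<lambda>j t. (c t j - c t0 j) / (t - t0)"
  let ?R = "\<lambda>t. F (c t) - F (c t0) - (\<Sum>j<m. partial j F (c t0) * (c t j - c t0 j))"
  have q: "(?q j \<longlongrightarrow> d j) (at t0)" if "j < m" for j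
    using d[OF that] unfolding has_field_derivative_iff .
  have dist0: "((\<lambda>t. l1_dist m (c t0) (c t)) \<longlongrightarrow> 0) (at t0)"
    using d by (intro l1_dist_tendsto_0) (rule DERIV_isCont)
  have "((\<lambda>t. ?R t / (t - t0)) \<longlongrightarrow> 0) (at t0)"
  proof (rule tendstoI)
    fix e :: real assume e: "e > 0"
    \<comment> \<open>Eventually a bound for the sum of the absolute difference quotients; the 1
      leaves room for a strict inequality and makes \<open>D\<close> positive.\<close>
    define D where "D = (\<Sum>j<m. \<bar>d j\<bar>) + 1"
    have D: "D > 0" by (simp add: D_def sum_nonneg add_nonneg_pos)
    obtain r where r: "r > 0" "\<And>w. w \<in> topspace (Euclidean_space m) \<Longrightarrow> l1_dist m (c t0) w \<le> r \<Longrightarrow>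
       w \<in> V \<and> \<bar>F w - F (c t0) - (\<Sum>j<m. partial j F (c t0) * (w j - c t0 j))\<bar>
         \<le> e / (2 * D) * l1_dist m (c t0) w"
      by (rule smooth_on_linear_approximation[OF F V c0, of "e / (2 * D)"]) (use e D in auto)
    have "((\<lambda>t. \<Sum>j<m. \<bar>?q j t\<bar>) \<longlongrightarrow> (\<Sum>j<m. \<bar>d j\<bar>)) (at t0)"
      using q by (intro tendsto_sum tendsto_rabs) auto
    then have "\<forall>\<^sub>F t in at t0. (\<Sum>j<m. \<bar>?q j t\<bar>) < D"
      by (rule order_tendstoD) (simp add: D_def)
    moreover have "\<forall>\<^sub>F t in at t0. l1_dist m (c t0) (c t) < r"
      using order_tendstoD(2)[OF dist0 r(1)] .
    moreover have "\<forall>\<^sub>F t in at t0. t \<noteq> t0" by (simp add: eventually_at_filter)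
    ultimately show "\<forall>\<^sub>F t in at t0. dist (?R t / (t - t0)) 0 < e"
      using cE
    proof eventually_elim
      case (elim t)
      have "\<bar>?R t\<bar> \<le> e / (2 * D) * l1_dist m (c t0) (c t)" using r(2)[of "c t"] elim by auto
      then have "\<bar>?R t\<bar> / \<bar>t - t0\<bar> \<le> e / (2 * D) * l1_dist m (c t0) (c t) / \<bar>t - t0\<bar>"
        by (intro divide_right_mono) auto
      also have "\<dots> = e / (2 * D) * (\<Sum>j<m. \<bar>?q j t\<bar>)"
        by (simp add: l1_dist_def sum_divide_distrib[symmetric] abs_minus_commute)
      also have "\<dots> \<le> e / (2 * D) * D"
        using elim e D by (intro mult_left_mono) auto
      also have "\<dots> < e" using e D by simp
      finally show ?case by (simp add: abs_divide)
    qed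
  qed
  moreover have "((\<lambda>t. \<Sum>j<m. partial j F (c t0) * ?q j t) \<longlongrightarrow> (\<Sum>j<m. partial j F (c t0) * d j)) (at t0)"
    using q by (intro tendsto_sum tendsto_mult tendsto_const) auto
  ultimately have "((\<lambda>t. ?R t / (t - t0) + (\<Sum>j<m. partial j F (c t0) * ?q j t))
      \<longlongrightarrow> 0 + (\<Sum>j<m. partial j F (c t0) * d j)) (at t0)"
    by (rule tendsto_add)
  moreover have "?R t / (t - t0) + (\<Sum>j<m. partial j F (c t0) * ?q j t) = (F (c t) - F (c t0)) / (t - t0)" for t
    unfolding diff_divide_distrib[of "F (c t) - F (c t0)"] by (simp add: sum_divide_distrib)
  ultimately show ?thesis unfolding has_field_derivative_iff by simp
qed

lemma eventually_fun_upd_in_open: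
  assumes V: "openin (Euclidean_space m) V" and v: "v \<in> V" and j: "j < m"
  shows "\<forall>\<^sub>F t in nhds (v j). v(j := t) \<in> V"
proof -
  obtain r where r: "r > 0" "\<And>w. w \<in> topspace (Euclidean_space m) \<Longrightarrow> l1_dist m v w \<le> r \<Longrightarrow> w \<in> V"
    using openin_Euclidean_space_l1_ball[OF V v] by metis
  have "v(j := t) \<in> V" if "dist t (v j) < r" for t
  proof (rule r(2))
    show "v(j := t) \<in> topspace (Euclidean_space m)"
      using v V j openin_subset by (intro fun_upd_Euclidean_space) blast+
    have "l1_dist m v (v(j := t)) = (\<Sum>i<m. if i = j then \<bar>v j - t\<bar> else 0)"
      unfolding l1_dist_def by (intro sum.cong) auto
    also have "\<dots> = \<bar>v j - t\<bar>" using j by simp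
    finally show "l1_dist m v (v(j := t)) \<le> r" using that by (simp add: dist_real_def)
  qed
  then show ?thesis using r(1) unfolding eventually_nhds_metric by blast
qed

lemma partial_comp:
  assumes V: "openin (Euclidean_space m) V" and v: "v \<in> V"
    and h: "\<And>i. i < m \<Longrightarrow> smooth_on m V (\<lambda>w. h w i)" and hE: "h ` V \<subseteq> topspace (Euclidean_space m)"
    and W: "openin (Euclidean_space m) W" and hv: "h v \<in> W" and F: "smooth_on m W F" and k: "k < m"
  shows has_partial_comp: "((\<lambda>t. F (h (v(k := t)))) has_real_derivative
      (\<Sum>l<m. partial l F (h v) * partial k (\<lambda>w. h w l) v)) (at (v k))"
    and partial_comp_eq: "partial k (\<lambda>w. F (h w)) v = (\<Sum>l<m. partial l F (h v) * partial k (\<lambda>w. h w l) v)"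
proof -
  have ev: "\<forall>\<^sub>F t in at (v k). h (v(k := t)) \<in> topspace (Euclidean_space m)"
    using eventually_fun_upd_in_open[OF V v k] hE
    unfolding eventually_at_filter by (auto elim!: eventually_mono)
  have "((\<lambda>t. F (h (v(k := t)))) has_real_derivative
      (\<Sum>l<m. partial l F (h (v(k := v k))) * partial k (\<lambda>w. h w l) v)) (at (v k))"
    using ev hv
    by (intro smooth_on_chain_rule_curve[OF F W]) (auto intro: smooth_on_has_partial[OF h k v])
  then show *: "((\<lambda>t. F (h (v(k := t)))) has_real_derivative
      (\<Sum>l<m. partial l F (h v) * partial k (\<lambda>w. h w l) v)) (at (v k))"
    by simp
  show "partial k (\<lambda>w. F (h w)) v = (\<Sum>l<m. partial l F (h v) * partial k (\<lambda>w. h w l) v)"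
    unfolding partial_def using DERIV_imp_deriv[OF *] by (simp add: partial_def)
qed

lemma openin_Euclidean_preimage:
  assumes V: "openin (Euclidean_space m) V" and h: "\<And>i. i < m \<Longrightarrow> continuous_on V (\<lambda>w. h w i)"
    and hE: "h ` V \<subseteq> topspace (Euclidean_space m)" and W: "openin (Euclidean_space m) W"
  shows "openin (Euclidean_space m) {v \<in> V. h v \<in> W}"
proof -
  have VE: "V \<subseteq> topspace (Euclidean_space m)" using V openin_subset by blast
  note top = subtopology_Euclidean_space_eq[OF VE]
  obtain W' where W': "open W'" "W = W' \<inter> topspace (Euclidean_space m)"
    using W unfolding Euclidean_space_def openin_subtopology
    by (auto simp: topspace_Euclidean_space euclidean_product_topology)
  have "continuous_on V h"
  proof (rule continuous_on_coordinatewise_then_product)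
    fix i show "continuous_on V (\<lambda>x. h x i)"
    proof (cases "i < m")
      case True then show ?thesis by (rule h)
    next
      case False
      then have "continuous_on V (\<lambda>x. h x i) \<longleftrightarrow> continuous_on V (\<lambda>x. 0::real)"
        using hE by (intro continuous_on_cong) (auto simp: topspace_Euclidean_space)
      then show ?thesis by simp
    qed
  qed
  then have "openin (top_of_set V) (V \<inter> h -` W')"
    using W'(1) continuous_openin_preimage_gen by blast
  moreover have "V \<inter> h -` W' = {v \<in> V. h v \<in> W}" using W' hE by auto
  ultimately show ?thesis using V top openin_trans_full by metis
qed

text \<open>The first-order formula is differentiated once more, so it must hold on a whole
  neighbourhood: \<open>V'\<close> is the open part of \<open>V\<close> that \<open>h\<close> maps
  into \<open>W\<close>. The two kinds of summands reappear in the action of a composed jet on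
  \<open>Dots\<close>.\<close>

lemma partial2_comp:
  assumes V: "openin (Euclidean_space m) V" and v: "v \<in> V"
    and h: "\<And>i. i < m \<Longrightarrow> smooth_on m V (\<lambda>w. h w i)" and hE: "h ` V \<subseteq> topspace (Euclidean_space m)"
    and W: "openin (Euclidean_space m) W" and hv: "h v \<in> W" and F: "smooth_on m W F"
    and j: "j < m" and k: "k < m"
  shows "partial j (partial k (\<lambda>w. F (h w))) v =
      (\<Sum>l<m. (\<Sum>q<m. partial q (partial l F) (h v) * partial j (\<lambda>w. h w q) v) * partial k (\<lambda>w. h w l) v
         + partial l F (h v) * partial j (partial k (\<lambda>w. h w l)) v)"
proof -
  define V' where "V' = {v \<in> V. h v \<in> W}"
  have V': "openin (Euclidean_space m) V'"
    unfolding V'_def using smooth_on_continuous[OF h V] by (intro openin_Euclidean_preimage V hE W) auto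
  have v': "v \<in> V'" using v hv by (simp add: V'_def)
  have h': "smooth_on m V' (\<lambda>w. h w i)" if "i < m" for i
    by (rule smooth_on_subset[OF h[OF that]]) (auto simp: V'_def)
  have hE': "h ` V' \<subseteq> topspace (Euclidean_space m)" using hE by (auto simp: V'_def)
  have hW: "h w \<in> W" if "w \<in> V'" for w using that by (simp add: V'_def)
  have "\<forall>\<^sub>F t in nhds (v j). partial k (\<lambda>w. F (h w)) (v(j := t)) =
     (\<Sum>l<m. partial l F (h (v(j := t))) * partial k (\<lambda>w. h w l) (v(j := t)))"
    using eventually_fun_upd_in_open[OF V' v' j]
    by eventually_elim (auto intro!: partial_comp_eq[OF V' _ h' hE' W hW F k])
  moreover have "((\<lambda>t. \<Sum>l<m. partial l F (h (v(j := t))) * partial k (\<lambda>w. h w l) (v(j := t))) has_real_derivative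
      (\<Sum>l<m. (\<Sum>q<m. partial q (partial l F) (h v) * partial j (\<lambda>w. h w q) v) * partial k (\<lambda>w. h w l) v
         + partial l F (h v) * partial j (partial k (\<lambda>w. h w l)) v)) (at (v j))"
  proof (rule DERIV_sum)
    fix l assume "l \<in> {..<m}"
    then have l: "l < m" by simp
    have "((\<lambda>t. partial l F (h (v(j := t))) * partial k (\<lambda>w. h w l) (v(j := t))) has_real_derivative
      (\<Sum>q<m. partial q (partial l F) (h v) * partial j (\<lambda>w. h w q) v) * partial k (\<lambda>w. h w l) (v(j := v j))
         + partial j (partial k (\<lambda>w. h w l)) v * partial l F (h (v(j := v j)))) (at (v j))"
      by (intro DERIV_mult has_partial_comp[OF V v h hE W hv smooth_on_partial[OF F l] j]
          smooth_on_has_partial[OF smooth_on_partial[OF h[OF l] k] j v])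
    then show "((\<lambda>t. partial l F (h (v(j := t))) * partial k (\<lambda>w. h w l) (v(j := t))) has_real_derivative
      (\<Sum>q<m. partial q (partial l F) (h v) * partial j (\<lambda>w. h w q) v) * partial k (\<lambda>w. h w l) v
         + partial l F (h v) * partial j (partial k (\<lambda>w. h w l)) v) (at (v j))"
      by (simp add: mult.commute)
  qed
  ultimately have "((\<lambda>t. partial k (\<lambda>w. F (h w)) (v(j := t))) has_real_derivative
      (\<Sum>l<m. (\<Sum>q<m. partial q (partial l F) (h v) * partial j (\<lambda>w. h w q) v) * partial k (\<lambda>w. h w l) v
         + partial l F (h v) * partial j (partial k (\<lambda>w. h w l)) v)) (at (v j))"
    by (subst DERIV_cong_ev[OF refl _ refl]) auto
  then show ?thesis unfolding partial_def[of j "partial k (\<lambda>w. F (h w))"] by (rule DERIV_imp_deriv)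
qed

section \<open>Symmetry of mixed partial derivatives\<close>

lemma second_difference_mean_value:
  assumes F: "smooth_on m V F" and j: "j < m" and k: "k < m" and jk: "j \<noteq> k" and h: "h > 0"
    and box: "\<And>s t. 0 \<le> s \<Longrightarrow> s \<le> h \<Longrightarrow> 0 \<le> t \<Longrightarrow> t \<le> h \<Longrightarrow> v(j := v j + s, k := v k + t) \<in> V"
  obtains s t where "0 \<le> s" "s \<le> h" "0 \<le> t" "t \<le> h"
    "F (v(j := v j + h, k := v k + h)) - F (v(j := v j + h, k := v k))
      - F (v(j := v j, k := v k + h)) + F (v(j := v j, k := v k))
     = h * h * partial k (partial j F) (v(j := v j + s, k := v k + t))"
proof -
  let ?p = "\<lambda>s t. v(j := v j + s, k := v k + t)"
  have dj: "((\<lambda>s. F (?p s t)) has_real_derivative partial j F (?p s t)) (at s)"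
    if "0 \<le> s" "s \<le> h" "0 \<le> t" "t \<le> h" for s t
  proof -
    have "((\<lambda>x. F ((?p s t)(j := x))) has_real_derivative partial j F (?p s t)) (at ((?p s t) j))"
      by (rule smooth_on_has_partial[OF F j box[OF that]])
    then have "((\<lambda>x. F ((?p s t)(j := x))) has_real_derivative partial j F (?p s t)) (at (v j + s))"
      using jk by simp
    moreover have "((\<lambda>s. v j + s) has_real_derivative 1) (at s)" by (auto intro!: derivative_eq_intros)
    ultimately have "((\<lambda>s'. F ((?p s t)(j := v j + s'))) has_real_derivative partial j F (?p s t) * 1) (at s)"
      by (rule DERIV_chain2)
    moreover have "(?p s t)(j := v j + s') = ?p s' t" for s' using jk by (auto simp: fun_eq_iff)
    ultimately show ?thesis by simp
  qed
  have dk: "((\<lambda>t. partial j F (?p s t)) has_real_derivative partial k (partial j F) (?p s t)) (at t)"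
    if "0 \<le> s" "s \<le> h" "0 \<le> t" "t \<le> h" for s t
  proof -
    have "((\<lambda>x. partial j F ((?p s t)(k := x))) has_real_derivative partial k (partial j F) (?p s t)) (at ((?p s t) k))"
      by (rule smooth_on_has_partial[OF smooth_on_partial[OF F j] k box[OF that]])
    then have "((\<lambda>x. partial j F ((?p s t)(k := x))) has_real_derivative partial k (partial j F) (?p s t)) (at (v k + t))"
      by simp
    moreover have "((\<lambda>s. v k + s) has_real_derivative 1) (at t)" by (auto intro!: derivative_eq_intros)
    ultimately have "((\<lambda>t'. partial j F ((?p s t)(k := v k + t'))) has_real_derivative partial k (partial j F) (?p s t) * 1) (at t)"
      by (rule DERIV_chain2)
    moreover have "(?p s t)(k := v k + s') = ?p s s'" for s' by (auto simp: fun_eq_iff)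
    ultimately show ?thesis by simp
  qed
  \<comment> \<open>The mean value theorem is applied in direction \<open>j\<close> to the
    difference taken in direction \<open>k\<close>; a second application, in direction
    \<open>k\<close>, follows.\<close>
  have "\<exists>z. 0 < z \<and> z < h \<and> (F (?p h h) - F (?p h 0)) - (F (?p 0 h) - F (?p 0 0))
      = (h - 0) * (partial j F (?p z h) - partial j F (?p z 0))"
    using h by (intro MVT2[where f = "\<lambda>s. F (?p s h) - F (?p s 0)"] DERIV_diff dj) auto
  then obtain s where s: "0 < s" "s < h" "(F (?p h h) - F (?p h 0)) - (F (?p 0 h) - F (?p 0 0))
      = h * (partial j F (?p s h) - partial j F (?p s 0))" by auto
  have "\<exists>z. 0 < z \<and> z < h \<and> partial j F (?p s h) - partial j F (?p s 0)
      = (h - 0) * partial k (partial j F) (?p s z)"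
    using h s by (intro MVT2[where f = "\<lambda>t. partial j F (?p s t)"] dk) auto
  then obtain t where t: "0 < t" "t < h" "partial j F (?p s h) - partial j F (?p s 0)
      = h * partial k (partial j F) (?p s t)" by auto
  show thesis by (rule that[of s t]) (use s t in auto)
qed

text \<open>Schwarz's theorem. The second difference over a small square is symmetric in the two
  directions and equals \<open>h * h\<close> times either mixed derivative at some point of the
  square; continuity carries the equality to \<open>v\<close>.\<close>

lemma partial_commute:
  assumes F: "smooth_on m V F" and V: "openin (Euclidean_space m) V" and v: "v \<in> V"
    and j: "j < m" and k: "k < m"
  shows "partial j (partial k F) v = partial k (partial j F) v"
proof (cases "j = k")
  case False
  show ?thesis
  proof (rule ccontr)
    assume ne: "partial j (partial k F) v \<noteq> partial k (partial j F) v"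
    \<comment> \<open>Half of the supposed gap, so that two deviations below \<open>e\<close> cannot
      bridge it.\<close>
    define e where "e = \<bar>partial j (partial k F) v - partial k (partial j F) v\<bar> / 2"
    have e: "e > 0" using ne by (simp add: e_def)
    obtain r1 where r1: "r1 > 0" "\<And>w. w \<in> topspace (Euclidean_space m) \<Longrightarrow> l1_dist m v w \<le> r1 \<Longrightarrow>
        w \<in> V \<and> \<bar>partial j (partial k F) w - partial j (partial k F) v\<bar> < e"
      using continuous_l1_ball[OF V v smooth_on_continuous[OF smooth_on_partial[OF smooth_on_partial[OF F k] j] V] e] by metis
    obtain r2 where r2: "r2 > 0" "\<And>w. w \<in> topspace (Euclidean_space m) \<Longrightarrow> l1_dist m v w \<le> r2 \<Longrightarrow>
        w \<in> V \<and> \<bar>partial k (partial j F) w - partial k (partial j F) v\<bar> < e"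
      using continuous_l1_ball[OF V v smooth_on_continuous[OF smooth_on_partial[OF smooth_on_partial[OF F j] k] V] e] by metis
    define h where "h = min r1 r2 / 2"
    have h: "h > 0" using r1 r2 by (simp add: h_def)
    let ?p = "\<lambda>s t. v(j := v j + s, k := v k + t)"
    have pE: "?p s t \<in> topspace (Euclidean_space m)" for s t
      using v V openin_subset j k by (intro fun_upd_Euclidean_space) blast+
    have pd: "l1_dist m v (?p s t) \<le> min r1 r2" if "0 \<le> s" "s \<le> h" "0 \<le> t" "t \<le> h" for s t
    proof -
      have "l1_dist m v (?p s t) \<le> (\<Sum>i<m. (if i = j then s else 0) + (if i = k then t else 0))"
        unfolding l1_dist_def using that by (intro sum_mono) auto
      also have "\<dots> = s + t" using j k by (simp add: sum.distrib)
      finally show ?thesis using that by (simp add: h_def)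
    qed
    have pV: "?p s t \<in> V" if "0 \<le> s" "s \<le> h" "0 \<le> t" "t \<le> h" for s t
      using r1(2)[OF pE] pd[OF that] by auto
    have tw: "v(k := v k + s, j := v j + t) = ?p t s" for s t
      using False by (rule fun_upd_twist[symmetric])
    have tw': "v(k := v k, j := v j + t) = v(j := v j + t, k := v k)"
      "v(k := v k + s, j := v j) = v(j := v j, k := v k + s)"
      "v(k := v k, j := v j) = v(j := v j, k := v k)" for s t
      using False by (auto simp: fun_eq_iff)
    obtain s t where st: "0 \<le> s" "s \<le> h" "0 \<le> t" "t \<le> h"
        "F (?p h h) - F (v(j := v j + h, k := v k)) - F (v(j := v j, k := v k + h)) + F (v(j := v j, k := v k))
         = h * h * partial k (partial j F) (?p s t)"
      by (rule second_difference_mean_value[OF F j k False h pV]) blast+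
    obtain s' t' where st': "0 \<le> s'" "s' \<le> h" "0 \<le> t'" "t' \<le> h"
        "F (?p h h) - F (v(j := v j, k := v k + h)) - F (v(j := v j + h, k := v k)) + F (v(j := v j, k := v k))
         = h * h * partial j (partial k F) (?p t' s')"
    proof (rule second_difference_mean_value[OF F k j False[symmetric] h, of v])
      show "v(k := v k + s, j := v j + t) \<in> V" if "0 \<le> s" "s \<le> h" "0 \<le> t" "t \<le> h" for s t
        using pV[of t s] that unfolding tw by auto
    next
      fix s t
      assume st: "0 \<le> s" "s \<le> h" "0 \<le> t" "t \<le> h"
        and eq: "F (v(k := v k + h, j := v j + h)) - F (v(k := v k + h, j := v j))
            - F (v(k := v k, j := v j + h)) + F (v(k := v k, j := v j))
           = h * h * partial j (partial k F) (v(k := v k + s, j := v j + t))"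
      show thesis
        using eq by (intro that[OF st]) (simp only: tw tw')
    qed
    have "partial k (partial j F) (?p s t) = partial j (partial k F) (?p t' s')"
    proof -
      have "h * h * partial k (partial j F) (?p s t) = h * h * partial j (partial k F) (?p t' s')"
        using st(5) st'(5) by linarith
      then show ?thesis using h by simp
    qed
    moreover have "\<bar>partial k (partial j F) (?p s t) - partial k (partial j F) v\<bar> < e"
      using r2(2)[OF pE] pd[OF st(1-4)] by auto
    moreover have "\<bar>partial j (partial k F) (?p t' s') - partial j (partial k F) v\<bar> < e"
      using r1(2)[OF pE] pd[OF st'(3,4,1,2)] by auto
    ultimately have "partial j (partial k F) v - partial k (partial j F) v < 2 * e"
      "partial k (partial j F) v - partial j (partial k F) v < 2 * e"
      by linarith+
    then show False unfolding e_def by (simp add: abs_if split: if_splits)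
  qed
qed simp

section \<open>Taylor estimates along line segments\<close>

definition segment_at :: "vec \<Rightarrow> vec \<Rightarrow> real \<Rightarrow> vec" where
  "segment_at z w t = (\<lambda>i. z i + t * (w i - z i))"

lemma segment_at_0 [simp]: "segment_at z w 0 = z" and segment_at_1 [simp]: "segment_at z w 1 = w"
  by (auto simp: segment_at_def)

lemma segment_at_Euclidean_space:
  "z \<in> topspace (Euclidean_space m) \<Longrightarrow> w \<in> topspace (Euclidean_space m) \<Longrightarrow>
    segment_at z w t \<in> topspace (Euclidean_space m)"
  by (auto simp: topspace_Euclidean_space segment_at_def)

lemma l1_dist_segment_at:
  assumes "0 \<le> t" "t \<le> 1" "l1_dist m c z \<le> r" "l1_dist m c w \<le> r"
  shows "l1_dist m c (segment_at z w t) \<le> r"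
proof -
  have "l1_dist m c (segment_at z w t) \<le> (\<Sum>i<m. (1 - t) * \<bar>c i - z i\<bar> + t * \<bar>c i - w i\<bar>)"
    unfolding l1_dist_def
  proof (rule sum_mono)
    fix i
    have "c i - segment_at z w t i = (1 - t) * (c i - z i) + t * (c i - w i)"
      by (simp add: segment_at_def algebra_simps)
    also have "\<bar>\<dots>\<bar> \<le> \<bar>(1 - t) * (c i - z i)\<bar> + \<bar>t * (c i - w i)\<bar>" by (rule abs_triangle_ineq)
    also have "\<dots> = (1 - t) * \<bar>c i - z i\<bar> + t * \<bar>c i - w i\<bar>" using assms by (simp add: abs_mult)
    finally show "\<bar>c i - segment_at z w t i\<bar> \<le> (1 - t) * \<bar>c i - z i\<bar> + t * \<bar>c i - w i\<bar>" .
  qed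
  also have "\<dots> = (1 - t) * l1_dist m c z + t * l1_dist m c w"
    by (simp add: l1_dist_def sum.distrib sum_distrib_left)
  also have "\<dots> \<le> (1 - t) * r + t * r" using assms by (intro add_mono mult_left_mono) auto
  also have "\<dots> = r" by (simp add: algebra_simps)
  finally show ?thesis .
qed

lemma has_derivative_along_segment:
  assumes F: "smooth_on m V F" and V: "openin (Euclidean_space m) V"
    and zw: "z \<in> topspace (Euclidean_space m)" "w \<in> topspace (Euclidean_space m)"
    and t: "segment_at z w t \<in> V"
  shows "((\<lambda>t. F (segment_at z w t)) has_real_derivative
           (\<Sum>j<m. partial j F (segment_at z w t) * (w j - z j))) (at t)"
  using segment_at_Euclidean_space[OF zw] t
  by (intro smooth_on_chain_rule_curve[OF F V])
     (auto simp: segment_at_def intro!: derivative_eq_intros)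

lemma abs_sum_mult_le:
  fixes a d :: "'i \<Rightarrow> real"
  assumes "\<And>j. j \<in> J \<Longrightarrow> \<bar>a j\<bar> \<le> K"
  shows "\<bar>\<Sum>j\<in>J. a j * d j\<bar> \<le> K * (\<Sum>j\<in>J. \<bar>d j\<bar>)"
proof -
  have "\<bar>\<Sum>j\<in>J. a j * d j\<bar> \<le> (\<Sum>j\<in>J. \<bar>a j * d j\<bar>)" by (rule sum_abs)
  also have "\<dots> \<le> (\<Sum>j\<in>J. K * \<bar>d j\<bar>)"
    using assms by (intro sum_mono) (auto simp: abs_mult intro!: mult_right_mono)
  finally show ?thesis by (simp add: sum_distrib_left)
qed

text \<open>Mean value theorem for \<open>F\<close> restricted to the segment. The set
  \<open>B\<close> is asked to contain just this segment, so the lemma applies on tubes, which may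
  fail to be convex.\<close>

lemma smooth_on_lipschitz_segment:
  assumes F: "smooth_on m V F" and V: "openin (Euclidean_space m) V"
    and zw: "z \<in> topspace (Euclidean_space m)" "w \<in> topspace (Euclidean_space m)"
    and B: "B \<subseteq> V" "\<And>t. 0 \<le> t \<Longrightarrow> t \<le> 1 \<Longrightarrow> segment_at z w t \<in> B"
    and K: "\<And>j u. j < m \<Longrightarrow> u \<in> B \<Longrightarrow> \<bar>partial j F u\<bar> \<le> K"
  shows "\<bar>F w - F z\<bar> \<le> K * l1_dist m z w"
proof -
  have "\<exists>t. 0 < t \<and> t < 1 \<and> F (segment_at z w 1) - F (segment_at z w 0) =
      (1 - 0) * (\<Sum>j<m. partial j F (segment_at z w t) * (w j - z j))"
    using B by (intro MVT2 has_derivative_along_segment[OF F V zw]) auto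
  then obtain t where t: "0 < t" "t < 1"
    "F w - F z = (\<Sum>j<m. partial j F (segment_at z w t) * (w j - z j))" by auto
  show ?thesis unfolding t(3)
    using abs_sum_mult_le[of "{..<m}" "\<lambda>j. partial j F (segment_at z w t)" K "\<lambda>j. w j - z j"] K B(2) t
    by (simp add: l1_dist_def abs_minus_commute)
qed

text \<open>Lagrange remainder for the one-variable function \<open>F (segment_at z w t)\<close>
  expanded at \<open>t = 0\<close>; the factor 1/2 of the remainder is given away.\<close>

lemma smooth_on_taylor1_segment:
  assumes F: "smooth_on m V F" and V: "openin (Euclidean_space m) V"
    and zw: "z \<in> topspace (Euclidean_space m)" "w \<in> topspace (Euclidean_space m)"
    and B: "B \<subseteq> V" "\<And>t. 0 \<le> t \<Longrightarrow> t \<le> 1 \<Longrightarrow> segment_at z w t \<in> B"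
    and K: "\<And>j k u. j < m \<Longrightarrow> k < m \<Longrightarrow> u \<in> B \<Longrightarrow> \<bar>partial k (partial j F) u\<bar> \<le> K"
  shows "\<bar>F w - F z - (\<Sum>j<m. partial j F z * (w j - z j))\<bar> \<le> K * (l1_dist m z w)\<^sup>2"
proof -
  let ?s = "segment_at z w" and ?d = "\<lambda>j. w j - z j"
  let ?D1 = "\<lambda>t. \<Sum>j<m. partial j F (?s t) * ?d j"
  let ?D2 = "\<lambda>t. \<Sum>j<m. (\<Sum>k<m. partial k (partial j F) (?s t) * ?d k) * ?d j"
  have d0: "((\<lambda>t. F (?s t)) has_real_derivative ?D1 t) (at t)" if "0 \<le> t" "t \<le> 1" for t
    using B that by (intro has_derivative_along_segment[OF F V zw]) auto
  have d1: "(?D1 has_real_derivative ?D2 t) (at t)" if "0 \<le> t" "t \<le> 1" for t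
    using B that by (intro DERIV_sum DERIV_cmult_right has_derivative_along_segment[OF smooth_on_partial[OF F] V zw]) auto
  define diff where "diff n = (if n = 0 then (\<lambda>t. F (?s t)) else if n = 1 then ?D1 else ?D2)" for n :: nat
  have "\<exists>t>0. t < 1 \<and> F (?s 1) = (\<Sum>n<2. diff n 0 / fact n * 1 ^ n) + diff 2 t / fact 2 * 1 ^ 2"
    using d0 d1 by (intro Maclaurin) (auto simp: diff_def less_2_cases_iff)
  then obtain t where t: "0 < t" "t < 1" "F w = F z + ?D1 0 + ?D2 t / 2"
    by (auto simp: diff_def numeral_2_eq_2)
  have "\<bar>?D2 t\<bar> \<le> K * l1_dist m z w * (\<Sum>j<m. \<bar>?d j\<bar>)"
  proof (rule abs_sum_mult_le)
    fix j assume "j \<in> {..<m}"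
    then show "\<bar>\<Sum>k<m. partial k (partial j F) (?s t) * ?d k\<bar> \<le> K * l1_dist m z w"
      using abs_sum_mult_le[of "{..<m}" "\<lambda>k. partial k (partial j F) (?s t)" K "\<lambda>j. w j - z j"] K B(2) t
      by (simp add: l1_dist_def abs_minus_commute)
  qed
  then have "\<bar>?D2 t\<bar> \<le> K * (l1_dist m z w)\<^sup>2"
    by (simp add: l1_dist_def abs_minus_commute power2_eq_square mult.assoc)
  moreover have "F w - F z - (\<Sum>j<m. partial j F z * (w j - z j)) = ?D2 t / 2"
    using t(3) by simp
  ultimately show ?thesis by (simp add: abs_divide)
qed

text \<open>The same argument one derivative further. This precision serves the transition maps
  between charts, whose quadratic term carries the change of the \<open>Dots\<close>
  coefficients.\<close>

lemma smooth_on_taylor2_segment: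
  assumes F: "smooth_on m V F" and V: "openin (Euclidean_space m) V"
    and zw: "z \<in> topspace (Euclidean_space m)" "w \<in> topspace (Euclidean_space m)"
    and B: "B \<subseteq> V" "\<And>t. 0 \<le> t \<Longrightarrow> t \<le> 1 \<Longrightarrow> segment_at z w t \<in> B"
    and K: "\<And>j k l u. j < m \<Longrightarrow> k < m \<Longrightarrow> l < m \<Longrightarrow> u \<in> B \<Longrightarrow> \<bar>partial l (partial k (partial j F)) u\<bar> \<le> K"
  shows "\<bar>F w - F z - (\<Sum>j<m. partial j F z * (w j - z j))
     - (\<Sum>j<m. \<Sum>k<m. partial k (partial j F) z * (w k - z k) * (w j - z j)) / 2\<bar> \<le> K * (l1_dist m z w) ^ 3"
proof -
  let ?s = "segment_at z w" and ?d = "\<lambda>j. w j - z j"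
  let ?D1 = "\<lambda>t. \<Sum>j<m. partial j F (?s t) * ?d j"
  let ?D2 = "\<lambda>t. \<Sum>j<m. (\<Sum>k<m. partial k (partial j F) (?s t) * ?d k) * ?d j"
  let ?D3 = "\<lambda>t. \<Sum>j<m. (\<Sum>k<m. (\<Sum>l<m. partial l (partial k (partial j F)) (?s t) * ?d l) * ?d k) * ?d j"
  have d0: "((\<lambda>t. F (?s t)) has_real_derivative ?D1 t) (at t)" if "0 \<le> t" "t \<le> 1" for t
    using B that by (intro has_derivative_along_segment[OF F V zw]) auto
  have d1: "(?D1 has_real_derivative ?D2 t) (at t)" if "0 \<le> t" "t \<le> 1" for t
    using B that by (intro DERIV_sum DERIV_cmult_right has_derivative_along_segment[OF smooth_on_partial[OF F] V zw]) auto
  have d2: "(?D2 has_real_derivative ?D3 t) (at t)" if "0 \<le> t" "t \<le> 1" for t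
    using B that by (intro DERIV_sum DERIV_cmult_right
        has_derivative_along_segment[OF smooth_on_partial[OF smooth_on_partial[OF F]] V zw]) auto
  define diff where "diff n = (if n = 0 then (\<lambda>t. F (?s t)) else if n = 1 then ?D1 else if n = 2 then ?D2 else ?D3)" for n :: nat
  have "\<exists>t>0. t < 1 \<and> F (?s 1) = (\<Sum>n<3. diff n 0 / fact n * 1 ^ n) + diff 3 t / fact 3 * 1 ^ 3"
  proof (rule Maclaurin)
    show "\<forall>n t. n < 3 \<and> 0 \<le> t \<and> t \<le> 1 \<longrightarrow> (diff n has_real_derivative diff (Suc n) t) (at t)"
    proof (intro allI impI)
      fix n :: nat and t :: real assume *: "n < 3 \<and> 0 \<le> t \<and> t \<le> 1"
      then consider "n = 0" | "n = 1" | "n = 2" by linarith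
      then show "(diff n has_real_derivative diff (Suc n) t) (at t)"
        using d0 d1 d2 * by cases (auto simp: diff_def)
    qed
  qed (auto simp: diff_def)
  then obtain t where t: "0 < t" "t < 1" "F w = F z + ?D1 0 + ?D2 0 / 2 + ?D3 t / 6"
    by (auto simp: diff_def numeral_3_eq_3 fact_reduce)
  have b1: "\<bar>\<Sum>l<m. partial l (partial k (partial j F)) (?s t) * ?d l\<bar> \<le> K * l1_dist m z w"
    if "j < m" "k < m" for j k
    using abs_sum_mult_le[of "{..<m}" "\<lambda>l. partial l (partial k (partial j F)) (?s t)" K "\<lambda>j. w j - z j"] K B(2) t that
    by (simp add: l1_dist_def abs_minus_commute)
  have b2: "\<bar>\<Sum>k<m. (\<Sum>l<m. partial l (partial k (partial j F)) (?s t) * ?d l) * ?d k\<bar>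
     \<le> K * l1_dist m z w * l1_dist m z w" if "j < m" for j
    using abs_sum_mult_le[of "{..<m}" "\<lambda>k. \<Sum>l<m. partial l (partial k (partial j F)) (?s t) * ?d l"
        "K * l1_dist m z w" "\<lambda>j. w j - z j"] b1 that
    by (simp add: l1_dist_def abs_minus_commute)
  have "\<bar>?D3 t\<bar> \<le> K * l1_dist m z w * l1_dist m z w * l1_dist m z w"
    using abs_sum_mult_le[of "{..<m}" "\<lambda>j. \<Sum>k<m. (\<Sum>l<m. partial l (partial k (partial j F)) (?s t) * ?d l) * ?d k"
        "K * l1_dist m z w * l1_dist m z w" "\<lambda>j. w j - z j"] b2
    by (simp add: l1_dist_def abs_minus_commute)
  then have b: "\<bar>?D3 t\<bar> \<le> K * (l1_dist m z w) ^ 3" by (simp add: power3_eq_cube mult.assoc)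
  have "F w - F z - (\<Sum>j<m. partial j F z * (w j - z j))
     - (\<Sum>j<m. \<Sum>k<m. partial k (partial j F) z * (w k - z k) * (w j - z j)) / 2 = ?D3 t / 6"
    using t(3) by (simp add: sum_distrib_right)
  then show ?thesis using b by (simp add: abs_divide)
qed

section \<open>Second-order jets and the rough velocity bundle\<close>

text \<open>A general base point is allowed because a transition map is expanded at
  \<open>x q\<close>, whereas frames are expanded at the origin.\<close>

definition jet2_at :: "nat \<Rightarrow> (vec \<Rightarrow> vec) \<Rightarrow> vec \<Rightarrow> jet2" where
  "jet2_at m h v =
     (\<lambda>i j. if i < m \<and> j < m then partial j (\<lambda>w. h w i) v else 0,
      \<lambda>i j k. if i < m \<and> j < m \<and> k < m then partial j (partial k (\<lambda>w. h w i)) v else 0)"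

lemma jet2_at_0_eq: "jet2_at_0 m h = jet2_at m h origin"
  by (simp add: jet2_at_0_def jet2_at_def)

lemma sum_sum_linear:
  fixes a :: "nat \<Rightarrow> real"
  shows "(\<Sum>k<m. (\<Sum>l<m. a l * b l k) * z k) = (\<Sum>l<m. a l * (\<Sum>k<m. b l k * z k))"
proof -
  have "(\<Sum>k<m. (\<Sum>l<m. a l * b l k) * z k) = (\<Sum>k<m. \<Sum>l<m. a l * (b l k * z k))"
    by (simp add: sum_distrib_right mult.assoc)
  also have "\<dots> = (\<Sum>l<m. \<Sum>k<m. a l * (b l k * z k))" by (rule sum.swap)
  finally show ?thesis by (simp add: sum_distrib_left)
qed

text \<open>Contraction of the second-order chain rule with two vectors. On the right, the first sum
  transports the second derivatives of the inner map linearly, and the second applies the second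
  derivatives of the outer map to the pushed-forward vectors: the two effects of acting with one jet
  after the other.\<close>

lemma sum_sum_bilinear:
  fixes a :: "nat \<Rightarrow> real"
  shows "(\<Sum>j<m. \<Sum>k<m. (\<Sum>l<m. (\<Sum>q<m. A q l * b q j) * b l k + a l * B l j k) * x j * y k)
    = (\<Sum>l<m. a l * (\<Sum>j<m. \<Sum>k<m. B l j k * x j * y k))
      + (\<Sum>q<m. \<Sum>l<m. A q l * (\<Sum>j<m. b q j * x j) * (\<Sum>k<m. b l k * y k))"
proof -
  define X where "X q = (\<Sum>j<m. b q j * x j)" for q
  define Y where "Y q = (\<Sum>j<m. b q j * y j)" for q
  have 1: "(\<Sum>j<m. \<Sum>k<m. (\<Sum>l<m. a l * B l j k) * x j * y k) = (\<Sum>l<m. a l * (\<Sum>j<m. \<Sum>k<m. B l j k * x j * y k))"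
  proof -
    have "(\<Sum>j<m. \<Sum>k<m. (\<Sum>l<m. a l * B l j k) * x j * y k)
       = (\<Sum>j<m. x j * (\<Sum>k<m. (\<Sum>l<m. a l * B l j k) * y k))"
      by (simp add: sum_distrib_left mult_ac)
    also have "\<dots> = (\<Sum>j<m. x j * (\<Sum>l<m. a l * (\<Sum>k<m. B l j k * y k)))"
      by (simp only: sum_sum_linear)
    also have "\<dots> = (\<Sum>j<m. (\<Sum>l<m. a l * (\<Sum>k<m. B l j k * y k)) * x j)"
      by (simp only: mult.commute)
    also have "\<dots> = (\<Sum>l<m. a l * (\<Sum>j<m. (\<Sum>k<m. B l j k * y k) * x j))"
      by (rule sum_sum_linear)
    finally show ?thesis by (simp add: sum_distrib_left sum_distrib_right mult_ac)
  qed
  have 2: "(\<Sum>j<m. \<Sum>k<m. (\<Sum>l<m. (\<Sum>q<m. A q l * b q j) * b l k) * x j * y k)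
     = (\<Sum>q<m. \<Sum>l<m. A q l * X q * Y l)"
  proof -
    have "(\<Sum>j<m. \<Sum>k<m. (\<Sum>l<m. (\<Sum>q<m. A q l * b q j) * b l k) * x j * y k)
       = (\<Sum>j<m. x j * (\<Sum>k<m. (\<Sum>l<m. (\<Sum>q<m. A q l * b q j) * b l k) * y k))"
      by (simp add: sum_distrib_left mult_ac)
    also have "\<dots> = (\<Sum>j<m. x j * (\<Sum>l<m. (\<Sum>q<m. A q l * b q j) * Y l))"
      by (simp only: sum_sum_linear Y_def)
    also have "\<dots> = (\<Sum>j<m. (\<Sum>l<m. Y l * (\<Sum>q<m. A q l * b q j)) * x j)"
      by (simp only: mult.commute)
    also have "\<dots> = (\<Sum>l<m. Y l * (\<Sum>j<m. (\<Sum>q<m. A q l * b q j) * x j))"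
      by (rule sum_sum_linear)
    also have "\<dots> = (\<Sum>l<m. Y l * (\<Sum>q<m. A q l * X q))"
      by (simp add: sum_sum_linear X_def)
    also have "\<dots> = (\<Sum>l<m. \<Sum>q<m. A q l * X q * Y l)"
      by (simp add: sum_distrib_left mult_ac)
    also have "\<dots> = (\<Sum>q<m. \<Sum>l<m. A q l * X q * Y l)" by (rule sum.swap)
    finally show ?thesis .
  qed
  show ?thesis
    unfolding X_def[symmetric] Y_def[symmetric] 2[symmetric] 1[symmetric]
    by (simp add: sum.distrib distrib_right)
qed

text \<open>Functoriality of the jet action. \<open>Vertex\<close> and \<open>Stack\<close> need the
  first-order chain rule; for \<open>Dots\<close> the second-order rule yields the quadratic term of
  the outer jet in the transformed \<open>Vertex\<close> entries plus the linear image of the inner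
  quadratic term.\<close>

lemma jet_act_comp:
  assumes V: "openin (Euclidean_space m) V" and v: "v \<in> V"
    and h: "\<And>i. i < m \<Longrightarrow> smooth_on m V (\<lambda>w. h w i)" and hE: "h ` V \<subseteq> topspace (Euclidean_space m)"
    and W: "openin (Euclidean_space m) W" and hv: "h v \<in> W"
    and \<phi>: "\<And>i. i < m \<Longrightarrow> smooth_on m W (\<lambda>u. \<phi> u i)"
  shows "jet_act m (jet2_at m (\<lambda>w. \<phi> (h w)) v) g = jet_act m (jet2_at m \<phi> (h v)) (jet_act m (jet2_at m h v) g)"
proof (intro ext)
  fix \<tau> i
  show "jet_act m (jet2_at m (\<lambda>w. \<phi> (h w)) v) g \<tau> i = jet_act m (jet2_at m \<phi> (h v)) (jet_act m (jet2_at m h v) g) \<tau> i"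
  proof (cases "i < m")
    case True
    note p1 = partial_comp_eq[OF V v h hE W hv \<phi>[OF True]]
    note p2 = partial2_comp[OF V v h hE W hv \<phi>[OF True]]
    have lin: "(\<Sum>k<m. (\<Sum>l<m. partial l (\<lambda>u. \<phi> u i) (h v) * partial k (\<lambda>w. h w l) v) * z k)
        = (\<Sum>l<m. partial l (\<lambda>u. \<phi> u i) (h v) * (\<Sum>k<m. partial k (\<lambda>w. h w l) v * z k))" for z
      by (rule sum_sum_linear)
    show ?thesis
    proof (cases \<tau>)
      case (Vertex \<alpha>)
      then show ?thesis using True p1 lin by (simp add: jet2_at_def)
    next
      case (Stack \<alpha> \<beta>)
      then show ?thesis using True p1 lin by (simp add: jet2_at_def)
    next
      case (Dots P)
      show ?thesis
        using True p1 p2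
        by (simp add: Dots jet2_at_def lin sum_sum_bilinear) (simp add: sum.distrib distrib_left)
    qed
  next
    case False
    then show ?thesis by (cases \<tau>) (auto simp: jet2_at_def)
  qed
qed

text \<open>Derivatives are local, so maps built from inverses of charts may be simplified on an
  open set even if the two sides differ elsewhere.\<close>

lemma partial_cong:
  assumes V: "openin (Euclidean_space m) V" and v: "v \<in> V" and j: "j < m"
    and eq: "\<And>w. w \<in> V \<Longrightarrow> F w = G w"
  shows "partial j F v = partial j G v"
proof -
  have "\<forall>\<^sub>F t in nhds (v j). F (v(j := t)) = G (v(j := t))"
    using eventually_fun_upd_in_open[OF V v j] by eventually_elim (rule eq)
  then show ?thesis unfolding partial_def by (intro deriv_cong_ev) auto
qed

lemma jet2_at_cong:
  assumes V: "openin (Euclidean_space m) V" and v: "v \<in> V"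
    and eq: "\<And>w i. w \<in> V \<Longrightarrow> i < m \<Longrightarrow> h w i = h' w i"
  shows "jet2_at m h v = jet2_at m h' v"
proof -
  have 1: "partial j (\<lambda>w. h w i) u = partial j (\<lambda>w. h' w i) u" if "i < m" "j < m" "u \<in> V" for i j u
    using that eq by (intro partial_cong[OF V]) auto
  have 2: "partial j (partial k (\<lambda>w. h w i)) v = partial j (partial k (\<lambda>w. h' w i)) v"
    if "i < m" "j < m" "k < m" for i j k
    using that 1 by (intro partial_cong[OF V v]) auto
  show ?thesis unfolding jet2_at_def using 1[OF _ _ v] 2 by (auto simp: fun_eq_iff)
qed

text \<open>The induction ranges over both functions because the hypothesis is handed on to their
  partial derivatives, which agree on the open set as well.\<close>

lemma Ck_on_cong:
  assumes V: "openin (Euclidean_space m) V" and "Ck_on m k V F" and "\<And>v. v \<in> V \<Longrightarrow> F v = G v"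
  shows "Ck_on m k V G"
  using assms(2,3)
proof (induction k arbitrary: F G)
  case 0
  have "continuous_on V F = continuous_on V G" using 0(2) by (intro continuous_on_cong) auto
  then show ?case using 0(1) continuous_map_Euclidean_subspace_iff[OF openin_subset[OF V]] by auto
next
  case (Suc k)
  have c: "continuous_on V F = continuous_on V G" using Suc(3) by (intro continuous_on_cong) auto
  have "(\<lambda>t. G (v(j := t))) differentiable at (v j)" if "j < m" "v \<in> V" for j v
  proof -
    have "(\<lambda>t. F (v(j := t))) differentiable at (v j)" using Suc(2) that by auto
    moreover have "\<forall>\<^sub>F t in nhds (v j). F (v(j := t)) = G (v(j := t))"
      using eventually_fun_upd_in_open[OF V that(2,1)] by eventually_elim (rule Suc(3))
    ultimately show ?thesis
      by (metis DERIV_cong_ev DERIV_deriv_iff_real_differentiable real_differentiable_def)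
  qed
  moreover have "Ck_on m k V (partial j G)" if "j < m" for j
  proof (rule Suc.IH)
    show "Ck_on m k V (partial j F)" using Suc(2) that by auto
    show "partial j F v = partial j G v" if "v \<in> V" for v
      using Suc(3) by (intro partial_cong[OF V that \<open>j < m\<close>])
  qed
  ultimately show ?case
    using Suc(2) c continuous_map_Euclidean_subspace_iff[OF openin_subset[OF V]] by auto
qed

lemma smooth_on_cong:
  "openin (Euclidean_space m) V \<Longrightarrow> (\<And>v. v \<in> V \<Longrightarrow> F v = G v) \<Longrightarrow> smooth_on m V F \<Longrightarrow> smooth_on m V G"
  unfolding smooth_on_def using Ck_on_cong by blast

lemma smooth_on_const: "smooth_on m V (\<lambda>_. c)"
proof -
  have "Ck_on m k V (\<lambda>_. c)" for k
  proof (induction k arbitrary: c)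
    case (Suc k)
    have "partial j (\<lambda>_. c) = (\<lambda>_. 0)" for j by (simp add: partial_def fun_eq_iff)
    then show ?case using Suc by simp
  qed simp
  then show ?thesis by (simp add: smooth_on_def)
qed

lemma partial_coordinate: "partial j (\<lambda>w. w i) = (\<lambda>_. if i = j then 1 else 0)"
  by (auto simp: partial_def)

lemma smooth_on_coordinate: 
  assumes V: "V \<subseteq> topspace (Euclidean_space m)" shows "smooth_on m V (\<lambda>w. w i)"
  unfolding smooth_on_def
proof
  fix k
  have c: "continuous_map (subtopology (Euclidean_space m) V) euclideanreal (\<lambda>w. w i)"
    unfolding continuous_map_Euclidean_subspace_iff[OF V]
    by (rule continuous_on_product_then_coordinatewise) (rule continuous_on_id)
  show "Ck_on m k V (\<lambda>w. w i)"
  proof (cases k)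
    case (Suc k')
    have "(\<lambda>t. (v(j := t)) i) differentiable (at (v j))" for v :: vec and j
      by (cases "i = j") auto
    then show ?thesis
      using c smooth_on_const[of m V] by (simp add: Suc partial_coordinate smooth_on_def)
  qed (use c in simp)
qed

lemma id_pointed_smooth_map: "(\<lambda>v. v) \<in> pointed_smooth_maps m"
  unfolding pointed_smooth_maps_def
  by (auto intro!: exI[of _ "topspace (Euclidean_space m)"] smooth_on_coordinate
      simp: topspace_Euclidean_space)

text \<open>This makes the bundle relation reflexive on \<open>velocity_fibre\<close>, whose tuples
  vanish at the coordinates beyond \<open>m\<close>, where the action returns zero.\<close>

lemma jet_act_id:
  assumes "f \<in> velocity_fibre m n"
  shows "jet_act m (jet2_at m (\<lambda>v. v) u) f = f"
proof (intro ext)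
  fix \<tau> i
  have jet: "jet2_at m (\<lambda>v. v) u = (\<lambda>i j. if i < m \<and> j < m then (if i = j then 1 else 0) else 0, \<lambda>i j k. 0)"
    by (auto simp: jet2_at_def partial_coordinate fun_eq_iff) (auto simp: partial_def)
  have *: "(\<Sum>j<m. (if i < m \<and> j < m then if i = j then 1 else 0 else 0) * g j) = g i" if "i < m" for g :: vec
  proof -
    have "(\<Sum>j<m. (if i < m \<and> j < m then if i = j then 1 else 0 else 0) * g j) = (\<Sum>j<m. if i = j then g j else 0)"
      using that by (intro sum.cong) auto
    then show ?thesis using that by simp
  qed
  show "jet_act m (jet2_at m (\<lambda>v. v) u) f \<tau> i = f \<tau> i"
  proof (cases "i < m")
    case True
    then show ?thesis unfolding jet using *[OF True] by (cases \<tau>) simp_all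
  next
    case False
    then have "f \<tau> i = 0" using assms by (simp add: velocity_fibre_def)
    then show ?thesis using False by (cases \<tau>) (auto simp: jet2_at_def)
  qed
qed

lemma jet_act_outside: "m \<le> i \<Longrightarrow> jet_act m a g \<tau> i = 0"
  by (cases a; cases \<tau>) auto

lemma chart_open_image:
  assumes "is_chart m M (U, x)" "openin M W"
  shows "openin (Euclidean_space m) (x ` (U \<inter> W))"
proof -
  have U: "openin M U" "openin (Euclidean_space m) (x ` U)"
    and hom: "homeomorphic_map (subtopology M U) (subtopology (Euclidean_space m) (x ` U)) x"
    using assms(1) by (auto simp: is_chart_def)
  have "openin (subtopology M U) (U \<inter> W)" using assms(2) by (rule openin_subtopology_Int2)
  then have "openin (subtopology (Euclidean_space m) (x ` U)) (x ` (U \<inter> W))"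
    using hom homeomorphic_imp_open_map open_map_def by blast
  then show ?thesis using U(2) openin_trans_full by blast
qed

lemma chart_inj_on: "is_chart m M (U, x) \<Longrightarrow> inj_on x U"
  unfolding is_chart_def homeomorphic_map_def
  using homeomorphic_imp_injective_map openin_subset
  by (metis (no_types, lifting) case_prodD homeomorphic_map_def topspace_subtopology_subset)

section \<open>Charts, frames and classes of the velocity bundle\<close>

locale manifold =
  fixes m :: nat and M :: "'a topology" and A :: "'a chart set"
  assumes mfd: "smooth_manifold m M A"
begin

lemma chart: "c \<in> A \<Longrightarrow> is_chart m M c"
  using mfd by (auto simp: smooth_manifold_def)

lemma chart_open: "(U, x) \<in> A \<Longrightarrow> openin M U"
  and chart_image_open: "(U, x) \<in> A \<Longrightarrow> openin (Euclidean_space m) (x ` U)"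
  using chart by (auto simp: is_chart_def)

lemma chart_inj: "(U, x) \<in> A \<Longrightarrow> inj_on x U"
  using chart chart_inj_on by blast

lemma chart_inv [simp]: "(U, x) \<in> A \<Longrightarrow> q \<in> U \<Longrightarrow> inv_into U x (x q) = q"
  using chart_inj inv_into_f_f by metis

lemma chart_point_Euclidean: "(U, x) \<in> A \<Longrightarrow> q \<in> U \<Longrightarrow> x q \<in> topspace (Euclidean_space m)"
  using chart_image_open openin_subset by (metis image_eqI subsetD)

lemma overlap_open: "(U, x) \<in> A \<Longrightarrow> openin M W \<Longrightarrow> openin (Euclidean_space m) (x ` (U \<inter> W))"
  using chart_open_image[OF chart] by blast

lemma transition_smooth:
  assumes "(U, x) \<in> A" "(V, y) \<in> A" "i < m"
  shows "smooth_on m (x ` (U \<inter> V)) (\<lambda>v. y (inv_into U x v) i)"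
proof -
  have "smooth_transition m (U, x) (V, y)"
    using mfd assms(1,2) unfolding smooth_manifold_def compatible_charts_def by blast
  then show ?thesis using assms(3) by (simp add: smooth_transition_def)
qed

text \<open>The inverse of a local diffeomorphism is itself a chart, so \<open>x\<close> after
  \<open>\<psi>\<close> is a transition map and its smoothness comes from compatibility.\<close>

lemma local_diffeo_smooth:
  assumes "local_diffeo_at_0 m A \<psi>" "(U, x) \<in> A" "\<psi> origin \<in> U"
  obtains V where "openin (Euclidean_space m) V" "origin \<in> V" "\<psi> ` V \<subseteq> U"
    "\<And>i. i < m \<Longrightarrow> smooth_on m V (\<lambda>w. x (\<psi> w) i)"
proof -
  obtain V0 where V0: "openin (Euclidean_space m) V0" "origin \<in> V0" "inj_on \<psi> V0"
    "(\<psi> ` V0, inv_into V0 \<psi>) \<in> A"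
    using assms(1) by (auto simp: local_diffeo_at_0_def)
  let ?V = "inv_into V0 \<psi> ` (\<psi> ` V0 \<inter> U)"
  have V: "?V = {v \<in> V0. \<psi> v \<in> U}" using V0(3) by (auto simp: image_iff) (metis IntI image_eqI inv_into_f_f)
  have op: "openin (Euclidean_space m) ?V" using overlap_open[OF V0(4) chart_open[OF assms(2)]] .
  show thesis
  proof (rule that[OF op])
    show "origin \<in> ?V" "\<psi> ` ?V \<subseteq> U" using V0(2) assms(3) unfolding V by auto
    fix i assume i: "i < m"
    show "smooth_on m ?V (\<lambda>w. x (\<psi> w) i)"
    proof (rule smooth_on_cong[OF op _ transition_smooth[OF V0(4) assms(2) i]])
      fix v assume "v \<in> ?V"
      then have "v \<in> V0" unfolding V by auto
      then have "inv_into (\<psi> ` V0) (inv_into V0 \<psi>) v = \<psi> v"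
        using V0(3) by (intro inv_into_f_eq) (auto simp: inj_on_inv_into)
      then show "x (inv_into (\<psi> ` V0) (inv_into V0 \<psi>) v) i = x (\<psi> v) i" by simp
    qed
  qed
qed

lemma mem_frame_jet_self: "local_diffeo_at_0 m A \<psi> \<Longrightarrow> \<psi> \<in> frame_jet m A \<psi>"
  by (auto simp: frame_jet_def same_2jet_def)

lemma jet_act_diffeo_comp:
  assumes "local_diffeo_at_0 m A \<psi>" "h \<in> pointed_smooth_maps m" "(U, x) \<in> A" "\<psi> origin \<in> U"
  shows "jet_act m (jet2_at_0 m (x \<circ> (\<psi> \<circ> h))) g
      = jet_act m (jet2_at_0 m (x \<circ> \<psi>)) (jet_act m (jet2_at_0 m h) g)"
proof -
  obtain W where W: "openin (Euclidean_space m) W" "origin \<in> W"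
    "\<And>i. i < m \<Longrightarrow> smooth_on m W (\<lambda>w. x (\<psi> w) i)"
    using local_diffeo_smooth[OF assms(1,3,4)] by metis
  obtain V where V: "h origin = origin" "openin (Euclidean_space m) V" "origin \<in> V"
    "h ` V \<subseteq> topspace (Euclidean_space m)" "\<And>i. i < m \<Longrightarrow> smooth_on m V (\<lambda>v. h v i)"
    using assms(2) by (auto simp: pointed_smooth_maps_def)
  show ?thesis
    using jet_act_comp[where \<phi> = "\<lambda>v. x (\<psi> v)" and g = g, OF V(2,3,5,4) W(1) _ W(3)] V(1) W(2)
    by (simp add: jet2_at_0_eq comp_def)
qed

text \<open>This makes the definite descriptions in \<open>base_point\<close> and
  \<open>fibre_coords\<close> denote. Each member of the class is compared directly with the
  generating pair \<open>(P, g)\<close>: composing the frame with \<open>h\<close> multiplies it by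
  the jet of \<open>h\<close>, and the tuple \<open>g\<close> has absorbed the same jet.\<close>

lemma velocity_class_coords:
  assumes c: "c \<in> velocity_bundle m n A"
  obtains \<psi> g where "local_diffeo_at_0 m A \<psi>" "(frame_jet m A \<psi>, g) \<in> c"
    "\<And>\<psi>' g'. local_diffeo_at_0 m A \<psi>' \<Longrightarrow> (frame_jet m A \<psi>', g') \<in> c \<Longrightarrow> \<psi>' origin = \<psi> origin"
    "\<And>\<psi>' g' U x. local_diffeo_at_0 m A \<psi>' \<Longrightarrow> (frame_jet m A \<psi>', g') \<in> c \<Longrightarrow> (U, x) \<in> A \<Longrightarrow> \<psi> origin \<in> U
       \<Longrightarrow> jet_act m (jet2_at_0 m (x \<circ> \<psi>')) g' = jet_act m (jet2_at_0 m (x \<circ> \<psi>)) g"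
proof -
  obtain P g where Pg: "P \<in> frame_bundle2 m A" "g \<in> velocity_fibre m n" "c = bundle_rel m n A `` {(P, g)}"
    using c unfolding velocity_bundle_def quotient_def by auto
  obtain \<psi> where \<psi>: "local_diffeo_at_0 m A \<psi>" "P = frame_jet m A \<psi>"
    using Pg(1) by (auto simp: frame_bundle2_def)
  have *: "\<psi>' origin = \<psi> origin \<and> (\<forall>U x. (U, x) \<in> A \<longrightarrow> \<psi> origin \<in> U \<longrightarrow>
     jet_act m (jet2_at_0 m (x \<circ> \<psi>')) g' = jet_act m (jet2_at_0 m (x \<circ> \<psi>)) g)"
    if \<psi>': "local_diffeo_at_0 m A \<psi>'" "(frame_jet m A \<psi>', g') \<in> c" for \<psi>' g'
  proof -
    obtain \<psi>1 h where h: "local_diffeo_at_0 m A \<psi>1" "h \<in> pointed_smooth_maps m"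
      "P = frame_jet m A \<psi>1" "frame_jet m A \<psi>' = frame_jet m A (\<psi>1 \<circ> h)" "g = jet_act m (jet2_at_0 m h) g'"
      using \<psi>'(2) unfolding Pg(3) by (auto simp: bundle_rel_def)
    have h0: "h origin = origin" using h(2) by (auto simp: pointed_smooth_maps_def)
    have 1: "same_2jet m A \<psi> \<psi>1"
      using mem_frame_jet_self[OF h(1)] h(3) \<psi>(2) by (auto simp: frame_jet_def)
    have 2: "same_2jet m A (\<psi>1 \<circ> h) \<psi>'"
      using mem_frame_jet_self[OF \<psi>'(1)] h(4) by (auto simp: frame_jet_def)
    have or: "\<psi>1 origin = \<psi> origin" "\<psi>' origin = \<psi> origin"
      using 1 2 h0 by (auto simp: same_2jet_def)
    have "jet_act m (jet2_at_0 m (x \<circ> \<psi>')) g' = jet_act m (jet2_at_0 m (x \<circ> \<psi>)) g"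
      if "(U, x) \<in> A" "\<psi> origin \<in> U" for U x
    proof -
      have "jet2_at_0 m (x \<circ> \<psi>') = jet2_at_0 m (x \<circ> (\<psi>1 \<circ> h))"
        using 2 that or h0 by (auto simp: same_2jet_def)
      moreover have "jet2_at_0 m (x \<circ> \<psi>) = jet2_at_0 m (x \<circ> \<psi>1)"
        using 1 that by (auto simp: same_2jet_def)
      ultimately show ?thesis
        using jet_act_diffeo_comp[OF h(1,2) that(1)] that(2) or h(5) by simp
    qed
    then show ?thesis using or by blast
  qed
  \<comment> \<open>The identity jet puts the generating pair into its own class.\<close>
  have jid: "jet2_at_0 m id \<in> jet_group m"
    unfolding jet_group_def using id_pointed_smooth_map[of m]
    by (auto simp: id_def comp_def intro!: exI[of _ "\<lambda>v. v"] bexI[of _ "\<lambda>v. v"])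
  have "(P, g) \<in> c"
    unfolding Pg(3) bundle_rel_def
    using Pg \<psi> jid id_pointed_smooth_map[of m] jet_act_id[OF Pg(2), of origin]
    by (auto simp: jet2_at_0_eq id_def comp_def intro!: exI[of _ \<psi>] exI[of _ "\<lambda>v. v"])
  then show thesis using that[of \<psi> g] * \<psi> by blast
qed

end

section \<open>Components of a rough velocity field and their change of chart\<close>

locale rough_field = manifold m M A for m :: nat and M :: "'a topology" and A +
  fixes n :: nat and f :: "'a \<Rightarrow> 'a velocity"
  assumes field: "rough_velocity_field m n M A f"
begin

lemma field_representative:
  assumes q: "q \<in> topspace M"
  obtains \<psi> g where "local_diffeo_at_0 m A \<psi>" "\<psi> origin = q"
    "\<And>U x. (U, x) \<in> A \<Longrightarrow> q \<in> U \<Longrightarrow> fibre_coords m A x (f q) = jet_act m (jet2_at_0 m (x \<circ> \<psi>)) g"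
proof -
  have c: "f q \<in> velocity_bundle m n A" "base_point m A (f q) = q"
    using field q by (auto simp: rough_velocity_field_def)
  obtain \<psi> g where \<psi>: "local_diffeo_at_0 m A \<psi>" "(frame_jet m A \<psi>, g) \<in> f q"
    "\<And>\<psi>' g'. local_diffeo_at_0 m A \<psi>' \<Longrightarrow> (frame_jet m A \<psi>', g') \<in> f q \<Longrightarrow> \<psi>' origin = \<psi> origin"
    "\<And>\<psi>' g' U x. local_diffeo_at_0 m A \<psi>' \<Longrightarrow> (frame_jet m A \<psi>', g') \<in> f q \<Longrightarrow> (U, x) \<in> A \<Longrightarrow> \<psi> origin \<in> U
       \<Longrightarrow> jet_act m (jet2_at_0 m (x \<circ> \<psi>')) g' = jet_act m (jet2_at_0 m (x \<circ> \<psi>)) g"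
    by (rule velocity_class_coords[OF c(1)]) blast
  have "base_point m A (f q) = \<psi> origin"
    unfolding base_point_def using \<psi>(1,2,3) by (intro the_equality) blast+
  then have 1: "\<psi> origin = q" using c(2) by simp
  have "fibre_coords m A x (f q) = jet_act m (jet2_at_0 m (x \<circ> \<psi>)) g" if "(U, x) \<in> A" "q \<in> U" for U x
    unfolding fibre_coords_def using \<psi> 1 that by (intro the_equality) blast+
  then show thesis using that \<psi>(1) 1 by blast
qed

text \<open>Components are taken as functions on the chart image rather than on the manifold, so
  that \<open>partial\<close> and \<open>smooth_on\<close> apply.\<close>

definition coord :: "'a set \<Rightarrow> ('a \<Rightarrow> vec) \<Rightarrow> forest \<Rightarrow> nat \<Rightarrow> vec \<Rightarrow> real" where
  "coord U x \<tau> i v = fibre_coords m A x (f (inv_into U x v)) \<tau> i"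

lemma coord_at: "(U, x) \<in> A \<Longrightarrow> q \<in> U \<Longrightarrow> coord U x \<tau> i (x q) = fibre_coords m A x (f q) \<tau> i"
  by (simp add: coord_def)

lemma coord_smooth:
  "(U, x) \<in> A \<Longrightarrow> \<tau> \<in> forests n \<Longrightarrow> i < m \<Longrightarrow> smooth_on m (x ` U) (coord U x \<tau> i)"
  using field unfolding rough_velocity_field_def coord_def by blast

lemma chart_in_space: "(U, x) \<in> A \<Longrightarrow> q \<in> U \<Longrightarrow> q \<in> topspace M"
  using chart_open openin_subset by blast

lemma coord_outside: "(U, x) \<in> A \<Longrightarrow> q \<in> U \<Longrightarrow> m \<le> i \<Longrightarrow> coord U x \<tau> i (x q) = 0"
  using field_representative[OF chart_in_space, of U x q] coord_at jet_act_outside by metis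

text \<open>Near the origin \<open>y\<close> after \<open>\<psi>\<close> is the transition map after
  \<open>x\<close> after \<open>\<psi>\<close>; by functoriality of the jet action the frame
  \<open>\<psi>\<close> and its tuple drop out.\<close>

lemma coord_change:
  assumes "(U, x) \<in> A" "(V, y) \<in> A" "q \<in> U" "q \<in> V"
  shows "coord V y \<tau> i (y q) =
    jet_act m (jet2_at m (\<lambda>v. y (inv_into U x v)) (x q)) (\<lambda>\<tau> i. coord U x \<tau> i (x q)) \<tau> i"
proof -
  obtain \<psi> g where \<psi>: "local_diffeo_at_0 m A \<psi>" "\<psi> origin = q"
    "\<And>U x. (U, x) \<in> A \<Longrightarrow> q \<in> U \<Longrightarrow> fibre_coords m A x (f q) = jet_act m (jet2_at_0 m (x \<circ> \<psi>)) g"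
    using field_representative[OF chart_in_space[OF assms(1,3)]] by metis
  obtain W where W: "openin (Euclidean_space m) W" "origin \<in> W" "\<psi> ` W \<subseteq> U"
    "\<And>i. i < m \<Longrightarrow> smooth_on m W (\<lambda>w. x (\<psi> w) i)"
    using local_diffeo_smooth[OF \<psi>(1) assms(1)] \<psi>(2) assms(3) by metis
  let ?\<phi> = "\<lambda>v. y (inv_into U x v)"
  have im: "(\<lambda>w. x (\<psi> w)) ` W \<subseteq> topspace (Euclidean_space m)"
    using W(3) chart_point_Euclidean[OF assms(1)] by auto
  have "jet_act m (jet2_at m (\<lambda>w. ?\<phi> (x (\<psi> w))) origin) g
     = jet_act m (jet2_at m ?\<phi> (x (\<psi> origin))) (jet_act m (jet2_at m (\<lambda>w. x (\<psi> w)) origin) g)"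
    using \<psi>(2) assms
    by (intro jet_act_comp[OF W(1,2,4) im overlap_open[OF assms(1) chart_open[OF assms(2)]] _
          transition_smooth[OF assms(1,2)]]) auto
  moreover have "jet2_at m (\<lambda>w. ?\<phi> (x (\<psi> w))) origin = jet2_at m (\<lambda>w. y (\<psi> w)) origin"
    using W(3) assms(1) by (intro jet2_at_cong[OF W(1,2)]) auto
  ultimately have "fibre_coords m A y (f q) = jet_act m (jet2_at m ?\<phi> (x q)) (fibre_coords m A x (f q))"
    using \<psi>(2,3) assms by (simp add: jet2_at_0_eq comp_def)
  then show ?thesis using assms by (simp add: coord_at)
qed

lemma coord_change_Vertex:
  assumes "(U, x) \<in> A" "(V, y) \<in> A" "q \<in> U" "q \<in> V" "i < m"
  shows "coord V y (Vertex \<alpha>) i (y q) =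
    (\<Sum>j<m. partial j (\<lambda>v. y (inv_into U x v) i) (x q) * coord U x (Vertex \<alpha>) j (x q))"
  using coord_change[OF assms(1-4)] assms(5) by (simp add: jet2_at_def)

lemma coord_change_Stack:
  assumes "(U, x) \<in> A" "(V, y) \<in> A" "q \<in> U" "q \<in> V" "i < m"
  shows "coord V y (Stack \<alpha> \<beta>) i (y q) =
    (\<Sum>j<m. partial j (\<lambda>v. y (inv_into U x v) i) (x q) * coord U x (Stack \<alpha> \<beta>) j (x q))"
  using coord_change[OF assms(1-4)] assms(5) by (simp add: jet2_at_def)

text \<open>The jet action reads the two labels in sorted order, so the formula for given \<alpha>
  and \<beta> rests on the symmetry of second derivatives.\<close>

lemma coord_change_Dots:
  assumes "(U, x) \<in> A" "(V, y) \<in> A" "q \<in> U" "q \<in> V" "i < m"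
  shows "coord V y (Dots (Upair \<alpha> \<beta>)) i (y q) =
    (\<Sum>j<m. partial j (\<lambda>v. y (inv_into U x v) i) (x q) * coord U x (Dots (Upair \<alpha> \<beta>)) j (x q))
    + (\<Sum>j<m. \<Sum>k<m. partial k (partial j (\<lambda>v. y (inv_into U x v) i)) (x q)
        * coord U x (Vertex \<alpha>) j (x q) * coord U x (Vertex \<beta>) k (x q))"
proof -
  have sym: "partial j (partial k (\<lambda>v. y (inv_into U x v) i)) (x q) = partial k (partial j (\<lambda>v. y (inv_into U x v) i)) (x q)"
    if "i < m" "j < m" "k < m" for i j k
    using assms that
    by (intro partial_commute[OF transition_smooth[OF assms(1,2)] overlap_open[OF assms(1) chart_open[OF assms(2)]]]) auto
  show ?thesis
    unfolding coord_change[OF assms(1-4)] jet2_at_def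
    by (subst jet_act_Dots) (use assms(5) sym in auto)
qed

text \<open>Differentiate the transition law of the \<open>Vertex \<beta>\<close> components in the
  direction of the \<open>Vertex \<alpha>\<close> components. The product rule yields the first
  derivatives of the transition map applied to the admissibility identity in the chart
  \<open>x\<close>, plus a term with its second derivatives; that term is precisely the
  inhomogeneous part of the \<open>Dots\<close> transition law.\<close>

lemma admissible_in_chart:
  assumes adm: "admissible m n M A f" and y: "(V, y) \<in> A" "q \<in> V"
    and i: "i < m" and ab: "\<alpha> \<in> {1..n}" "\<beta> \<in> {1..n}"
  shows "(\<Sum>j<m. partial j (coord V y (Vertex \<beta>) i) (y q) * coord V y (Vertex \<alpha>) j (y q))
    = coord V y (Dots (Upair \<alpha> \<beta>)) i (y q) + coord V y (Stack \<alpha> \<beta>) i (y q)"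
proof -
  obtain U x where x: "(U, x) \<in> A" "q \<in> U" and
    "\<forall>i<m. \<forall>\<alpha>\<in>{1..n}. \<forall>\<beta>\<in>{1..n}.
       (\<Sum>j<m. partial j (\<lambda>v. fibre_coords m A x (f (inv_into U x v)) (Vertex \<beta>) i) (x q)
           * fibre_coords m A x (f q) (Vertex \<alpha>) j)
         = fibre_coords m A x (f q) (Dots (Upair \<alpha> \<beta>)) i + fibre_coords m A x (f q) (Stack \<alpha> \<beta>) i"
    using adm chart_in_space[OF y] unfolding admissible_def by fast
  then have adm_x: "(\<Sum>k<m. partial k (coord U x (Vertex \<beta>) j) (x q) * coord U x (Vertex \<alpha>) k (x q))
    = coord U x (Dots (Upair \<alpha> \<beta>)) j (x q) + coord U x (Stack \<alpha> \<beta>) j (x q)" if "j < m" for j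
    using ab that coord_at[OF x] by (simp add: coord_def[abs_def])
  define \<phi> where "\<phi> = (\<lambda>l v. y (inv_into U x v) l)"
  define d where "d = (\<lambda>k. coord U x (Vertex \<alpha>) k (x q))"
  define Fb where "Fb = coord U x (Vertex \<beta>)"
  define G where "G = coord V y (Vertex \<beta>) i"
  \<comment> \<open>Straight line in the chart \<open>x\<close> through \<open>x q\<close> with the
    \<alpha> components as velocity; \<open>g\<close> is its image in the chart
    \<open>y\<close>.\<close>
  define c where "c t = (\<lambda>k. x q k + t * d k)" for t :: real
  define g where "g t = y (inv_into U x (c t))" for t
  let ?O = "x ` (U \<inter> V)"
  have vert: "Vertex \<beta> \<in> forests n" using ab by (auto simp: forests_def)
  have O: "openin (Euclidean_space m) ?O" using overlap_open[OF x(1) chart_open[OF y(1)]] .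
  have \<phi>: "smooth_on m ?O (\<phi> l)" if "l < m" for l
    using transition_smooth[OF x(1) y(1) that] by (simp add: \<phi>_def)
  have c0: "c 0 = x q" by (simp add: c_def)
  have g0: "g 0 = y q" using x by (simp add: g_def c0)
  have xq: "x q \<in> ?O" using x y by auto
  \<comment> \<open>By \<open>coord_outside\<close> the entries of \<open>d\<close> beyond
    \<open>m\<close> vanish, so the line never leaves the coordinate space.\<close>
  have cE: "c t \<in> topspace (Euclidean_space m)" for t
    using chart_point_Euclidean[OF x] coord_outside[OF x]
    by (auto simp: topspace_Euclidean_space c_def d_def)
  have dc: "((\<lambda>t. c t k) has_real_derivative d k) (at 0)" for k
    unfolding c_def by (auto intro!: derivative_eq_intros)
  have evO: "\<forall>\<^sub>F t in at 0. c t \<in> ?O"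
    using DERIV_isCont[OF dc] cE c0 xq by (intro eventually_curve_in_open[OF _ _ O]) auto
  have gy: "g t = y q'" if "c t = x q'" "q' \<in> U \<inter> V" for t q'
    using that x by (simp add: g_def)
  have dg: "((\<lambda>t. g t l) has_real_derivative coord V y (Vertex \<alpha>) l (y q)) (at 0)" if "l < m" for l
  proof -
    have "((\<lambda>t. \<phi> l (c t)) has_real_derivative (\<Sum>k<m. partial k (\<phi> l) (c 0) * d k)) (at 0)"
      using xq c0 cE dc by (intro smooth_on_chain_rule_curve[OF \<phi>[OF that] O]) auto
    then show ?thesis
      unfolding coord_change_Vertex[OF x(1) y(1) x(2) y(2) that] by (simp add: \<phi>_def g_def c0 d_def)
  qed
  have gE: "\<forall>\<^sub>F t in at 0. g t \<in> topspace (Euclidean_space m)"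
    using evO by eventually_elim (use gy chart_point_Euclidean[OF y(1)] in force)
  have DG: "((\<lambda>t. G (g t)) has_real_derivative
      (\<Sum>l<m. partial l G (g 0) * coord V y (Vertex \<alpha>) l (y q))) (at 0)"
    unfolding G_def using g0 y gE dg
    by (intro smooth_on_chain_rule_curve[OF coord_smooth[OF y(1) vert i] chart_image_open[OF y(1)]]) auto
  have ev: "G (g t) = (\<Sum>j<m. partial j (\<phi> i) (c t) * Fb j (c t))" if ct: "c t \<in> ?O" for t
  proof -
    obtain q' where q': "c t = x q'" "q' \<in> U" "q' \<in> V" using ct by auto
    show ?thesis
      using coord_change_Vertex[OF x(1) y(1) q'(2,3) i, of \<beta>] gy[of t q'] q'
      by (simp add: G_def \<phi>_def Fb_def)
  qed
  have "\<forall>\<^sub>F t in nhds 0. G (g t) = (\<Sum>j<m. partial j (\<phi> i) (c t) * Fb j (c t))"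
    using evO ev xq c0 unfolding eventually_at_filter by (auto elim!: eventually_mono)
  moreover have "((\<lambda>t. \<Sum>j<m. partial j (\<phi> i) (c t) * Fb j (c t)) has_real_derivative
      (\<Sum>j<m. (\<Sum>k<m. partial k (partial j (\<phi> i)) (c 0) * d k) * Fb j (c 0)
          + (\<Sum>k<m. partial k (Fb j) (c 0) * d k) * partial j (\<phi> i) (c 0))) (at 0)"
  proof (intro DERIV_sum DERIV_mult)
    fix j assume "j \<in> {..<m}"
    then have j: "j < m" by simp
    show "((\<lambda>t. partial j (\<phi> i) (c t)) has_real_derivative
        (\<Sum>k<m. partial k (partial j (\<phi> i)) (c 0) * d k)) (at 0)"
      using xq c0 cE dc by (intro smooth_on_chain_rule_curve[OF smooth_on_partial[OF \<phi>[OF i] j] O]) auto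
    show "((\<lambda>t. Fb j (c t)) has_real_derivative (\<Sum>k<m. partial k (Fb j) (c 0) * d k)) (at 0)"
      unfolding Fb_def using x c0 cE dc
      by (intro smooth_on_chain_rule_curve[OF coord_smooth[OF x(1) vert j] chart_image_open[OF x(1)]]) auto
  qed
  ultimately have "((\<lambda>t. G (g t)) has_real_derivative
      (\<Sum>j<m. (\<Sum>k<m. partial k (partial j (\<phi> i)) (c 0) * d k) * Fb j (c 0)
          + (\<Sum>k<m. partial k (Fb j) (c 0) * d k) * partial j (\<phi> i) (c 0))) (at 0)"
    by (subst DERIV_cong_ev[OF refl _ refl]) auto
  \<comment> \<open>Two computations of the derivative of \<open>G (g t)\<close> at 0 must agree:
    directly in the chart \<open>y\<close>, and through the transition law along the line in the
    chart \<open>x\<close>.\<close>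
  from DERIV_unique[OF DG this]
  have "(\<Sum>l<m. partial l G (y q) * coord V y (Vertex \<alpha>) l (y q))
      = (\<Sum>j<m. (\<Sum>k<m. partial k (partial j (\<phi> i)) (x q) * d k) * Fb j (x q)
          + (\<Sum>k<m. partial k (Fb j) (x q) * d k) * partial j (\<phi> i) (x q))"
    by (simp add: g0 c0)
  also have "\<dots> = (\<Sum>j<m. (\<Sum>k<m. partial k (partial j (\<phi> i)) (x q) * d k) * Fb j (x q))
      + (\<Sum>j<m. partial j (\<phi> i) (x q) * (coord U x (Dots (Upair \<alpha> \<beta>)) j (x q) + coord U x (Stack \<alpha> \<beta>) j (x q)))"
    using adm_x by (simp add: Fb_def d_def sum.distrib mult.commute)
  also have "(\<Sum>j<m. (\<Sum>k<m. partial k (partial j (\<phi> i)) (x q) * d k) * Fb j (x q))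
      = (\<Sum>j<m. \<Sum>k<m. partial j (partial k (\<phi> i)) (x q) * d j * Fb k (x q))"
    by (subst sum.swap) (simp add: sum_distrib_right)
  also have "\<dots> = (\<Sum>j<m. \<Sum>k<m. partial k (partial j (\<phi> i)) (x q) * d j * Fb k (x q))"
    using partial_commute[OF \<phi>[OF i] O xq] by simp
  finally show ?thesis
    unfolding coord_change_Dots[OF x(1) y(1) x(2) y(2) i] coord_change_Stack[OF x(1) y(1) x(2) y(2) i]
    by (simp add: G_def \<phi>_def d_def Fb_def distrib_left sum.distrib)
qed

end

section \<open>The Euler step of an admissible field\<close>

text \<open>The sum in the definition of an integral curve with point and coordinate fixed; its
  bilinearity in \<open>g\<close> and \<open>X\<close> isolates the algebra of forests from the
  analysis.\<close>

definition rough_increment :: "nat \<Rightarrow> (forest \<Rightarrow> real) \<Rightarrow> (forest \<Rightarrow> real) \<Rightarrow> real" where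
  "rough_increment n g X = (\<Sum>\<tau>\<in>forests n. 1 / sym_factor \<tau> * g \<tau> * X \<tau>)"

lemma forest_memberships [simp]:
  "Vertex \<alpha> \<in> forests n \<longleftrightarrow> \<alpha> \<in> {1..n}"
  "Dots (Upair \<alpha> \<beta>) \<in> forests n \<longleftrightarrow> \<alpha> \<in> {1..n} \<and> \<beta> \<in> {1..n}"
  "Stack \<alpha> \<beta> \<in> forests n \<longleftrightarrow> \<alpha> \<in> {1..n} \<and> \<beta> \<in> {1..n}"
  by (auto simp: forests_def)

lemma forests_cases:
  assumes "\<tau> \<in> forests n"
  obtains \<alpha> where "\<tau> = Vertex \<alpha>" "\<alpha> \<in> {1..n}"
  | \<alpha> \<beta> where "\<tau> = Dots (Upair \<alpha> \<beta>)" "\<alpha> \<in> {1..n}" "\<beta> \<in> {1..n}"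
  | \<alpha> \<beta> where "\<tau> = Stack \<alpha> \<beta>" "\<alpha> \<in> {1..n}" "\<beta> \<in> {1..n}"
  using assms unfolding forests_def by blast

text \<open>Passage from unordered to ordered pairs of labels: distinct labels are met twice with
  symmetry factor 1, equal labels once with symmetry factor 2, so a uniform factor 1/2
  results.\<close>

lemma sum_Dots:
  fixes g :: "forest \<Rightarrow> real"
  shows "(\<Sum>\<tau>\<in>(\<lambda>(\<alpha>, \<beta>). Dots (Upair \<alpha> \<beta>)) ` ({1..n} \<times> {1..n}). 1 / sym_factor \<tau> * g \<tau>)
    = (\<Sum>\<alpha>=1..n. \<Sum>\<beta>=1..n. g (Dots (Upair \<alpha> \<beta>))) / 2"
proof -
  let ?S = "{1..n} \<times> {1..n}" and ?q = "\<lambda>(\<alpha>, \<beta>). Dots (Upair \<alpha> \<beta>)"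
  have "(\<Sum>\<alpha>=1..n. \<Sum>\<beta>=1..n. g (Dots (Upair \<alpha> \<beta>))) / 2 = (\<Sum>p\<in>?S. g (?q p) / 2)"
    by (simp add: sum.cartesian_product sum_divide_distrib case_prod_beta)
  also have "\<dots> = (\<Sum>\<tau>\<in>?q ` ?S. \<Sum>p\<in>{p. p \<in> ?S \<and> ?q p = \<tau>}. g (?q p) / 2)"
    by (rule sum.image_gen) auto
  also have "\<dots> = (\<Sum>\<tau>\<in>?q ` ?S. 1 / sym_factor \<tau> * g \<tau>)"
  proof (rule sum.cong[OF refl])
    fix \<tau> assume "\<tau> \<in> ?q ` ?S"
    then obtain p where p: "p \<in> ?S" "\<tau> = ?q p" by blast
    obtain a b where "p = (a, b)" by (cases p)
    then have ab: "\<tau> = Dots (Upair a b)" "a \<in> {1..n}" "b \<in> {1..n}" using p by auto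
    have fib: "{p. p \<in> ?S \<and> ?q p = \<tau>} = {(a, b), (b, a)}" using ab by auto
    have comm: "Upair b a = Upair a b" by simp
    show "(\<Sum>p\<in>{p. p \<in> ?S \<and> ?q p = \<tau>}. g (?q p) / 2) = 1 / sym_factor \<tau> * g \<tau>"
      unfolding fib unfolding ab(1) by (cases "a = b") (simp_all add: comm)
  qed
  finally show ?thesis by simp
qed

lemma Collect_pairs_eq_image: "{g a b |a b. a \<in> A \<and> b \<in> B} = (\<lambda>(a, b). g a b) ` (A \<times> B)"
  by force

lemma rough_increment_eq:
  "rough_increment n g X = (\<Sum>\<alpha>=1..n. g (Vertex \<alpha>) * X (Vertex \<alpha>))
     + (\<Sum>\<alpha>=1..n. \<Sum>\<beta>=1..n. g (Dots (Upair \<alpha> \<beta>)) * X (Dots (Upair \<alpha> \<beta>))) / 2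
     + (\<Sum>\<alpha>=1..n. \<Sum>\<beta>=1..n. g (Stack \<alpha> \<beta>) * X (Stack \<alpha> \<beta>))"
proof -
  let ?S = "{1..n} \<times> {1..n}" and ?q = "\<lambda>(\<alpha>, \<beta>). Dots (Upair \<alpha> \<beta>)" and ?s = "\<lambda>(\<alpha>, \<beta>). Stack \<alpha> \<beta>"
  have f: "forests n = Vertex ` {1..n} \<union> ?q ` ?S \<union> ?s ` ?S"
    by (simp only: forests_def Collect_pairs_eq_image)
  let ?t = "\<lambda>\<tau>. 1 / sym_factor \<tau> * (g \<tau> * X \<tau>)"
  have "rough_increment n g X = sum ?t (Vertex ` {1..n} \<union> ?q ` ?S \<union> ?s ` ?S)"
    unfolding rough_increment_def f by (simp only: mult.assoc)
  also have "\<dots> = sum ?t (Vertex ` {1..n}) + sum ?t (?q ` ?S) + sum ?t (?s ` ?S)"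
    by (subst sum.union_disjoint, simp, simp, force, subst sum.union_disjoint) auto
  also have "sum ?t (?q ` ?S) = (\<Sum>\<alpha>=1..n. \<Sum>\<beta>=1..n. g (Dots (Upair \<alpha> \<beta>)) * X (Dots (Upair \<alpha> \<beta>))) / 2"
    by (rule sum_Dots)
  also have "sum ?t (Vertex ` {1..n}) = (\<Sum>\<alpha>=1..n. g (Vertex \<alpha>) * X (Vertex \<alpha>))"
    by (subst sum.reindex) (auto simp: inj_on_def)
  also have "sum ?t (?s ` ?S) = (\<Sum>\<alpha>=1..n. \<Sum>\<beta>=1..n. g (Stack \<alpha> \<beta>) * X (Stack \<alpha> \<beta>))"
    by (subst sum.reindex) (auto simp: inj_on_def sum.cartesian_product case_prod_beta)
  finally show ?thesis .
qed

lemma rough_increment_diff_left: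
  "rough_increment n (\<lambda>\<tau>. g \<tau> - g' \<tau>) X = rough_increment n g X - rough_increment n g' X"
  by (simp add: rough_increment_def algebra_simps sum_subtractf diff_divide_distrib)

lemma rough_increment_diff_right:
  "rough_increment n g (\<lambda>\<tau>. X \<tau> - X' \<tau>) = rough_increment n g X - rough_increment n g X'"
  by (simp add: rough_increment_def algebra_simps sum_subtractf diff_divide_distrib)

lemma inverse_sym_factor: "0 < 1 / sym_factor \<tau>" "1 / sym_factor \<tau> \<le> 1"
  by (cases \<tau>; simp)+

lemma rough_increment_bound:
  assumes "\<And>\<tau>. \<tau> \<in> forests n \<Longrightarrow> \<bar>g \<tau>\<bar> \<le> G" "\<And>\<tau>. \<tau> \<in> forests n \<Longrightarrow> \<bar>X \<tau>\<bar> \<le> D"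
  shows "\<bar>rough_increment n g X\<bar> \<le> real (card (forests n)) * (G * D)"
proof -
  have "\<bar>1 / sym_factor \<tau> * g \<tau> * X \<tau>\<bar> \<le> G * D" if "\<tau> \<in> forests n" for \<tau>
  proof -
    have "\<bar>1 / sym_factor \<tau> * g \<tau> * X \<tau>\<bar> = (1 / sym_factor \<tau>) * (\<bar>g \<tau>\<bar> * \<bar>X \<tau>\<bar>)"
      using inverse_sym_factor(1)[of \<tau>] by (simp add: abs_mult)
    also have "\<dots> \<le> 1 * (\<bar>g \<tau>\<bar> * \<bar>X \<tau>\<bar>)"
      using inverse_sym_factor(2) by (intro mult_right_mono) auto
    also have "\<dots> \<le> G * D"
      using assms[OF that] by simp (intro mult_mono; auto)
    finally show ?thesis .
  qed
  then have "(\<Sum>\<tau>\<in>forests n. \<bar>1 / sym_factor \<tau> * g \<tau> * X \<tau>\<bar>) \<le> real (card (forests n)) * (G * D)"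
    by (rule sum_bounded_above)
  then show ?thesis unfolding rough_increment_def by (rule order_trans[OF sum_abs])
qed

fun forest_degree :: "forest \<Rightarrow> nat" where
  "forest_degree (Vertex \<alpha>) = 1"
| "forest_degree (Dots P) = 2"
| "forest_degree (Stack \<alpha> \<beta>) = 2"

text \<open>\<open>h\<close> stands for the control to the power \<open>1 / p\<close>: a forest with
  \<open>k\<close> vertices has size of order \<open>h ^ k\<close>, and remainders are compared as
  powers of \<open>h\<close>.\<close>

definition rough_size :: "nat \<Rightarrow> real \<Rightarrow> real \<Rightarrow> (forest \<Rightarrow> real) \<Rightarrow> bool" where
  "rough_size n C h X \<longleftrightarrow> (\<forall>\<tau>\<in>forests n. \<bar>X \<tau>\<bar> \<le> C * h ^ forest_degree \<tau>)"

lemma rough_increment_first_order: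
  assumes X: "rough_size n C h X" and h: "0 \<le> h" "h \<le> 1" and C: "0 \<le> C"
    and g: "\<And>\<tau>. \<tau> \<in> forests n \<Longrightarrow> \<bar>g \<tau>\<bar> \<le> G"
  shows "\<bar>rough_increment n g X\<bar> \<le> real (card (forests n)) * (G * (C * h))"
proof (rule rough_increment_bound[OF g])
  fix \<tau> assume t: "\<tau> \<in> forests n"
  have "h * h \<le> h * 1" using h by (intro mult_left_mono) auto
  then have "h ^ forest_degree \<tau> \<le> h" by (cases \<tau>) (auto simp: power2_eq_square)
  then have "C * h ^ forest_degree \<tau> \<le> C * h" using C by (intro mult_left_mono)
  then show "\<bar>X \<tau>\<bar> \<le> C * h" using X t by (force simp: rough_size_def)
qed

text \<open>Setting the one-vertex entries of \<open>X\<close> to zero leaves the forests of degree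
  two, each of order \<open>h\<^sup>2\<close>.\<close>

lemma rough_increment_second_order:
  assumes X: "rough_size n C h X" and C: "0 \<le> C"
    and g: "\<And>\<tau>. \<tau> \<in> forests n \<Longrightarrow> \<bar>g \<tau>\<bar> \<le> G"
  shows "\<bar>rough_increment n g X - (\<Sum>\<alpha>=1..n. g (Vertex \<alpha>) * X (Vertex \<alpha>))\<bar> \<le> real (card (forests n)) * (G * (C * h\<^sup>2))"
proof -
  define X' where "X' \<tau> = (if forest_degree \<tau> = 1 then 0 else X \<tau>)" for \<tau>
  have "rough_increment n g X - (\<Sum>\<alpha>=1..n. g (Vertex \<alpha>) * X (Vertex \<alpha>)) = rough_increment n g X'"
    unfolding rough_increment_eq by (simp add: X'_def)
  moreover have "\<bar>X' \<tau>\<bar> \<le> C * h\<^sup>2" if "\<tau> \<in> forests n" for \<tau>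
  proof -
    have "\<bar>X \<tau>\<bar> \<le> C * h ^ forest_degree \<tau>" using X that by (simp add: rough_size_def)
    then show ?thesis using C by (cases \<tau>) (auto simp: X'_def)
  qed
  ultimately show ?thesis using rough_increment_bound[of n g G X', OF g] by simp
qed

text \<open>Chen's relation: \<^verbatim>\<open>c\<close> is the concatenation of \<^verbatim>\<open>a\<close> followed by \<^verbatim>\<open>b\<close>.\<close>

definition chen :: "nat \<Rightarrow> (forest \<Rightarrow> real) \<Rightarrow> (forest \<Rightarrow> real) \<Rightarrow> (forest \<Rightarrow> real) \<Rightarrow> bool" where
  "chen n a b c \<longleftrightarrow> (\<forall>\<alpha>\<in>{1..n}. \<forall>\<beta>\<in>{1..n}.
     c (Vertex \<alpha>) = a (Vertex \<alpha>) + b (Vertex \<alpha>) \<and>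
     c (Dots (Upair \<alpha> \<beta>)) = a (Dots (Upair \<alpha> \<beta>)) + b (Dots (Upair \<alpha> \<beta>))
        + a (Vertex \<alpha>) * b (Vertex \<beta>) + b (Vertex \<alpha>) * a (Vertex \<beta>) \<and>
     c (Stack \<alpha> \<beta>) = a (Stack \<alpha> \<beta>) + b (Stack \<alpha> \<beta>) + a (Vertex \<alpha>) * b (Vertex \<beta>))"

text \<open>The two cross terms of \<open>Dots\<close> contribute equally by symmetry of the
  coefficient and cancel the factor 1/2. Together with the cross term of \<open>Stack\<close> they
  carry the coefficient on the right-hand side of the admissibility condition.\<close>

lemma rough_increment_chen:
  assumes "chen n a b c"
  shows "rough_increment n g c = rough_increment n g a + rough_increment n g b
    + (\<Sum>\<beta>=1..n. \<Sum>\<alpha>=1..n. (g (Dots (Upair \<alpha> \<beta>)) + g (Stack \<alpha> \<beta>)) * a (Vertex \<alpha>) * b (Vertex \<beta>))"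
proof -
  define e where "e \<tau> = c \<tau> - a \<tau> - b \<tau>" for \<tau>
  have e: "e (Vertex \<alpha>) = 0" "e (Dots (Upair \<alpha> \<beta>)) = a (Vertex \<alpha>) * b (Vertex \<beta>) + b (Vertex \<alpha>) * a (Vertex \<beta>)"
     "e (Stack \<alpha> \<beta>) = a (Vertex \<alpha>) * b (Vertex \<beta>)" if "\<alpha> \<in> {1..n}" "\<beta> \<in> {1..n}" for \<alpha> \<beta>
    using assms that by (simp_all add: chen_def e_def)
  have sw: "(\<Sum>\<alpha>=1..n. \<Sum>\<beta>=1..n. g (Dots (Upair \<alpha> \<beta>)) * (b (Vertex \<alpha>) * a (Vertex \<beta>)))
     = (\<Sum>\<alpha>=1..n. \<Sum>\<beta>=1..n. g (Dots (Upair \<alpha> \<beta>)) * (a (Vertex \<alpha>) * b (Vertex \<beta>)))"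
  proof -
    have "Upair \<alpha> \<beta> = Upair \<beta> \<alpha>" for \<alpha> \<beta> :: nat by simp
    then show ?thesis by (subst sum.swap) (simp only: mult.commute)
  qed
  have "rough_increment n g e = (\<Sum>\<alpha>=1..n. \<Sum>\<beta>=1..n. g (Dots (Upair \<alpha> \<beta>)) * (a (Vertex \<alpha>) * b (Vertex \<beta>) + b (Vertex \<alpha>) * a (Vertex \<beta>))) / 2
     + (\<Sum>\<alpha>=1..n. \<Sum>\<beta>=1..n. g (Stack \<alpha> \<beta>) * (a (Vertex \<alpha>) * b (Vertex \<beta>)))"
  proof -
    have "(\<Sum>\<alpha>=1..n. g (Vertex \<alpha>) * e (Vertex \<alpha>)) = 0"
      by (intro sum.neutral ballI mult_eq_0_iff[THEN iffD2] disjI2 e(1))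
    moreover have "(\<Sum>\<alpha>=1..n. \<Sum>\<beta>=1..n. g (Dots (Upair \<alpha> \<beta>)) * e (Dots (Upair \<alpha> \<beta>)))
       = (\<Sum>\<alpha>=1..n. \<Sum>\<beta>=1..n. g (Dots (Upair \<alpha> \<beta>)) * (a (Vertex \<alpha>) * b (Vertex \<beta>) + b (Vertex \<alpha>) * a (Vertex \<beta>)))"
      by (intro sum.cong refl arg_cong2[where f = times] e(2))
    moreover have "(\<Sum>\<alpha>=1..n. \<Sum>\<beta>=1..n. g (Stack \<alpha> \<beta>) * e (Stack \<alpha> \<beta>))
       = (\<Sum>\<alpha>=1..n. \<Sum>\<beta>=1..n. g (Stack \<alpha> \<beta>) * (a (Vertex \<alpha>) * b (Vertex \<beta>)))"
      by (intro sum.cong refl arg_cong2[where f = times] e(3))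
    ultimately show ?thesis unfolding rough_increment_eq by simp
  qed
  also have "\<dots> = (\<Sum>\<alpha>=1..n. \<Sum>\<beta>=1..n. g (Dots (Upair \<alpha> \<beta>)) * (a (Vertex \<alpha>) * b (Vertex \<beta>)))
     + (\<Sum>\<alpha>=1..n. \<Sum>\<beta>=1..n. g (Stack \<alpha> \<beta>) * (a (Vertex \<alpha>) * b (Vertex \<beta>)))"
    using sw by (simp add: distrib_left sum.distrib)
  also have "\<dots> = (\<Sum>\<alpha>=1..n. \<Sum>\<beta>=1..n. (g (Dots (Upair \<alpha> \<beta>)) + g (Stack \<alpha> \<beta>)) * a (Vertex \<alpha>) * b (Vertex \<beta>))"
    by (simp add: distrib_right sum.distrib mult.assoc)
  also have "\<dots> = (\<Sum>\<beta>=1..n. \<Sum>\<alpha>=1..n. (g (Dots (Upair \<alpha> \<beta>)) + g (Stack \<alpha> \<beta>)) * a (Vertex \<alpha>) * b (Vertex \<beta>))"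
    by (rule sum.swap)
  finally have "rough_increment n g e = \<dots>" .
  moreover have "rough_increment n g e = rough_increment n g c - rough_increment n g a - rough_increment n g b"
    unfolding e_def by (simp add: rough_increment_diff_right)
  ultimately show ?thesis by simp
qed

text \<open>The field in a single chart, as functions on an open set of coordinates; the manifold
  enters through \<open>chart_field\<close>, which supplies these hypotheses for every
  chart.\<close>

locale coord_field =
  fixes m n :: nat and V :: "vec set" and F :: "forest \<Rightarrow> nat \<Rightarrow> vec \<Rightarrow> real"
  assumes V: "openin (Euclidean_space m) V"
    and F: "\<And>\<tau> i. \<tau> \<in> forests n \<Longrightarrow> i < m \<Longrightarrow> smooth_on m V (F \<tau> i)"
    and adm: "\<And>v i \<alpha> \<beta>. v \<in> V \<Longrightarrow> i < m \<Longrightarrow> \<alpha> \<in> {1..n} \<Longrightarrow> \<beta> \<in> {1..n} \<Longrightarrow>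
      (\<Sum>j<m. partial j (F (Vertex \<beta>) i) v * F (Vertex \<alpha>) j v)
         = F (Dots (Upair \<alpha> \<beta>)) i v + F (Stack \<alpha> \<beta>) i v"
begin

definition euler_step :: "(forest \<Rightarrow> real) \<Rightarrow> vec \<Rightarrow> vec" where
  "euler_step X v = (\<lambda>i. if i < m then v i + rough_increment n (\<lambda>\<tau>. F \<tau> i v) X else 0)"

lemma euler_step_Euclidean [simp]: "euler_step X v \<in> topspace (Euclidean_space m)"
  by (auto simp: euler_step_def topspace_Euclidean_space)

text \<open>Second derivatives are included because the almost flow property expands the components
  to first order with quadratic remainder.\<close>

definition bounded_derivs :: "vec set \<Rightarrow> real \<Rightarrow> bool" where
  "bounded_derivs B K \<longleftrightarrow> 0 < K \<and> B \<subseteq> V \<and> (\<forall>\<tau>\<in>forests n. \<forall>i<m. \<forall>u\<in>B.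
     \<bar>F \<tau> i u\<bar> \<le> K \<and> (\<forall>j<m. \<bar>partial j (F \<tau> i) u\<bar> \<le> K \<and> (\<forall>k<m. \<bar>partial k (partial j (F \<tau> i)) u\<bar> \<le> K)))"

lemma bounded_derivs_compact:
  assumes "compact B" "B \<subseteq> V"
  obtains K where "bounded_derivs B K"
proof -
  have c: "continuous_on B G" if "smooth_on m V G" for G
    using smooth_on_continuous[OF that V] assms(2) continuous_on_subset by blast
  let ?J = "forests n \<times> {..<m}"
  obtain K0 where K0: "K0 > 0" "\<And>p z. p \<in> ?J \<Longrightarrow> z \<in> B \<Longrightarrow> \<bar>(\<lambda>(\<tau>, i). F \<tau> i) p z\<bar> \<le> K0"
    by (rule compact_finite_bounded_real[OF assms(1), of ?J "\<lambda>(\<tau>, i). F \<tau> i"])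
       (auto simp: finite_forests intro!: c F)
  obtain K1 where K1: "K1 > 0" "\<And>p z. p \<in> ?J \<times> {..<m} \<Longrightarrow> z \<in> B \<Longrightarrow> \<bar>(\<lambda>((\<tau>, i), j). partial j (F \<tau> i)) p z\<bar> \<le> K1"
    by (rule compact_finite_bounded_real[OF assms(1), of "?J \<times> {..<m}" "\<lambda>((\<tau>, i), j). partial j (F \<tau> i)"])
       (auto simp: finite_forests intro!: c F smooth_on_partial)
  obtain K2 where K2: "K2 > 0" "\<And>p z. p \<in> (?J \<times> {..<m}) \<times> {..<m} \<Longrightarrow> z \<in> B \<Longrightarrow>
      \<bar>(\<lambda>(((\<tau>, i), j), k). partial k (partial j (F \<tau> i))) p z\<bar> \<le> K2"
    by (rule compact_finite_bounded_real[OF assms(1), of "(?J \<times> {..<m}) \<times> {..<m}"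
          "\<lambda>(((\<tau>, i), j), k). partial k (partial j (F \<tau> i))"])
       (auto simp: finite_forests intro!: c F smooth_on_partial)
  have "bounded_derivs B (K0 + K1 + K2)"
    unfolding bounded_derivs_def
  proof (intro conjI ballI allI impI)
    fix \<tau> i u assume *: "\<tau> \<in> forests n" "i < m" "u \<in> B"
    show "\<bar>F \<tau> i u\<bar> \<le> K0 + K1 + K2" using K0(2)[of "(\<tau>, i)" u] K1(1) K2(1) * by simp
    fix j assume j: "j < m"
    show "\<bar>partial j (F \<tau> i) u\<bar> \<le> K0 + K1 + K2" using K1(2)[of "((\<tau>, i), j)" u] K0(1) K2(1) * j by simp
    fix k assume k: "k < m"
    show "\<bar>partial k (partial j (F \<tau> i)) u\<bar> \<le> K0 + K1 + K2"
      using K2(2)[of "(((\<tau>, i), j), k)" u] K0(1) K1(1) * j k by simp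
  qed (use K0(1) K1(1) K2(1) assms in auto)
  then show thesis by (rule that)
qed

lemma euler_step_displacement:
  assumes B: "bounded_derivs B K" and v: "v \<in> B"
    and X: "rough_size n C h X" "0 \<le> h" "h \<le> 1" "0 \<le> C"
  shows "l1_dist m v (euler_step X v) \<le> real m * (real (card (forests n)) * (K * (C * h)))"
proof -
  have "\<bar>v i - euler_step X v i\<bar> \<le> real (card (forests n)) * (K * (C * h))" if "i < m" for i
  proof -
    have "\<bar>rough_increment n (\<lambda>\<tau>. F \<tau> i v) X\<bar> \<le> real (card (forests n)) * (K * (C * h))"
      using B v that by (intro rough_increment_first_order[OF X]) (auto simp: bounded_derivs_def)
    then show ?thesis using that by (simp add: euler_step_def)
  qed
  then show ?thesis unfolding l1_dist_def
    using sum_bounded_above[of "{..<m}" "\<lambda>i. \<bar>v i - euler_step X v i\<bar>"] by simp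
qed

text \<open>The identity part has Lipschitz constant 1 and the increment one of order
  \<open>h\<close>. A constant tending to 1 with \<open>h\<close> is what the induction over the
  scheme can absorb.\<close>

lemma euler_step_lipschitz:
  assumes B: "bounded_derivs B K" and v: "v \<in> B" "w \<in> B"
    and seg: "\<And>t. 0 \<le> t \<Longrightarrow> t \<le> 1 \<Longrightarrow> segment_at v w t \<in> B"
    and X: "rough_size n C h X" "0 \<le> h" "h \<le> 1" "0 \<le> C"
  shows "l1_dist m (euler_step X v) (euler_step X w)
    \<le> (1 + real m * (real (card (forests n)) * (K * (C * h)))) * l1_dist m v w"
proof -
  have BV: "B \<subseteq> V" and VE: "V \<subseteq> topspace (Euclidean_space m)"
    using B V openin_subset by (auto simp: bounded_derivs_def)
  have "\<bar>euler_step X v i - euler_step X w i\<bar> \<le> \<bar>v i - w i\<bar> + real (card (forests n)) * (K * l1_dist m v w * (C * h))" if i: "i < m" for i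
  proof -
    have "\<bar>rough_increment n (\<lambda>\<tau>. F \<tau> i w - F \<tau> i v) X\<bar> \<le> real (card (forests n)) * (K * l1_dist m v w * (C * h))"
    proof (rule rough_increment_first_order[OF X])
      fix \<tau> assume "\<tau> \<in> forests n"
      then show "\<bar>F \<tau> i w - F \<tau> i v\<bar> \<le> K * l1_dist m v w"
        using B v i BV VE
        by (intro smooth_on_lipschitz_segment[OF F[OF _ i] V _ _ BV seg]) (auto simp: bounded_derivs_def)
    qed
    then show ?thesis using i by (simp add: euler_step_def rough_increment_diff_left)
  qed
  then have "l1_dist m (euler_step X v) (euler_step X w)
      \<le> (\<Sum>i<m. \<bar>v i - w i\<bar> + real (card (forests n)) * (K * l1_dist m v w * (C * h)))"
    unfolding l1_dist_def[of m "euler_step X v"] by (intro sum_mono) auto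
  also have "\<dots> = (1 + real m * (real (card (forests n)) * (K * (C * h)))) * l1_dist m v w"
    by (simp add: sum.distrib l1_dist_def algebra_simps)
  finally show ?thesis .
qed

text \<open>\<open>K1 * h\<close> bounds the first step. \<open>K * K1\<^sup>2\<close> is the
  quadratic Taylor remainder and the summand after it the degree-two part of the first step, both
  paired with one-vertex entries of the second step; the last summand comes from the degree-two
  entries of the second step.\<close>

definition flow_defect_const :: "real \<Rightarrow> real \<Rightarrow> real" where
  "flow_defect_const K C = (let K1 = real m * (real (card (forests n)) * (K * C)) in
     real m * (real n * (C * (K * K1\<^sup>2 + real m * (K * (real (card (forests n)) * (K * C))))) + real (card (forests n)) * (K * K1 * C)))"

text \<open>The increment over \<open>b\<close> taken at \<open>w\<close> instead of
  \<open>v\<close> changes, to leading order, by the derivative of the one-vertex components along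
  the one-vertex part \<open>P\<close> of the first step, paired with the one-vertex entries of
  \<open>b\<close>. Chen's relation puts the same double sum into the step over \<open>c\<close>, so
  the two cancel up to third order.\<close>

lemma euler_step_almost_flow:
  assumes B: "bounded_derivs B K" and v: "v \<in> B" and w: "w = euler_step a v"
    and seg: "\<And>t. 0 \<le> t \<Longrightarrow> t \<le> 1 \<Longrightarrow> segment_at v w t \<in> B"
    and a: "rough_size n C h a" and b: "rough_size n C h b" and c: "chen n a b c"
    and h: "0 \<le> h" "h \<le> 1" and C: "0 \<le> C"
  shows "l1_dist m (euler_step b w) (euler_step c v) \<le> flow_defect_const K C * h ^ 3"
proof -
  have BV: "B \<subseteq> V" and VE: "V \<subseteq> topspace (Euclidean_space m)" and K: "0 < K"
    using B V openin_subset by (auto simp: bounded_derivs_def)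
  have vV: "v \<in> V" and vE: "v \<in> topspace (Euclidean_space m)" using BV VE v by auto
  have wE: "w \<in> topspace (Euclidean_space m)" using w by simp
  define N where "N = real (card (forests n))"
  have N: "N \<ge> 0" by (simp add: N_def)
  define K1 where "K1 = real m * (N * (K * C))"
  have K1: "K1 \<ge> 0" using K C N by (simp add: K1_def)
  have d: "l1_dist m v w \<le> K1 * h"
    using euler_step_displacement[OF B v a h C] by (simp add: w K1_def N_def mult_ac)
  have dh: "(l1_dist m v w)\<^sup>2 \<le> K1\<^sup>2 * h\<^sup>2"
    using power_mono[OF d, of 2] by (simp add: power_mult_distrib)
  define P where "P j = (\<Sum>\<alpha>=1..n. F (Vertex \<alpha>) j v * a (Vertex \<alpha>))" for j
  have wP: "\<bar>w j - v j - P j\<bar> \<le> N * (K * (C * h\<^sup>2))" if "j < m" for j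
  proof -
    have "w j - v j = rough_increment n (\<lambda>\<tau>. F \<tau> j v) a" using that by (simp add: w euler_step_def)
    then show ?thesis
      unfolding P_def N_def using that B v
      by (simp only:) (rule rough_increment_second_order[OF a C]; auto simp: bounded_derivs_def)
  qed
  have comp: "\<bar>euler_step b w i - euler_step c v i\<bar>
      \<le> real n * (C * (K * K1\<^sup>2 + real m * (K * (N * (K * C))))) * h ^ 3 + N * (K * K1 * C) * h ^ 3" if i: "i < m" for i
  proof -
    let ?dF = "\<lambda>\<tau>. F \<tau> i w - F \<tau> i v"
    have dF: "\<bar>?dF \<tau>\<bar> \<le> K * (K1 * h)" if "\<tau> \<in> forests n" for \<tau>
    proof -
      have "\<bar>?dF \<tau>\<bar> \<le> K * l1_dist m v w"
        using B that i
        by (intro smooth_on_lipschitz_segment[OF F[OF _ i] V vE wE BV seg]) (auto simp: bounded_derivs_def)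
      also have "\<dots> \<le> K * (K1 * h)" using d K by (intro mult_left_mono) auto
      finally show ?thesis .
    qed
    \<comment> \<open>Admissibility turns the coefficient left by Chen's relation into a directional
      derivative, and the sum over \<alpha> assembles the direction \<open>P\<close>.\<close>
    have "(\<Sum>\<beta>=1..n. \<Sum>\<alpha>=1..n. (F (Dots (Upair \<alpha> \<beta>)) i v + F (Stack \<alpha> \<beta>) i v) * a (Vertex \<alpha>) * b (Vertex \<beta>))
       = (\<Sum>\<beta>=1..n. (\<Sum>j<m. partial j (F (Vertex \<beta>) i) v * P j) * b (Vertex \<beta>))"
    proof (rule sum.cong[OF refl])
      fix \<beta> assume \<beta>: "\<beta> \<in> {1..n}"
      have "(\<Sum>\<alpha>=1..n. (F (Dots (Upair \<alpha> \<beta>)) i v + F (Stack \<alpha> \<beta>) i v) * a (Vertex \<alpha>) * b (Vertex \<beta>))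
         = (\<Sum>\<alpha>=1..n. \<Sum>j<m. partial j (F (Vertex \<beta>) i) v * F (Vertex \<alpha>) j v * a (Vertex \<alpha>)) * b (Vertex \<beta>)"
        using adm[OF vV i _ \<beta>] by (simp add: sum_distrib_right[symmetric])
      also have "\<dots> = (\<Sum>j<m. partial j (F (Vertex \<beta>) i) v * P j) * b (Vertex \<beta>)"
        by (subst sum.swap) (simp add: P_def sum_distrib_left mult.assoc)
      finally show "(\<Sum>\<alpha>=1..n. (F (Dots (Upair \<alpha> \<beta>)) i v + F (Stack \<alpha> \<beta>) i v) * a (Vertex \<alpha>) * b (Vertex \<beta>)) = \<dots>" .
    qed
    then have chen_c: "rough_increment n (\<lambda>\<tau>. F \<tau> i v) c = rough_increment n (\<lambda>\<tau>. F \<tau> i v) a + rough_increment n (\<lambda>\<tau>. F \<tau> i v) b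
       + (\<Sum>\<beta>=1..n. (\<Sum>j<m. partial j (F (Vertex \<beta>) i) v * P j) * b (Vertex \<beta>))"
      by (simp add: rough_increment_chen[OF c])
    have "euler_step b w i - euler_step c v i
       = rough_increment n ?dF b - (\<Sum>\<beta>=1..n. (\<Sum>j<m. partial j (F (Vertex \<beta>) i) v * P j) * b (Vertex \<beta>))"
      using i by (simp add: euler_step_def w chen_c rough_increment_diff_left)
    \<comment> \<open>The one-vertex entries of \<open>b\<close> are split off: for them the
      difference of components must be expanded, while the degree-two entries already supply a
      factor of order \<open>h\<^sup>2\<close>.\<close>
    also have "\<dots> = (\<Sum>\<beta>=1..n. (?dF (Vertex \<beta>) - (\<Sum>j<m. partial j (F (Vertex \<beta>) i) v * P j)) * b (Vertex \<beta>))
       + (rough_increment n ?dF b - (\<Sum>\<beta>=1..n. ?dF (Vertex \<beta>) * b (Vertex \<beta>)))"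
      by (simp add: left_diff_distrib sum_subtractf)
    finally have split: "\<bar>euler_step b w i - euler_step c v i\<bar> \<le>
       \<bar>\<Sum>\<beta>=1..n. (?dF (Vertex \<beta>) - (\<Sum>j<m. partial j (F (Vertex \<beta>) i) v * P j)) * b (Vertex \<beta>)\<bar>
       + \<bar>rough_increment n ?dF b - (\<Sum>\<beta>=1..n. ?dF (Vertex \<beta>) * b (Vertex \<beta>))\<bar>"
      by simp
    have p2: "\<bar>rough_increment n ?dF b - (\<Sum>\<beta>=1..n. ?dF (Vertex \<beta>) * b (Vertex \<beta>))\<bar> \<le> N * (K * (K1 * h) * (C * h\<^sup>2))"
      unfolding N_def by (rule rough_increment_second_order[OF b C dF])
    have inner: "\<bar>?dF (Vertex \<beta>) - (\<Sum>j<m. partial j (F (Vertex \<beta>) i) v * P j)\<bar>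
        \<le> (K * K1\<^sup>2 + real m * (K * (N * (K * C)))) * h\<^sup>2" if \<beta>: "\<beta> \<in> {1..n}" for \<beta>
    proof -
      have Fb: "Vertex \<beta> \<in> forests n" using \<beta> by simp
      have t: "\<bar>F (Vertex \<beta>) i w - F (Vertex \<beta>) i v - (\<Sum>j<m. partial j (F (Vertex \<beta>) i) v * (w j - v j))\<bar>
          \<le> K * (l1_dist m v w)\<^sup>2"
        using B Fb i
        by (intro smooth_on_taylor1_segment[OF F[OF Fb i] V vE wE BV seg]) (auto simp: bounded_derivs_def)
      have "\<bar>\<Sum>j<m. partial j (F (Vertex \<beta>) i) v * (w j - v j - P j)\<bar>
          \<le> K * (\<Sum>j<m. \<bar>w j - v j - P j\<bar>)"
        using B v Fb i by (intro abs_sum_mult_le) (auto simp: bounded_derivs_def)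
      also have "\<dots> \<le> K * (real m * (N * (K * (C * h\<^sup>2))))"
        using sum_bounded_above[of "{..<m}" "\<lambda>j. \<bar>w j - v j - P j\<bar>"] wP K by (intro mult_left_mono) auto
      finally have t2: "\<bar>\<Sum>j<m. partial j (F (Vertex \<beta>) i) v * (w j - v j - P j)\<bar> \<le> K * (real m * (N * (K * (C * h\<^sup>2))))" .
      have "K * (l1_dist m v w)\<^sup>2 \<le> K * (K1\<^sup>2 * h\<^sup>2)" using dh K by (intro mult_left_mono) auto
      moreover have "?dF (Vertex \<beta>) - (\<Sum>j<m. partial j (F (Vertex \<beta>) i) v * P j)
         = (F (Vertex \<beta>) i w - F (Vertex \<beta>) i v - (\<Sum>j<m. partial j (F (Vertex \<beta>) i) v * (w j - v j)))
           + (\<Sum>j<m. partial j (F (Vertex \<beta>) i) v * (w j - v j - P j))"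
        by (simp add: right_diff_distrib sum_subtractf)
      ultimately have "\<bar>?dF (Vertex \<beta>) - (\<Sum>j<m. partial j (F (Vertex \<beta>) i) v * P j)\<bar>
         \<le> K * (K1\<^sup>2 * h\<^sup>2) + K * (real m * (N * (K * (C * h\<^sup>2))))"
        using t t2 by linarith
      then show ?thesis by (simp add: algebra_simps)
    qed
    have "\<bar>(?dF (Vertex \<beta>) - (\<Sum>j<m. partial j (F (Vertex \<beta>) i) v * P j)) * b (Vertex \<beta>)\<bar>
        \<le> ((K * K1\<^sup>2 + real m * (K * (N * (K * C)))) * h\<^sup>2) * (C * h)" if \<beta>: "\<beta> \<in> {1..n}" for \<beta>
    proof -
      have "\<bar>b (Vertex \<beta>)\<bar> \<le> C * h"
        using b[unfolded rough_size_def, THEN bspec, of "Vertex \<beta>"] \<beta> by simp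
      then show ?thesis unfolding abs_mult using inner[OF \<beta>] by (intro mult_mono) auto
    qed
    then have "(\<Sum>\<beta>=1..n. \<bar>(?dF (Vertex \<beta>) - (\<Sum>j<m. partial j (F (Vertex \<beta>) i) v * P j)) * b (Vertex \<beta>)\<bar>)
        \<le> of_nat (card {1..n}) * (((K * K1\<^sup>2 + real m * (K * (N * (K * C)))) * h\<^sup>2) * (C * h))"
      by (rule sum_bounded_above)
    then have p1: "\<bar>\<Sum>\<beta>=1..n. (?dF (Vertex \<beta>) - (\<Sum>j<m. partial j (F (Vertex \<beta>) i) v * P j)) * b (Vertex \<beta>)\<bar>
        \<le> real n * (((K * K1\<^sup>2 + real m * (K * (N * (K * C)))) * h\<^sup>2) * (C * h))"
      by (intro order_trans[OF sum_abs]) simp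
    have "real n * (((K * K1\<^sup>2 + real m * (K * (N * (K * C)))) * h\<^sup>2) * (C * h))
        = real n * (C * (K * K1\<^sup>2 + real m * (K * (N * (K * C))))) * h ^ 3"
      and "N * (K * (K1 * h) * (C * h\<^sup>2)) = N * (K * K1 * C) * h ^ 3"
      by (simp_all only: power2_eq_square power3_eq_cube mult_ac)
    then show ?thesis using split p1 p2 by linarith
  qed
  have "l1_dist m (euler_step b w) (euler_step c v)
      \<le> real m * (real n * (C * (K * K1\<^sup>2 + real m * (K * (N * (K * C))))) * h ^ 3 + N * (K * K1 * C) * h ^ 3)"
    unfolding l1_dist_def
    using sum_bounded_above[of "{..<m}" "\<lambda>i. \<bar>euler_step b w i - euler_step c v i\<bar>"] comp by simp
  then show ?thesis
    unfolding flow_defect_const_def Let_def N_def[symmetric] K1_def[symmetric]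
    by (simp only: distrib_right mult.assoc)
qed

end

section \<open>Davie's estimate and local existence\<close>

text \<open>The induction for an abstract almost flow. \<open>Bin\<close> is where the scheme is to
  be kept, \<open>Bout\<close> the larger set reached by one more step, on which the Lipschitz bound
  holds. \<open>\<kappa>\<close> bounds the length of one step and \<open>radius\<close> keeps the
  iterates in \<open>Bin\<close>. The hypothesis \<open>L\<close> says that the constant reproduces
  itself: errors over two halves of the control give the first summand, two almost flow defects the
  second.\<close>

locale davie_scheme =
  fixes m :: nat and a b :: real and \<omega> :: "real \<Rightarrow> real \<Rightarrow> real" and \<theta> K L \<epsilon> \<kappa> R :: real
    and y0 :: vec and Bin Bout :: "vec set" and \<mu> :: "real \<Rightarrow> real \<Rightarrow> vec \<Rightarrow> vec"
  assumes ab: "a \<le> b"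
    and w_nonneg: "\<And>s t. a \<le> s \<Longrightarrow> s \<le> t \<Longrightarrow> t \<le> b \<Longrightarrow> 0 \<le> \<omega> s t"
    and w_diag: "\<And>s. a \<le> s \<Longrightarrow> s \<le> b \<Longrightarrow> \<omega> s s = 0"
    and w_add: "\<And>s u t. a \<le> s \<Longrightarrow> s \<le> u \<Longrightarrow> u \<le> t \<Longrightarrow> t \<le> b \<Longrightarrow> \<omega> s u + \<omega> u t \<le> \<omega> s t"
    and flow_diag: "\<And>s v. a \<le> s \<Longrightarrow> s \<le> b \<Longrightarrow> l1_dist m (\<mu> s s v) v = 0"
    and flow_in: "\<And>s t v. a \<le> s \<Longrightarrow> s \<le> t \<Longrightarrow> t \<le> b \<Longrightarrow> v \<in> Bin \<Longrightarrow> \<mu> s t v \<in> Bout"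
    and flow_near: "\<And>s t v. a \<le> s \<Longrightarrow> s \<le> t \<Longrightarrow> t \<le> b \<Longrightarrow> v \<in> Bin \<Longrightarrow> l1_dist m v (\<mu> s t v) \<le> \<kappa>"
    and flow_defect: "\<And>s u t v. a \<le> s \<Longrightarrow> s \<le> u \<Longrightarrow> u \<le> t \<Longrightarrow> t \<le> b \<Longrightarrow> v \<in> Bin \<Longrightarrow>
        l1_dist m (\<mu> s t v) (\<mu> u t (\<mu> s u v)) \<le> K * \<omega> s t powr \<theta>"
    and flow_lip: "\<And>s t v w. a \<le> s \<Longrightarrow> s \<le> t \<Longrightarrow> t \<le> b \<Longrightarrow> v \<in> Bout \<Longrightarrow> w \<in> Bout \<Longrightarrow>
        l1_dist m (\<mu> s t v) (\<mu> s t w) \<le> (1 + \<epsilon>) * l1_dist m v w"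
    and Bin_Bout: "Bin \<subseteq> Bout" and y0: "y0 \<in> Bin"
    and Bin_I: "\<And>v. v \<in> Bout \<Longrightarrow> l1_dist m y0 v \<le> R \<Longrightarrow> v \<in> Bin"
    and pos: "0 \<le> \<theta>" "0 \<le> K" "0 \<le> L" "0 \<le> \<epsilon>"
    and radius: "\<kappa> + L * \<omega> a b powr \<theta> \<le> R"
    and L: "(1 + (1 + \<epsilon>)\<^sup>2) * (L / 2 powr \<theta>) + (2 + \<epsilon>) * K \<le> L"
begin

lemma w_mono: "a \<le> s \<Longrightarrow> s \<le> s' \<Longrightarrow> s' \<le> t' \<Longrightarrow> t' \<le> t \<Longrightarrow> t \<le> b \<Longrightarrow> \<omega> s' t' \<le> \<omega> s t"
  using w_add[of s s' t] w_add[of s' t' t] w_nonneg[of s s'] w_nonneg[of t' t] by linarith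

lemma w_powr_mono:
  "a \<le> s \<Longrightarrow> s \<le> s' \<Longrightarrow> s' \<le> t' \<Longrightarrow> t' \<le> t \<Longrightarrow> t \<le> b \<Longrightarrow> \<omega> s' t' powr \<theta> \<le> \<omega> s t powr \<theta>"
  using w_mono[of s s' t' t] w_nonneg[of s' t'] pos(1) by (intro powr_mono2) auto

text \<open>
  The induction splits at the last time before which at most half of the control is used, so that
  both remaining pieces carry at most half of it and \<^verbatim>\<open>\<theta> > 1\<close> absorbs the two Lipschitz factors.
\<close>

lemma scheme_estimate:
  fixes t :: "nat \<Rightarrow> real"
  assumes t_mono: "\<And>k l. k \<le> l \<Longrightarrow> l \<le> N \<Longrightarrow> t k \<le> t l"
    and t_range: "\<And>k. k \<le> N \<Longrightarrow> a \<le> t k \<and> t k \<le> b"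
    and y_0: "y 0 = y0" and y_Suc: "\<And>k. k < N \<Longrightarrow> y (Suc k) = \<mu> (t k) (t (Suc k)) (y k)"
  shows "l \<le> N \<Longrightarrow> y l \<in> Bin \<and> (\<forall>k\<le>l. l1_dist m (\<mu> (t k) (t l) (y k)) (y l) \<le> L * \<omega> (t k) (t l) powr \<theta>)"
proof (induction l rule: less_induct)
  case (less l)
  have IH_in: "y j \<in> Bin" if "j < l" for j using less that by auto
  have IH: "l1_dist m (\<mu> (t k) (t j) (y k)) (y j) \<le> L * \<omega> (t k) (t j) powr \<theta>" if "j < l" "k \<le> j" for k j
    using less that by auto
  \<comment> \<open>Only membership in \<open>Bout\<close> is known at this stage; it suffices for
    the Lipschitz bounds, and \<open>Bin\<close> follows at the end from the estimate with
    \<open>k = 0\<close>.\<close>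
  have out: "y l \<in> Bout"
  proof (cases l)
    case 0 then show ?thesis using y_0 y0 Bin_Bout by auto
  next
    case (Suc l')
    then show ?thesis using IH_in[of l'] y_Suc[of l'] less.prems t_mono[of l' l] t_range[of l'] t_range[of l]
      by (auto intro!: flow_in)
  qed
  have out': "y j \<in> Bout" if "j \<le> l" for j
    using that out IH_in[of j] Bin_Bout by (cases "j = l") auto
  \<comment> \<open>The end index \<open>l\<close> is fixed and the start varies: the right piece
    uses the inner induction on \<open>l - k\<close>, the left piece the outer one.\<close>
  have est: "l1_dist m (\<mu> (t k) (t l) (y k)) (y l) \<le> L * \<omega> (t k) (t l) powr \<theta>" if "k \<le> l" for k
    using that
  proof (induction "l - k" arbitrary: k rule: less_induct)
    case inner: (less k)
    show ?case
    proof (cases "k = l")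
      case True
      then show ?thesis using flow_diag[of "t l" "y l"] t_range[OF less.prems] pos by simp
    next
      case False
      then have kl: "k < l" using inner.prems by simp
      let ?w = "\<omega> (t k) (t l)"
      have tk: "a \<le> t k" "t k \<le> t l" "t l \<le> b" using t_range t_mono kl less.prems by auto
      have w0: "0 \<le> ?w" using w_nonneg tk by auto
      define J where "J = Max {j. k \<le> j \<and> j < l \<and> \<omega> (t k) (t j) \<le> ?w / 2}"
      have fin: "finite {j. k \<le> j \<and> j < l \<and> \<omega> (t k) (t j) \<le> ?w / 2}"
        by (rule finite_subset[of _ "{..<l}"]) auto
      have "k \<in> {j. k \<le> j \<and> j < l \<and> \<omega> (t k) (t j) \<le> ?w / 2}"
        using kl w0 w_diag[of "t k"] tk by auto
      then have "J \<in> {j. k \<le> j \<and> j < l \<and> \<omega> (t k) (t j) \<le> ?w / 2}"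
        unfolding J_def using fin by (intro Max_in) auto
      then have J: "k \<le> J" "J < l" "\<omega> (t k) (t J) \<le> ?w / 2" by auto
      have tt: "t k \<le> t J" "t J \<le> t (Suc J)" "t (Suc J) \<le> t l" "a \<le> t J" "a \<le> t (Suc J)" "t (Suc J) \<le> b" "t J \<le> b"
        using J t_mono less.prems t_range[of J] t_range[of "Suc J"] by auto
      have J2: "\<omega> (t (Suc J)) (t l) \<le> ?w / 2"
      proof (cases "Suc J = l")
        case True then show ?thesis using w_diag[of "t l"] w0 tk by simp
      next
        case False
        have "Suc J \<notin> {j. k \<le> j \<and> j < l \<and> \<omega> (t k) (t j) \<le> ?w / 2}"
          using Max_ge[OF fin, of "Suc J"] unfolding J_def[symmetric] by auto
        then have "\<omega> (t k) (t (Suc J)) > ?w / 2" using J False by auto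
        moreover have "\<omega> (t k) (t (Suc J)) + \<omega> (t (Suc J)) (t l) \<le> ?w"
          using tt tk by (intro w_add) auto
        ultimately show ?thesis by linarith
      qed
      \<comment> \<open>The value of \<open>L * (?w / 2) powr \<theta>\<close>, a common bound for
        both pieces.\<close>
      define H where "H = L * (?w powr \<theta> / 2 powr \<theta>)"
      have half: "L * x powr \<theta> \<le> H" if "0 \<le> x" "x \<le> ?w / 2" for x
      proof -
        have "x powr \<theta> \<le> (?w / 2) powr \<theta>" using that pos by (intro powr_mono2) auto
        also have "\<dots> = ?w powr \<theta> / 2 powr \<theta>" using w0 by (simp add: powr_divide)
        finally show ?thesis unfolding H_def using pos by (intro mult_left_mono) auto
      qed
      have yk: "y k \<in> Bin" using IH_in kl by simp
      have e1: "l1_dist m (\<mu> (t k) (t J) (y k)) (y J) \<le> H"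
        using IH[OF J(2,1)] half[OF w_nonneg J(3)] tt tk by auto
      have e2: "l1_dist m (\<mu> (t (Suc J)) (t l) (y (Suc J))) (y l) \<le> H"
      proof -
        have "l1_dist m (\<mu> (t (Suc J)) (t l) (y (Suc J))) (y l) \<le> L * \<omega> (t (Suc J)) (t l) powr \<theta>"
          using J by (intro inner.hyps) auto
        then show ?thesis using half[OF w_nonneg J2] tt tk by auto
      qed
      have yS: "y (Suc J) = \<mu> (t J) (t (Suc J)) (y J)" using y_Suc J less.prems by auto
      \<comment> \<open>The left error is carried across the single step from \<open>J\<close> to
        \<open>Suc J\<close> and then, together with a defect, across the right piece; each
        transport costs a factor \<open>1 + \<epsilon>\<close>.\<close>
      have c1: "l1_dist m (\<mu> (t J) (t (Suc J)) (\<mu> (t k) (t J) (y k))) (y (Suc J)) \<le> (1 + \<epsilon>) * H"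
      proof -
        have "l1_dist m (\<mu> (t J) (t (Suc J)) (\<mu> (t k) (t J) (y k))) (y (Suc J))
            \<le> (1 + \<epsilon>) * l1_dist m (\<mu> (t k) (t J) (y k)) (y J)"
          unfolding yS using tt tk J yk out'[of J] by (intro flow_lip flow_in) auto
        also have "\<dots> \<le> (1 + \<epsilon>) * H" using e1 pos by (intro mult_left_mono) auto
        finally show ?thesis .
      qed
      have c2: "l1_dist m (\<mu> (t k) (t (Suc J)) (y k)) (\<mu> (t J) (t (Suc J)) (\<mu> (t k) (t J) (y k))) \<le> K * ?w powr \<theta>"
      proof -
        have "l1_dist m (\<mu> (t k) (t (Suc J)) (y k)) (\<mu> (t J) (t (Suc J)) (\<mu> (t k) (t J) (y k)))
          \<le> K * \<omega> (t k) (t (Suc J)) powr \<theta>" using tt tk yk by (intro flow_defect) auto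
        also have "\<dots> \<le> K * ?w powr \<theta>" using w_powr_mono[of "t k" "t k" "t (Suc J)" "t l"] tt tk pos
          by (intro mult_left_mono) auto
        finally show ?thesis .
      qed
      have c12: "l1_dist m (\<mu> (t k) (t (Suc J)) (y k)) (y (Suc J)) \<le> K * ?w powr \<theta> + (1 + \<epsilon>) * H"
        using c1 c2 l1_dist_triangle order_trans add_mono by meson
      have c3: "l1_dist m (\<mu> (t (Suc J)) (t l) (\<mu> (t k) (t (Suc J)) (y k))) (\<mu> (t (Suc J)) (t l) (y (Suc J)))
          \<le> (1 + \<epsilon>) * (K * ?w powr \<theta> + (1 + \<epsilon>) * H)"
      proof -
        have "l1_dist m (\<mu> (t (Suc J)) (t l) (\<mu> (t k) (t (Suc J)) (y k))) (\<mu> (t (Suc J)) (t l) (y (Suc J)))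
          \<le> (1 + \<epsilon>) * l1_dist m (\<mu> (t k) (t (Suc J)) (y k)) (y (Suc J))"
          using tt tk J yk out'[of "Suc J"] by (intro flow_lip flow_in) auto
        also have "\<dots> \<le> (1 + \<epsilon>) * (K * ?w powr \<theta> + (1 + \<epsilon>) * H)" using c12 pos by (intro mult_left_mono) auto
        finally show ?thesis .
      qed
      have c4: "l1_dist m (\<mu> (t k) (t l) (y k)) (\<mu> (t (Suc J)) (t l) (\<mu> (t k) (t (Suc J)) (y k))) \<le> K * ?w powr \<theta>"
        using tt tk yk by (intro flow_defect) auto
      have "l1_dist m (\<mu> (t k) (t l) (y k)) (y l)
        \<le> K * ?w powr \<theta> + ((1 + \<epsilon>) * (K * ?w powr \<theta> + (1 + \<epsilon>) * H) + H)"
        using c4 c3 e2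
          l1_dist_triangle[of m "\<mu> (t k) (t l) (y k)" "y l" "\<mu> (t (Suc J)) (t l) (\<mu> (t k) (t (Suc J)) (y k))"]
          l1_dist_triangle[of m "\<mu> (t (Suc J)) (t l) (\<mu> (t k) (t (Suc J)) (y k))" "y l" "\<mu> (t (Suc J)) (t l) (y (Suc J))"]
        by linarith
      also have "\<dots> = ((1 + (1 + \<epsilon>)\<^sup>2) * (L / 2 powr \<theta>) + (2 + \<epsilon>) * K) * ?w powr \<theta>"
        by (simp add: H_def power2_eq_square algebra_simps add_divide_distrib)
      also have "\<dots> \<le> L * ?w powr \<theta>" using L by (intro mult_right_mono) auto
      finally show ?thesis .
    qed
  qed
  \<comment> \<open>One big step from \<open>y0\<close> plus the estimate from index 0 bounds the
    excursion independently of the number of times.\<close>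
  have "l1_dist m y0 (y l) \<le> R"
  proof -
    have r: "a \<le> t 0" "t 0 \<le> t l" "t l \<le> b" using t_range[of 0] t_range[of l] t_mono[of 0 l] less.prems by auto
    have "l1_dist m y0 (\<mu> (t 0) (t l) y0) \<le> \<kappa>" using r y0 by (intro flow_near) auto
    moreover have "l1_dist m (\<mu> (t 0) (t l) y0) (y l) \<le> L * \<omega> (t 0) (t l) powr \<theta>" using est[of 0] y_0 by simp
    moreover have "L * \<omega> (t 0) (t l) powr \<theta> \<le> L * \<omega> a b powr \<theta>"
      using r pos ab by (intro mult_left_mono w_powr_mono) auto
    ultimately show ?thesis using radius l1_dist_triangle[of m y0 "y l" "\<mu> (t 0) (t l) y0"] by linarith
  qed
  then show ?case using Bin_I[OF out] est by blast
qed

text \<open>The scheme is run over the sorted times with \<open>a\<close> added, and its values are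
  placed at those times; \<open>y0\<close> is the default elsewhere, which keeps every value in
  \<open>Bin\<close>.\<close>

lemma finite_times_solution:
  assumes "finite D" "D \<subseteq> {a..b}"
  obtains Y where "Y a = y0" "\<And>t. Y t \<in> Bin"
    "\<And>s t. s \<in> D \<Longrightarrow> t \<in> D \<Longrightarrow> s \<le> t \<Longrightarrow> l1_dist m (\<mu> s t (Y s)) (Y t) \<le> L * \<omega> s t powr \<theta>"
proof -
  define D' where "D' = insert a D"
  define xs where "xs = sorted_list_of_set D'"
  define N where "N = length xs - 1"
  have D': "finite D'" "D' \<subseteq> {a..b}" "a \<in> D'" using assms ab by (auto simp: D'_def)
  have xs: "set xs = D'" "sorted xs" "distinct xs" using D' by (auto simp: xs_def)
  have N: "length xs = Suc N" using xs(1) D'(3) by (cases xs) (auto simp: N_def)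
  have ex: "\<exists>k\<le>N. xs ! k = s" if "s \<in> D'" for s
    using that xs(1) N by (metis in_set_conv_nth less_Suc_eq_le)
  then obtain idx where idx: "\<And>s. s \<in> D' \<Longrightarrow> idx s \<le> N \<and> xs ! idx s = s" by metis
  have mono: "xs ! k \<le> xs ! l" if "k \<le> l" "l \<le> N" for k l
    using sorted_nth_mono[OF xs(2)] that N by simp
  have range: "a \<le> xs ! k \<and> xs ! k \<le> b" if "k \<le> N" for k
    using that N xs(1) D'(2) nth_mem[of k xs] by auto
  have uniq: "idx (xs ! k) = k" if "k \<le> N" for k
    using idx[of "xs ! k"] that xs N nth_mem[of k xs] nth_eq_iff_index_eq[OF xs(3), of "idx (xs ! k)" k] by auto
  have "xs ! 0 = a"
    using mono[of 0 "idx a"] idx[OF D'(3)] range[of 0] by auto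
  then have idx_a: "idx a = 0" using uniq[of 0] by simp
  define y where "y = rec_nat y0 (\<lambda>k v. \<mu> (xs ! k) (xs ! Suc k) v)"
  have est: "y l \<in> Bin \<and> (\<forall>k\<le>l. l1_dist m (\<mu> (xs ! k) (xs ! l) (y k)) (y l) \<le> L * \<omega> (xs ! k) (xs ! l) powr \<theta>)"
    if "l \<le> N" for l
    by (rule scheme_estimate[of N "\<lambda>k. xs ! k" y, OF mono range _ _ that]) (auto simp: y_def)
  show thesis
  proof (rule that[of "\<lambda>s. if s \<in> D' then y (idx s) else y0"])
    show "(if a \<in> D' then y (idx a) else y0) = y0" by (simp add: idx_a y_def)
    show "(if s \<in> D' then y (idx s) else y0) \<in> Bin" for s using est idx y0 by auto
    fix s t assume st: "s \<in> D" "t \<in> D" "s \<le> t"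
    then have st': "s \<in> D'" "t \<in> D'" by (auto simp: D'_def)
    have "idx s \<le> idx t"
    proof (rule ccontr)
      assume "\<not> idx s \<le> idx t"
      then have "t \<le> s" using mono[of "idx t" "idx s"] idx[OF st'(1)] idx[OF st'(2)] by auto
      then have "s = t" using st by simp
      then show False using \<open>\<not> idx s \<le> idx t\<close> by simp
    qed
    then show "l1_dist m (\<mu> s t (if s \<in> D' then y (idx s) else y0)) (if t \<in> D' then y (idx t) else y0) \<le> L * \<omega> s t powr \<theta>"
      using est[of "idx t"] idx[OF st'(1)] idx[OF st'(2)] st' by auto
  qed
qed

text \<open>
  No refinement of partitions is needed: the estimates for pairs of times are closed conditions on
  a product of compact sets, and finitely many of them can be met simultaneously.
\<close>

lemma solution_exists:
  assumes Bin: "compact Bin" "closed Bin"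
    and cont: "\<And>s t i. a \<le> s \<Longrightarrow> s \<le> t \<Longrightarrow> t \<le> b \<Longrightarrow> i < m \<Longrightarrow> continuous_on Bin (\<lambda>v. \<mu> s t v i)"
  obtains Y where "Y a = y0" "\<And>t. Y t \<in> Bin"
    "\<And>s t. a \<le> s \<Longrightarrow> s \<le> t \<Longrightarrow> t \<le> b \<Longrightarrow> l1_dist m (\<mu> s t (Y s)) (Y t) \<le> L * \<omega> s t powr \<theta>"
proof -
  define Q where "Q = {Y :: real \<Rightarrow> vec. \<forall>t. Y t \<in> Bin}"
  define P where "P = {(s, t). a \<le> s \<and> s \<le> t \<and> t \<le> b}"
  \<comment> \<open>Each condition also contains the initial value, coordinate by coordinate, so
    that one family of closed sets encodes both requirements.\<close>
  define E where "E = (\<lambda>(s, t). {Y \<in> Q. l1_dist m (\<mu> s t (Y s)) (Y t) \<le> L * \<omega> s t powr \<theta>} \<inter> {Y. \<forall>i. Y a i = y0 i})"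
  have coord: "continuous_on UNIV (\<lambda>Y :: real \<Rightarrow> vec. Y t)" for t by simp
  have coord2: "continuous_on UNIV (\<lambda>Y :: real \<Rightarrow> vec. Y t i)" for t i
    using continuous_on_product_then_coordinatewise[OF coord] .
  have Q: "compact Q" unfolding Q_def using Bin by (intro compact_PiE_UNIV) auto
  have "closed {Y :: real \<Rightarrow> vec. Y t \<in> Bin}" for t
    using closed_vimage[OF Bin(2) coord[of t]] by (simp add: vimage_def)
  then have "closed (\<Inter>t. {Y :: real \<Rightarrow> vec. Y t \<in> Bin})" by (intro closed_INT) auto
  then have Qc: "closed Q" by (simp add: Q_def Collect_all_eq)
  have "Q \<inter> (\<Inter>p\<in>P. E p) \<noteq> {}"
  proof (rule compact_imp_fip_image[OF Q])
    fix p assume "p \<in> P"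
    then obtain s t where p: "p = (s, t)" "a \<le> s" "s \<le> t" "t \<le> b" by (auto simp: P_def)
    have "continuous_on Q (\<lambda>Y. \<mu> s t (Y s) i)" if "i < m" for i
      using continuous_on_compose2[OF cont[OF p(2-4) that] continuous_on_subset[OF coord[of s] subset_UNIV[of Q]]]
      by (auto simp: Q_def)
    then have "continuous_on Q (\<lambda>Y. l1_dist m (\<mu> s t (Y s)) (Y t))"
      unfolding l1_dist_def
      by (intro continuous_on_sum continuous_on_rabs continuous_on_diff continuous_on_subset[OF coord2]) auto
    then have "closed {Y \<in> Q. l1_dist m (\<mu> s t (Y s)) (Y t) \<le> L * \<omega> s t powr \<theta>}"
      by (intro continuous_on_closed_Collect_le continuous_on_const Qc)
    moreover have "closed (\<Inter>i. {Y :: real \<Rightarrow> vec. Y a i = y0 i})"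
      using coord2 by (intro closed_INT ballI closed_Collect_eq continuous_on_const)
    ultimately show "closed (E p)" by (auto simp: E_def p(1) Collect_all_eq)
  next
    fix I' assume I': "finite I'" "I' \<subseteq> P"
    \<comment> \<open>Finitely many pairs involve finitely many times, and a single scheme over
      these meets all their estimates.\<close>
    have D: "finite (fst ` I' \<union> snd ` I')" "fst ` I' \<union> snd ` I' \<subseteq> {a..b}" using I' by (auto simp: P_def)
    obtain Y where Y: "Y a = y0" "\<And>t. Y t \<in> Bin"
      "\<And>s t. s \<in> fst ` I' \<union> snd ` I' \<Longrightarrow> t \<in> fst ` I' \<union> snd ` I' \<Longrightarrow> s \<le> t \<Longrightarrow>
          l1_dist m (\<mu> s t (Y s)) (Y t) \<le> L * \<omega> s t powr \<theta>"
      using finite_times_solution[OF D] by metis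
    have "Y \<in> E p" if "p \<in> I'" for p
    proof -
      obtain s t where p: "p = (s, t)" by (cases p)
      then have "s \<in> fst ` I'" "t \<in> snd ` I'" "s \<le> t" using that I'(2) by (force simp: P_def)+
      then show ?thesis using Y by (auto simp: E_def Q_def p)
    qed
    then have "Y \<in> Q \<inter> (\<Inter>p\<in>I'. E p)" using Y(2) by (auto simp: Q_def)
    then show "Q \<inter> (\<Inter>p\<in>I'. E p) \<noteq> {}" by blast
  qed
  then obtain Y where Y: "Y \<in> Q" "\<And>p. p \<in> P \<Longrightarrow> Y \<in> E p" by blast
  show thesis
  proof (rule that[of Y])
    \<comment> \<open>The pair \<open>(a, a)\<close> is always present and yields the initial
      value.\<close>
    have "Y \<in> E (a, a)" using Y(2) ab by (auto simp: P_def)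
    then show "Y a = y0" by (auto simp: E_def)
    show "Y t \<in> Bin" for t using Y(1) by (auto simp: Q_def)
    show "l1_dist m (\<mu> s t (Y s)) (Y t) \<le> L * \<omega> s t powr \<theta>" if "a \<le> s" "s \<le> t" "t \<le> b" for s t
      using Y(2)[of "(s, t)"] that by (auto simp: E_def P_def)
  qed
qed

end

section \<open>The control and the increments of the driving rough path\<close>

locale rough_driver =
  fixes n :: nat and S T p :: real and \<omega> :: "real \<Rightarrow> real \<Rightarrow> real" and X :: "forest \<Rightarrow> real \<Rightarrow> real \<Rightarrow> real"
  assumes p: "1 \<le> p" "p < 3" and control: "control_function S T \<omega>" and path: "branched_rough_path n S T p \<omega> X"
begin

lemma w_nonneg: "S \<le> s \<Longrightarrow> s \<le> t \<Longrightarrow> t \<le> T \<Longrightarrow> 0 \<le> \<omega> s t"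
  using control unfolding control_function_def time_simplex_def by auto

lemma w_diag: "S \<le> s \<Longrightarrow> s \<le> T \<Longrightarrow> \<omega> s s = 0"
  using control unfolding control_function_def by auto

lemma w_add: "S \<le> s \<Longrightarrow> s \<le> u \<Longrightarrow> u \<le> t \<Longrightarrow> t \<le> T \<Longrightarrow> \<omega> s u + \<omega> u t \<le> \<omega> s t"
  using control unfolding control_function_def by blast

lemma w_mono: "S \<le> s \<Longrightarrow> s \<le> s' \<Longrightarrow> s' \<le> t' \<Longrightarrow> t' \<le> t \<Longrightarrow> t \<le> T \<Longrightarrow> \<omega> s' t' \<le> \<omega> s t"
  using w_add[of s s' t] w_add[of s' t' t] w_nonneg[of s s'] w_nonneg[of t' t] by linarith

text \<open>The simplex of times is compact, so the control is uniformly continuous there, and it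
  vanishes on the diagonal.\<close>

lemma w_uniformly_small:
  assumes "e > 0"
  obtains \<delta> where "\<delta> > 0" "\<And>s t. S \<le> s \<Longrightarrow> s \<le> t \<Longrightarrow> t \<le> T \<Longrightarrow> t - s < \<delta> \<Longrightarrow> \<omega> s t < e"
proof -
  have eq: "time_simplex {S..T} = ({S..T} \<times> {S..T}) \<inter> {q. fst q \<le> snd q}"
    by (auto simp: time_simplex_def)
  have "compact (time_simplex {S..T})"
    unfolding eq
    by (intro compact_Int_closed compact_Times compact_Icc closed_Collect_le continuous_on_fst continuous_on_snd continuous_on_id)
  then have "uniformly_continuous_on (time_simplex {S..T}) (\<lambda>(s, t). \<omega> s t)"
    using control unfolding control_function_def by (intro compact_uniformly_continuous) auto
  then obtain \<delta> where \<delta>: "\<delta> > 0" "\<And>q q'. q \<in> time_simplex {S..T} \<Longrightarrow> q' \<in> time_simplex {S..T} \<Longrightarrow>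
      dist q' q < \<delta> \<Longrightarrow> dist (case q' of (s, t) \<Rightarrow> \<omega> s t) (case q of (s, t) \<Rightarrow> \<omega> s t) < e"
    using assms unfolding uniformly_continuous_on_def by metis
  show thesis
  proof (rule that[OF \<delta>(1)])
    fix s t assume st: "S \<le> s" "s \<le> t" "t \<le> T" "t - s < \<delta>"
    have "dist (s, t) (s, s) < \<delta>" using st by (simp add: dist_Pair_Pair dist_real_def)
    then have "dist (\<omega> s t) (\<omega> s s) < e"
      using \<delta>(2)[of "(s, s)" "(s, t)"] st by (auto simp: time_simplex_def)
    then show "\<omega> s t < e" using w_diag[of s] st by (simp add: dist_real_def)
  qed
qed

text \<open>The quantity substituted for \<open>h\<close> in the coordinate estimates; the error
  allowed to an integral curve is of the order of its cube.\<close>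

definition scale :: "real \<Rightarrow> real \<Rightarrow> real" where
  "scale s t = \<omega> s t powr (1 / p)"

lemma scale_nonneg [simp]: "0 \<le> scale s t"
  by (simp add: scale_def)

lemma scale_mono: "S \<le> s \<Longrightarrow> s \<le> s' \<Longrightarrow> s' \<le> t' \<Longrightarrow> t' \<le> t \<Longrightarrow> t \<le> T \<Longrightarrow> scale s' t' \<le> scale s t"
  using w_mono[of s s' t' t] w_nonneg[of s' t'] p unfolding scale_def by (intro powr_mono2) auto

lemma scale_power: "0 < k \<Longrightarrow> scale s t ^ k = \<omega> s t powr (k / p)"
  by (cases "\<omega> s t = 0") (simp_all add: scale_def powr_power)

lemma scale_le:
  assumes "S \<le> s" "s \<le> t" "t \<le> T" "0 < h" "\<omega> s t \<le> h powr p"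
  shows "scale s t \<le> h"
proof -
  have "scale s t \<le> (h powr p) powr (1 / p)"
    unfolding scale_def using assms w_nonneg p by (intro powr_mono2) auto
  also have "\<dots> = h" using assms p by (simp add: powr_powr)
  finally show ?thesis .
qed

lemma rough_size_mono:
  assumes "rough_size n C h Z" "0 \<le> h" "h \<le> h'" "0 \<le> C"
  shows "rough_size n C h' Z"
  unfolding rough_size_def
proof
  fix \<tau> assume "\<tau> \<in> forests n"
  then have "\<bar>Z \<tau>\<bar> \<le> C * h ^ forest_degree \<tau>" using assms by (simp add: rough_size_def)
  also have "\<dots> \<le> C * h' ^ forest_degree \<tau>" using assms by (intro mult_left_mono power_mono) auto
  finally show "\<bar>Z \<tau>\<bar> \<le> C * h' ^ forest_degree \<tau>" .
qed

abbreviation incr :: "real \<Rightarrow> real \<Rightarrow> forest \<Rightarrow> real" where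
  "incr s t \<equiv> \<lambda>\<tau>. X \<tau> s t"

lemma incr_size:
  obtains C where "C > 0" "\<And>s t. S \<le> s \<Longrightarrow> s \<le> t \<Longrightarrow> t \<le> T \<Longrightarrow> rough_size n C (scale s t) (incr s t)"
proof -
  obtain C where C: "C > 0" "\<And>\<alpha> \<beta> s t. \<alpha> \<in> {1..n} \<Longrightarrow> \<beta> \<in> {1..n} \<Longrightarrow> S \<le> s \<Longrightarrow> s \<le> t \<Longrightarrow> t \<le> T \<Longrightarrow>
     \<bar>X (Vertex \<alpha>) s t\<bar> \<le> C * \<omega> s t powr (1 / p) \<and>
     \<bar>X (Dots (Upair \<alpha> \<beta>)) s t\<bar> \<le> C * \<omega> s t powr (2 / p) \<and>
     \<bar>X (Stack \<alpha> \<beta>) s t\<bar> \<le> C * \<omega> s t powr (2 / p)"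
    using path unfolding branched_rough_path_def time_simplex_def by fastforce
  have p2: "scale s t ^ 2 = \<omega> s t powr (2 / p)" for s t using scale_power[of 2 s t] by simp
  show thesis
  proof (rule that[OF C(1)])
    fix s t assume st: "S \<le> s" "s \<le> t" "t \<le> T"
    show "rough_size n C (scale s t) (incr s t)"
      unfolding rough_size_def
    proof
      fix \<tau> assume "\<tau> \<in> forests n"
      then show "\<bar>X \<tau> s t\<bar> \<le> C * scale s t ^ forest_degree \<tau>"
      proof (cases rule: forests_cases)
        case (1 \<alpha>)
        show ?thesis using C(2)[OF 1(2) 1(2) st] by (simp add: 1(1) scale_def)
      next
        case (2 \<alpha> \<beta>)
        show ?thesis using C(2)[OF 2(2,3) st] by (simp add: 2(1) p2)
      next
        case (3 \<alpha> \<beta>)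
        show ?thesis using C(2)[OF 3(2,3) st] by (simp add: 3(1) p2)
      qed
    qed
  qed
qed

text \<open>\<open>Dots\<close> is given as a product at each pair of times; multiplying out the
  sums of one-vertex increments produces its two cross terms.\<close>

lemma incr_chen:
  assumes "S \<le> s" "s \<le> u" "u \<le> t" "t \<le> T"
  shows "chen n (incr s u) (incr u t) (incr s t)"
proof -
  have *: "X (Vertex \<alpha>) s t = X (Vertex \<alpha>) s u + X (Vertex \<alpha>) u t \<and>
        X (Dots (Upair \<alpha> \<beta>)) s t = X (Vertex \<alpha>) s t * X (Vertex \<beta>) s t \<and>
        X (Stack \<alpha> \<beta>) s t = X (Stack \<alpha> \<beta>) s u + X (Stack \<alpha> \<beta>) u t + X (Vertex \<alpha>) s u * X (Vertex \<beta>) u t"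
    if "\<alpha> \<in> {1..n}" "\<beta> \<in> {1..n}" "S \<le> s" "s \<le> u" "u \<le> t" "t \<le> T" for \<alpha> \<beta> s u t
    using path that unfolding branched_rough_path_def by blast
  show ?thesis
    unfolding chen_def
  proof (intro ballI)
    fix \<alpha> \<beta> assume ab: "\<alpha> \<in> {1..n}" "\<beta> \<in> {1..n}"
    \<comment> \<open>The product formula on the two subintervals is read off degenerate
      subdivisions of them.\<close>
    have d: "X (Dots (Upair \<alpha> \<beta>)) s u = X (Vertex \<alpha>) s u * X (Vertex \<beta>) s u"
      "X (Dots (Upair \<alpha> \<beta>)) u t = X (Vertex \<alpha>) u t * X (Vertex \<beta>) u t"
      using *[OF ab, of s s u] *[OF ab, of u u t] assms by auto
    show "X (Vertex \<alpha>) s t = X (Vertex \<alpha>) s u + X (Vertex \<alpha>) u t \<and>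
     X (Dots (Upair \<alpha> \<beta>)) s t = X (Dots (Upair \<alpha> \<beta>)) s u + X (Dots (Upair \<alpha> \<beta>)) u t
        + X (Vertex \<alpha>) s u * X (Vertex \<beta>) u t + X (Vertex \<alpha>) u t * X (Vertex \<beta>) s u \<and>
     X (Stack \<alpha> \<beta>) s t = X (Stack \<alpha> \<beta>) s u + X (Stack \<alpha> \<beta>) u t + X (Vertex \<alpha>) s u * X (Vertex \<beta>) u t"
      using *[OF ab assms] *[OF ab(2,1) assms] d by (simp add: algebra_simps)
  qed
qed

text \<open>At equal times the scale is zero, and every forest has positive degree, so the size
  bound forces the value.\<close>

lemma incr_diag:
  assumes "S \<le> s" "s \<le> T" "\<tau> \<in> forests n"
  shows "X \<tau> s s = 0"
proof -
  obtain C where C: "C > 0" "\<And>s t. S \<le> s \<Longrightarrow> s \<le> t \<Longrightarrow> t \<le> T \<Longrightarrow> rough_size n C (scale s t) (incr s t)"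
    using incr_size by blast
  have sc: "scale s s = 0" using w_diag[of s] assms by (simp add: scale_def)
  have z: "(0::real) ^ forest_degree \<tau> = 0" by (cases \<tau>) auto
  have "\<bar>X \<tau> s s\<bar> \<le> C * scale s s ^ forest_degree \<tau>"
    using C(2)[of s s] assms by (auto simp: rough_size_def)
  then show ?thesis unfolding sc z by simp
qed

end

section \<open>Solutions in one chart for small control\<close>

locale driven_coord_field = coord_field m n V F + rough_driver n S T p \<omega> X
  for m n V F S T p \<omega> X
begin

text \<open>All constants come from a fixed ball around \<open>z\<close>, so one bound \<delta> on
  the control serves every start within \<rho>. The covering of the support relies on this
  uniformity.\<close>

lemma local_solution_exists:
  assumes z: "z \<in> V"
  obtains \<rho> \<delta> where "\<rho> > 0" "\<delta> > 0"
    "\<And>a b y0. S \<le> a \<Longrightarrow> a \<le> b \<Longrightarrow> b \<le> T \<Longrightarrow> \<omega> a b \<le> \<delta> \<Longrightarrow> y0 \<in> topspace (Euclidean_space m) \<Longrightarrow>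
       l1_dist m z y0 \<le> \<rho> \<Longrightarrow> \<exists>Y L Z. Y a = y0 \<and> compact Z \<and> Z \<subseteq> V \<and> (\<forall>t. Y t \<in> Z) \<and> 0 \<le> L \<and>
       (\<forall>s t. a \<le> s \<longrightarrow> s \<le> t \<longrightarrow> t \<le> b \<longrightarrow> l1_dist m (euler_step (incr s t) (Y s)) (Y t) \<le> L * \<omega> s t powr (3 / p))"
proof -
  have zE: "z \<in> topspace (Euclidean_space m)" using z V openin_subset by blast
  obtain r where r: "r > 0" "l1_tube m {z} r \<subseteq> V"
    using compact_l1_tube_in_open[of "{z}" V m] z V by auto
  \<comment> \<open>One third each for the distance of the start from \<open>z\<close>, the
    excursion of the scheme, and one further Euler step; the ball \<open>B\<close> of radius
    \<open>3 * \<rho>\<close> holds all of them.\<close>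
  define \<rho> where "\<rho> = r / 3"
  have \<rho>: "\<rho> > 0" using r by (simp add: \<rho>_def)
  define B where "B = l1_tube m {z} r"
  have B_iff: "v \<in> B \<longleftrightarrow> v \<in> topspace (Euclidean_space m) \<and> l1_dist m z v \<le> 3 * \<rho>" for v
    by (auto simp: B_def l1_tube_def \<rho>_def)
  obtain K where K: "bounded_derivs B K"
    using bounded_derivs_compact[of B] compact_l1_tube[of "{z}" m r] zE r unfolding B_def by auto
  have Kpos: "K > 0" using K by (simp add: bounded_derivs_def)
  have segB: "segment_at v w t \<in> B" if "v \<in> B" "w \<in> B" "0 \<le> t" "t \<le> 1" for v w t
    using that by (auto simp: B_iff intro: segment_at_Euclidean_space l1_dist_segment_at)
  obtain C where C: "C > 0" "\<And>s t. S \<le> s \<Longrightarrow> s \<le> t \<Longrightarrow> t \<le> T \<Longrightarrow> rough_size n C (scale s t) (incr s t)"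
    using incr_size by blast
  define K1 where "K1 = real m * (real (card (forests n)) * (K * C))"
  have K1: "K1 \<ge> 0" using Kpos C by (simp add: K1_def)
  define K3 where "K3 = flow_defect_const K C"
  have K3: "K3 \<ge> 0" using Kpos C by (simp add: K3_def flow_defect_const_def Let_def)
  define \<theta> where "\<theta> = 3 / p"
  have \<theta>: "\<theta> > 1" using p by (simp add: \<theta>_def)
  \<comment> \<open>\<open>2 powr \<theta>\<close> exceeds 2 because \<open>3 / p > 1\<close>; this
    margin pays for the Lipschitz factors.\<close>
  define c where "c = (2::real) powr \<theta>"
  have c: "c > 2" using powr_less_mono[OF \<theta>, of 2] by (simp add: c_def)
  \<comment> \<open>For \<open>\<epsilon> \<le> 1\<close> one has
    \<open>(1 + \<epsilon>)\<^sup>2 \<le> 1 + 3 * \<epsilon>\<close>, and the bound by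
    \<open>(c - 2) / 6\<close> keeps \<open>2 + 3 * \<epsilon>\<close> below
    \<open>c\<close>.\<close>
  define \<epsilon> where "\<epsilon> = min 1 ((c - 2) / 6)"
  have \<epsilon>: "\<epsilon> > 0" "\<epsilon> \<le> 1" "6 * \<epsilon> \<le> c - 2" using c by (auto simp: \<epsilon>_def min_def)
  have "\<epsilon> * \<epsilon> \<le> \<epsilon> * 1" using \<epsilon> by (intro mult_left_mono) auto
  moreover have "(1 + \<epsilon>)\<^sup>2 = 1 + 2 * \<epsilon> + \<epsilon> * \<epsilon>" by (simp add: power2_eq_square algebra_simps)
  ultimately have c1: "1 + (1 + \<epsilon>)\<^sup>2 < c" using \<epsilon> by linarith
  \<comment> \<open>The solution of \<open>L = (1 + (1 + \<epsilon>)\<^sup>2) * (L / c) + (2 +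
    \<epsilon>) * K3\<close>, so that the condition on \<open>L\<close> in the scheme holds with
    equality.\<close>
  define L where "L = (2 + \<epsilon>) * K3 * c / (c - (1 + (1 + \<epsilon>)\<^sup>2))"
  have Lpos: "L \<ge> 0" using \<epsilon> K3 c c1 by (simp add: L_def)
  have "L * (c - (1 + (1 + \<epsilon>)\<^sup>2)) = (2 + \<epsilon>) * K3 * c" using c1 by (simp add: L_def)
  then have "(1 + (1 + \<epsilon>)\<^sup>2) * (L / c) + (2 + \<epsilon>) * K3 = L" using c by (simp add: field_simps)
  then have L: "(1 + (1 + \<epsilon>)\<^sup>2) * (L / 2 powr \<theta>) + (2 + \<epsilon>) * K3 \<le> L" by (simp add: c_def)
  \<comment> \<open>Three demands: powers of \<open>h\<close> decrease, Lipschitz constants are at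
    most \<open>1 + \<epsilon>\<close>, and a step plus the error \<open>L * h\<close> stays within
    \<rho>. The added 1 avoids division by zero.\<close>
  define h where "h = min 1 (min (\<epsilon> / (K1 + 1)) (\<rho> / (K1 + L + 1)))"
  have h: "0 < h" "h \<le> 1" using \<epsilon> \<rho> K1 Lpos by (auto simp: h_def)
  have h1: "K1 * h \<le> \<epsilon>"
  proof -
    have "h \<le> \<epsilon> / (K1 + 1)" by (simp add: h_def)
    then have "(K1 + 1) * h \<le> \<epsilon>" using K1 by (simp add: field_simps)
    then show ?thesis using h by (simp add: algebra_simps)
  qed
  have h2: "K1 * h + L * h \<le> \<rho>"
  proof -
    have "h \<le> \<rho> / (K1 + L + 1)" by (simp add: h_def)
    then have "(K1 + L + 1) * h \<le> \<rho>" using K1 Lpos by (simp add: field_simps)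
    then show ?thesis using h by (simp add: algebra_simps)
  qed
  have h3: "h ^ 3 \<le> h" using power_decreasing[of 1 3 h] h by simp
  show thesis
  \<comment> \<open>Control at most \<open>h powr p\<close> means scale at most
    \<open>h\<close>.\<close>
  proof (rule that[of \<rho> "h powr p"])
    show "\<rho> > 0" "h powr p > 0" using \<rho> h by auto
    fix a b y0
    assume ab: "S \<le> a" "a \<le> b" "b \<le> T" and wab: "\<omega> a b \<le> h powr p"
      and y0: "y0 \<in> topspace (Euclidean_space m)" "l1_dist m z y0 \<le> \<rho>"
    define Bin where "Bin = l1_tube m {y0} \<rho>"
    have Bin_iff: "v \<in> Bin \<longleftrightarrow> v \<in> topspace (Euclidean_space m) \<and> l1_dist m y0 v \<le> \<rho>" for v
      by (auto simp: Bin_def l1_tube_def)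
    have Binc: "compact Bin" unfolding Bin_def using y0 by (intro compact_l1_tube) auto
    have Bin2: "l1_dist m z v \<le> 2 * \<rho>" if "v \<in> Bin" for v
      using that y0 l1_dist_triangle[of m z v y0] by (simp add: Bin_iff)
    have BinB: "v \<in> B" if "v \<in> Bin" for v using Bin2[OF that] that \<rho> by (simp add: B_iff Bin_iff)
    have sc: "scale s t \<le> h" if "a \<le> s" "s \<le> t" "t \<le> b" for s t
      using scale_le[of a b h] scale_mono[of a s t b] that ab wab h by auto
    have size: "rough_size n C (scale s t) (incr s t)" "scale s t \<le> 1" if "a \<le> s" "s \<le> t" "t \<le> b" for s t
      using that ab sc[OF that] h C(2)[of s t] by auto
    have near: "l1_dist m v (euler_step (incr s t) v) \<le> K1 * h" if "a \<le> s" "s \<le> t" "t \<le> b" "v \<in> B" for s t v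
    proof -
      have "l1_dist m v (euler_step (incr s t) v) \<le> K1 * scale s t"
        using euler_step_displacement[OF K that(4) size(1)[OF that(1-3)] _ size(2)[OF that(1-3)]] C(1)
        by (simp add: K1_def mult_ac)
      also have "\<dots> \<le> K1 * h" using sc[OF that(1-3)] K1 by (rule mult_left_mono)
      finally show ?thesis .
    qed
    have stepB: "euler_step (incr s t) v \<in> B" if "a \<le> s" "s \<le> t" "t \<le> b" "v \<in> Bin" for s t v
    proof -
      have "L * h \<ge> 0" using Lpos h by simp
      then show ?thesis
        using near[OF that(1-3) BinB[OF that(4)]] Bin2[OF that(4)] h2
          l1_dist_triangle[of m z "euler_step (incr s t) v" v]
        by (simp add: B_iff)
    qed
    interpret davie_scheme m a b \<omega> \<theta> K3 L \<epsilon> "K1 * h" \<rho> y0 Bin B "\<lambda>s t. euler_step (incr s t)"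
    proof
      show "a \<le> b" by fact
      show "0 \<le> \<omega> s t" if "a \<le> s" "s \<le> t" "t \<le> b" for s t using w_nonneg that ab by auto
      show "\<omega> s s = 0" if "a \<le> s" "s \<le> b" for s using w_diag that ab by auto
      show "\<omega> s u + \<omega> u t \<le> \<omega> s t" if "a \<le> s" "s \<le> u" "u \<le> t" "t \<le> b" for s u t using w_add that ab by auto
      show "l1_dist m (euler_step (incr s s) v) v = 0" if "a \<le> s" "s \<le> b" for s v
        using incr_diag[of s] that ab
        by (auto simp: l1_dist_def euler_step_def rough_increment_def intro!: sum.neutral)
      show "euler_step (incr s t) v \<in> B" if "a \<le> s" "s \<le> t" "t \<le> b" "v \<in> Bin" for s t v
        by (rule stepB[OF that])
      show "l1_dist m v (euler_step (incr s t) v) \<le> K1 * h" if "a \<le> s" "s \<le> t" "t \<le> b" "v \<in> Bin" for s t v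
        using near[OF that(1-3) BinB[OF that(4)]] .
      show "l1_dist m (euler_step (incr s t) v) (euler_step (incr u t) (euler_step (incr s u) v)) \<le> K3 * \<omega> s t powr \<theta>"
        if o: "a \<le> s" "s \<le> u" "u \<le> t" "t \<le> b" "v \<in> Bin" for s u t v
      proof -
        have "l1_dist m (euler_step (incr u t) (euler_step (incr s u) v)) (euler_step (incr s t) v) \<le> K3 * scale s t ^ 3"
          unfolding K3_def
        proof (rule euler_step_almost_flow[OF K BinB[OF o(5)] refl])
          show "segment_at v (euler_step (incr s u) v) x \<in> B" if "0 \<le> x" "x \<le> 1" for x
            using o that by (intro segB BinB stepB) auto
          \<comment> \<open>Both partial increments are measured at the scale of the whole interval,
            so that the defect comes out in terms of \<open>\<omega> s t\<close>.\<close>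
          show "rough_size n C (scale s t) (incr s u)"
            using o ab C(1) by (intro rough_size_mono[OF C(2)[of s u]] scale_mono scale_nonneg) auto
          show "rough_size n C (scale s t) (incr u t)"
            using o ab C(1) by (intro rough_size_mono[OF C(2)[of u t]] scale_mono scale_nonneg) auto
          show "chen n (incr s u) (incr u t) (incr s t)" using o ab by (intro incr_chen) auto
          show "scale s t \<le> 1" using size(2)[of s t] o by auto
        qed (use C in auto)
        then show ?thesis using scale_power[of 3 s t] by (simp add: \<theta>_def l1_dist_commute)
      qed
      show "l1_dist m (euler_step (incr s t) v) (euler_step (incr s t) w) \<le> (1 + \<epsilon>) * l1_dist m v w"
        if "a \<le> s" "s \<le> t" "t \<le> b" "v \<in> B" "w \<in> B" for s t v w
      proof -
        have "l1_dist m (euler_step (incr s t) v) (euler_step (incr s t) w) \<le> (1 + K1 * scale s t) * l1_dist m v w"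
          using euler_step_lipschitz[OF K that(4,5) segB[OF that(4,5)] size(1)[OF that(1-3)] _ size(2)[OF that(1-3)]] C(1)
          by (simp add: K1_def mult_ac)
        also have "\<dots> \<le> (1 + \<epsilon>) * l1_dist m v w"
          using h1 mult_left_mono[OF sc[OF that(1-3)] K1] by (intro mult_right_mono) auto
        finally show ?thesis .
      qed
      show "Bin \<subseteq> B" using BinB by auto
      show "y0 \<in> Bin" using y0 \<rho> by (simp add: Bin_iff)
      show "v \<in> Bin" if "v \<in> B" "l1_dist m y0 v \<le> \<rho>" for v using that by (simp add: B_iff Bin_iff)
      show "0 \<le> \<theta>" "0 \<le> K3" "0 \<le> L" "0 \<le> \<epsilon>" using \<theta> K3 Lpos \<epsilon> by auto
      show "K1 * h + L * \<omega> a b powr \<theta> \<le> \<rho>"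
      proof -
        have "\<omega> a b powr \<theta> = scale a b ^ 3" using scale_power[of 3 a b] by (simp add: \<theta>_def)
        also have "\<dots> \<le> h ^ 3" using sc[of a b] ab by (intro power_mono) auto
        also have "\<dots> \<le> h" by (rule h3)
        finally have "L * \<omega> a b powr \<theta> \<le> L * h" using Lpos by (rule mult_left_mono)
        then show ?thesis using h2 by linarith
      qed
      show "(1 + (1 + \<epsilon>)\<^sup>2) * (L / 2 powr \<theta>) + (2 + \<epsilon>) * K3 \<le> L" by (rule L)
    qed
    have BinV: "Bin \<subseteq> V" using BinB r(2) by (auto simp: B_def)
    have cont: "continuous_on Bin (\<lambda>v. euler_step (incr s t) v i)" if "i < m" for s t i
    proof -
      have "continuous_on Bin (F \<tau> i)" if "\<tau> \<in> forests n" for \<tau>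
        using smooth_on_continuous[OF F[OF that \<open>i < m\<close>] V] BinV continuous_on_subset by blast
      then have "continuous_on Bin (\<lambda>v. v i + rough_increment n (\<lambda>\<tau>. F \<tau> i v) (incr s t))"
        unfolding rough_increment_def
        by (intro continuous_on_add continuous_on_sum continuous_on_mult continuous_on_const
            continuous_on_product_then_coordinatewise[OF continuous_on_id]) auto
      then show ?thesis using that by (simp add: euler_step_def)
    qed
    from Binc obtain Y where "Y a = y0" "\<And>t. Y t \<in> Bin"
      "\<And>s t. a \<le> s \<Longrightarrow> s \<le> t \<Longrightarrow> t \<le> b \<Longrightarrow> l1_dist m (euler_step (incr s t) (Y s)) (Y t) \<le> L * \<omega> s t powr \<theta>"
      using solution_exists[OF _ compact_imp_closed] cont by metis
    then show "\<exists>Y L Z. Y a = y0 \<and> compact Z \<and> Z \<subseteq> V \<and> (\<forall>t. Y t \<in> Z) \<and> 0 \<le> L \<and>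
       (\<forall>s t. a \<le> s \<longrightarrow> s \<le> t \<longrightarrow> t \<le> b \<longrightarrow> l1_dist m (euler_step (incr s t) (Y s)) (Y t) \<le> L * \<omega> s t powr (3 / p))"
      using BinV Binc Lpos by (intro exI[of _ Y] exI[of _ L] exI[of _ Bin]) (auto simp: \<theta>_def)
  qed
qed

end

section \<open>Change of chart and concatenation\<close>

lemma rough_increment_sum_left:
  "rough_increment n (\<lambda>\<tau>. \<Sum>j\<in>J. c j * g j \<tau>) X = (\<Sum>j\<in>J. c j * rough_increment n (g j) X)"
proof -
  have "rough_increment n (\<lambda>\<tau>. \<Sum>j\<in>J. c j * g j \<tau>) X
      = (\<Sum>\<tau>\<in>forests n. \<Sum>j\<in>J. c j * (1 / sym_factor \<tau> * g j \<tau> * X \<tau>))"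
    by (simp add: rough_increment_def sum_distrib_left sum_distrib_right mult_ac)
  also have "\<dots> = (\<Sum>j\<in>J. \<Sum>\<tau>\<in>forests n. c j * (1 / sym_factor \<tau> * g j \<tau> * X \<tau>))"
    by (rule sum.swap)
  finally show ?thesis by (simp add: rough_increment_def sum_distrib_left)
qed

text \<open>Used with \<open>x\<close> the one-vertex increments: a double sum over labels, with
  \<open>Dots\<close> increments written as products, becomes the quadratic form \<open>c\<close> in
  the one-vertex displacements of the coordinates.\<close>

lemma sum_bilinear_swap:
  fixes c :: "'j \<Rightarrow> 'j \<Rightarrow> real" and x :: "'i \<Rightarrow> real"
  shows "(\<Sum>\<alpha>\<in>I. \<Sum>\<beta>\<in>I. (\<Sum>j\<in>J. \<Sum>k\<in>J. c j k * g \<alpha> j * g \<beta> k) * (x \<alpha> * x \<beta>))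
    = (\<Sum>j\<in>J. \<Sum>k\<in>J. c j k * ((\<Sum>\<alpha>\<in>I. g \<alpha> j * x \<alpha>) * (\<Sum>\<beta>\<in>I. g \<beta> k * x \<beta>)))"
proof -
  define T where "T q r = c (fst r) (snd r) * (g (fst q) (fst r) * x (fst q) * (g (snd q) (snd r) * x (snd q)))" for q r
  have pI: "(\<Sum>\<alpha>\<in>I. \<Sum>\<beta>\<in>I. G \<alpha> \<beta>) = (\<Sum>q\<in>I \<times> I. G (fst q) (snd q))" for G :: "'i \<Rightarrow> 'i \<Rightarrow> real"
    by (simp add: sum.cartesian_product case_prod_beta)
  have pJ: "(\<Sum>\<alpha>\<in>J. \<Sum>\<beta>\<in>J. G \<alpha> \<beta>) = (\<Sum>q\<in>J \<times> J. G (fst q) (snd q))" for G :: "'j \<Rightarrow> 'j \<Rightarrow> real"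
    by (simp add: sum.cartesian_product case_prod_beta)
  have "(\<Sum>\<alpha>\<in>I. \<Sum>\<beta>\<in>I. (\<Sum>j\<in>J. \<Sum>k\<in>J. c j k * g \<alpha> j * g \<beta> k) * (x \<alpha> * x \<beta>))
      = (\<Sum>\<alpha>\<in>I. \<Sum>\<beta>\<in>I. \<Sum>j\<in>J. \<Sum>k\<in>J. T (\<alpha>, \<beta>) (j, k))"
    by (simp add: T_def sum_distrib_left sum_distrib_right mult_ac)
  also have "\<dots> = (\<Sum>q\<in>I \<times> I. \<Sum>r\<in>J \<times> J. T q r)"
    by (simp only: pI pJ prod.collapse)
  also have "\<dots> = (\<Sum>r\<in>J \<times> J. \<Sum>q\<in>I \<times> I. T q r)" by (rule sum.swap)
  also have "\<dots> = (\<Sum>j\<in>J. \<Sum>k\<in>J. \<Sum>\<alpha>\<in>I. \<Sum>\<beta>\<in>I. T (\<alpha>, \<beta>) (j, k))"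
    by (simp only: pI pJ prod.collapse)
  also have "\<dots> = (\<Sum>j\<in>J. \<Sum>k\<in>J. c j k * ((\<Sum>\<alpha>\<in>I. g \<alpha> j * x \<alpha>) * (\<Sum>\<beta>\<in>I. g \<beta> k * x \<beta>)))"
    by (simp only: T_def fst_conv snd_conv sum_product) (simp only: sum_distrib_left)
  finally show ?thesis .
qed

lemma sum_sum_abs_le:
  fixes c :: "nat \<Rightarrow> nat \<Rightarrow> real"
  assumes "\<And>j k. j < m \<Longrightarrow> k < m \<Longrightarrow> \<bar>c j k\<bar> \<le> K" "\<And>j k. j < m \<Longrightarrow> k < m \<Longrightarrow> \<bar>e j k\<bar> \<le> D"
  shows "\<bar>\<Sum>j<m. \<Sum>k<m. c j k * e j k\<bar> \<le> real m * (real m * (K * D))"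
proof -
  have "\<bar>c j k * e j k\<bar> \<le> K * D" if "j < m" "k < m" for j k
    unfolding abs_mult using assms[OF that] by (intro mult_mono) auto
  then have "\<bar>\<Sum>k<m. c j k * e j k\<bar> \<le> real m * (K * D)" if "j < m" for j
    using that sum_bounded_above[of "{..<m}" "\<lambda>k. \<bar>c j k * e j k\<bar>" "K * D"]
    by (intro order_trans[OF sum_abs]) auto
  then show ?thesis
    using sum_bounded_above[of "{..<m}" "\<lambda>j. \<bar>\<Sum>k<m. c j k * e j k\<bar>" "real m * (K * D)"]
    by (intro order_trans[OF sum_abs]) auto
qed

context coord_field
begin

text \<open>Taylor's formula of order two for \<open>\<phi>\<close> between \<open>z\<close> and
  \<open>w\<close>. The linear term matches the parts of \<open>G\<close> with first derivatives.
  The quadratic term, once \<open>w - z\<close> is replaced by the one-vertex displacement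
  \<open>P\<close>, equals the contribution of the second-derivative part of the \<open>Dots\<close>
  coefficients, because \<open>Dots\<close> increments are products. \<open>E * h\<close> bounds the
  distance from \<open>z\<close> to \<open>w\<close>, and \<open>Q * h\<^sup>2\<close> each
  coordinate of \<open>w - z\<close> minus \<open>P\<close>.\<close>

lemma chart_change_estimate:
  assumes B: "bounded_derivs B K" and z: "z \<in> B" and w: "w \<in> topspace (Euclidean_space m)"
    and seg: "\<And>t. 0 \<le> t \<Longrightarrow> t \<le> 1 \<Longrightarrow> segment_at z w t \<in> B"
    and \<phi>: "smooth_on m W \<phi>" "openin (Euclidean_space m) W" "B \<subseteq> W"
    and \<phi>1: "\<And>j u. j < m \<Longrightarrow> u \<in> B \<Longrightarrow> \<bar>partial j \<phi> u\<bar> \<le> K'"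
    and \<phi>2: "\<And>j k u. j < m \<Longrightarrow> k < m \<Longrightarrow> u \<in> B \<Longrightarrow> \<bar>partial k (partial j \<phi>) u\<bar> \<le> K'"
    and \<phi>3: "\<And>j k l u. j < m \<Longrightarrow> k < m \<Longrightarrow> l < m \<Longrightarrow> u \<in> B \<Longrightarrow> \<bar>partial l (partial k (partial j \<phi>)) u\<bar> \<le> K'"
    and K': "0 \<le> K'" and X: "rough_size n C h X" "0 \<le> h" "h \<le> 1" "0 \<le> C" and L: "0 \<le> L"
    and dots: "\<And>\<alpha> \<beta>. \<alpha> \<in> {1..n} \<Longrightarrow> \<beta> \<in> {1..n} \<Longrightarrow> X (Dots (Upair \<alpha> \<beta>)) = X (Vertex \<alpha>) * X (Vertex \<beta>)"
    and est: "l1_dist m (euler_step X z) w \<le> L * h ^ 3"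
    and G1: "\<And>\<alpha>. G (Vertex \<alpha>) = (\<Sum>j<m. partial j \<phi> z * F (Vertex \<alpha>) j z)"
    and G2: "\<And>\<alpha> \<beta>. G (Dots (Upair \<alpha> \<beta>)) = (\<Sum>j<m. partial j \<phi> z * F (Dots (Upair \<alpha> \<beta>)) j z)
       + (\<Sum>j<m. \<Sum>k<m. partial k (partial j \<phi>) z * F (Vertex \<alpha>) j z * F (Vertex \<beta>) k z)"
    and G3: "\<And>\<alpha> \<beta>. G (Stack \<alpha> \<beta>) = (\<Sum>j<m. partial j \<phi> z * F (Stack \<alpha> \<beta>) j z)"
    and N: "N = real (card (forests n))" and E: "E = real m * (N * (K * C)) + L" and Q: "Q = L + N * (K * C)"
  shows "\<bar>\<phi> w - \<phi> z - rough_increment n G X\<bar>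
     \<le> (K' * E ^ 3 + K' * L + real m * (real m * (K' * (2 * (E * Q) + Q * Q)))) * h ^ 3"
proof -
  have K: "0 < K" and zE: "z \<in> topspace (Euclidean_space m)"
    using B z V openin_subset by (auto simp: bounded_derivs_def)
  have pos: "0 \<le> N" "0 \<le> E" "0 \<le> Q" using K X L by (simp_all add: N E Q)
  have h3: "h ^ 3 \<le> h\<^sup>2" "h\<^sup>2 \<le> h" using power_decreasing[of 2 3 h] power_decreasing[of 1 2 h] X by auto
  define d where "d j = w j - z j" for j
  define P where "P j = (\<Sum>\<alpha>=1..n. F (Vertex \<alpha>) j z * X (Vertex \<alpha>))" for j
  define I where "I j = rough_increment n (\<lambda>\<tau>. F \<tau> j z) X" for j
  define c where "c j k = partial k (partial j \<phi>) z" for j k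
  have Lh: "L * h ^ 3 \<le> L * h" using h3 L by (intro mult_left_mono) auto
  have Lh2: "L * h ^ 3 \<le> L * h\<^sup>2" using h3 L by (intro mult_left_mono) auto
  have "l1_dist m z w \<le> real m * (N * (K * (C * h))) + L * h ^ 3"
    using l1_dist_triangle[of m z w "euler_step X z"] est euler_step_displacement[OF B z X] by (simp add: N)
  also have "\<dots> \<le> E * h" using Lh by (simp add: E distrib_right mult.assoc)
  finally have dist: "l1_dist m z w \<le> E * h" .
  have dE: "\<bar>d j\<bar> \<le> E * h" if "j < m" for j
    using coord_le_l1_dist[OF that, of z w] dist by (simp add: d_def)
  have R: "(\<Sum>j<m. \<bar>d j - I j\<bar>) \<le> L * h ^ 3"
  proof -
    have "(\<Sum>j<m. \<bar>d j - I j\<bar>) = l1_dist m (euler_step X z) w"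
      unfolding l1_dist_def by (intro sum.cong) (auto simp: euler_step_def d_def I_def)
    then show ?thesis using est by simp
  qed
  have dP: "\<bar>d j - P j\<bar> \<le> Q * h\<^sup>2" if "j < m" for j
  proof -
    have "\<bar>d j - I j\<bar> \<le> (\<Sum>j<m. \<bar>d j - I j\<bar>)"
      using that by (intro member_le_sum[where f = "\<lambda>j. \<bar>d j - I j\<bar>"]) auto
    moreover have "\<bar>I j - P j\<bar> \<le> N * (K * (C * h\<^sup>2))"
      unfolding I_def P_def N using B z that
      by (intro rough_increment_second_order[OF X(1,4)]) (auto simp: bounded_derivs_def)
    ultimately have "\<bar>d j - P j\<bar> \<le> L * h\<^sup>2 + N * (K * (C * h\<^sup>2))" using R Lh2 by linarith
    then show ?thesis by (simp add: Q distrib_right mult.assoc)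
  qed
  have PQ: "\<bar>P j\<bar> \<le> (E + Q) * h" if "j < m" for j
  proof -
    have "Q * h\<^sup>2 \<le> Q * h" using h3 pos by (intro mult_left_mono) auto
    then have "\<bar>P j\<bar> \<le> E * h + Q * h" using dE[OF that] dP[OF that] by linarith
    then show ?thesis by (simp add: distrib_right)
  qed
  \<comment> \<open>A difference of two products costs one factor of order \<open>h\<close> and one
    of order \<open>h\<^sup>2\<close>, hence order three.\<close>
  have quad: "\<bar>d k * d j - P j * P k\<bar> \<le> (2 * (E * Q) + Q * Q) * h ^ 3" if "j < m" "k < m" for j k
  proof -
    have "d k * d j - P j * P k = (d k - P k) * d j + P k * (d j - P j)" by (simp add: algebra_simps)
    then have "\<bar>d k * d j - P j * P k\<bar> \<le> \<bar>d k - P k\<bar> * \<bar>d j\<bar> + \<bar>P k\<bar> * \<bar>d j - P j\<bar>"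
      using abs_triangle_ineq[of "(d k - P k) * d j" "P k * (d j - P j)"] by (simp add: abs_mult)
    also have "\<dots> \<le> (Q * h\<^sup>2) * (E * h) + ((E + Q) * h) * (Q * h\<^sup>2)"
      using dP dE PQ that by (intro add_mono mult_mono) (auto simp: pos X)
    also have "\<dots> = (2 * (E * Q) + Q * Q) * h ^ 3"
      by (simp add: power2_eq_square power3_eq_cube algebra_simps)
    finally show ?thesis .
  qed
  \<comment> \<open>The purely linear transform of the components; it differs from \<open>G\<close>
    on \<open>Dots\<close> alone.\<close>
  define G0 where "G0 \<tau> = (\<Sum>j<m. partial j \<phi> z * F \<tau> j z)" for \<tau>
  have "rough_increment n (\<lambda>\<tau>. G \<tau> - G0 \<tau>) X
     = (\<Sum>\<alpha>=1..n. \<Sum>\<beta>=1..n. (\<Sum>j<m. \<Sum>k<m. c j k * F (Vertex \<alpha>) j z * F (Vertex \<beta>) k z) * X (Dots (Upair \<alpha> \<beta>))) / 2"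
    unfolding rough_increment_eq by (simp add: G1 G2 G3 G0_def c_def)
  also have "(\<Sum>\<alpha>=1..n. \<Sum>\<beta>=1..n. (\<Sum>j<m. \<Sum>k<m. c j k * F (Vertex \<alpha>) j z * F (Vertex \<beta>) k z) * X (Dots (Upair \<alpha> \<beta>)))
     = (\<Sum>\<alpha>=1..n. \<Sum>\<beta>=1..n. (\<Sum>j<m. \<Sum>k<m. c j k * F (Vertex \<alpha>) j z * F (Vertex \<beta>) k z) * (X (Vertex \<alpha>) * X (Vertex \<beta>)))"
    by (intro sum.cong refl arg_cong2[where f = times] dots)
  also have "\<dots> = (\<Sum>j<m. \<Sum>k<m. c j k * (P j * P k))"
    unfolding P_def by (rule sum_bilinear_swap)
  finally have RI: "rough_increment n G X = (\<Sum>j<m. partial j \<phi> z * I j) + (\<Sum>j<m. \<Sum>k<m. c j k * (P j * P k)) / 2"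
    by (simp add: rough_increment_diff_left G0_def[abs_def] rough_increment_sum_left I_def)
  have T: "\<bar>\<phi> w - \<phi> z - (\<Sum>j<m. partial j \<phi> z * d j) - (\<Sum>j<m. \<Sum>k<m. c j k * (d k * d j)) / 2\<bar> \<le> K' * E ^ 3 * h ^ 3"
  proof -
    have "\<bar>\<phi> w - \<phi> z - (\<Sum>j<m. partial j \<phi> z * d j) - (\<Sum>j<m. \<Sum>k<m. c j k * (d k * d j)) / 2\<bar> \<le> K' * (l1_dist m z w) ^ 3"
      using smooth_on_taylor2_segment[OF \<phi>(1,2) zE w \<phi>(3) seg \<phi>3] by (simp add: d_def c_def mult.assoc)
    also have "\<dots> \<le> K' * (E * h) ^ 3" using dist K' by (intro mult_left_mono power_mono) auto
    finally show ?thesis by (simp add: power_mult_distrib mult.assoc)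
  qed
  have T1: "\<bar>\<Sum>j<m. partial j \<phi> z * (d j - I j)\<bar> \<le> K' * L * h ^ 3"
  proof -
    have "\<bar>\<Sum>j<m. partial j \<phi> z * (d j - I j)\<bar> \<le> K' * (\<Sum>j<m. \<bar>d j - I j\<bar>)"
      using \<phi>1 z by (intro abs_sum_mult_le) auto
    also have "\<dots> \<le> K' * (L * h ^ 3)" using R K' by (rule mult_left_mono)
    finally show ?thesis by (simp add: mult.assoc)
  qed
  have T2: "\<bar>\<Sum>j<m. \<Sum>k<m. c j k * (d k * d j - P j * P k)\<bar> \<le> real m * (real m * (K' * ((2 * (E * Q) + Q * Q) * h ^ 3)))"
    using \<phi>2 z quad by (intro sum_sum_abs_le) (auto simp: c_def)
  have "\<phi> w - \<phi> z - rough_increment n G X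
     = (\<phi> w - \<phi> z - (\<Sum>j<m. partial j \<phi> z * d j) - (\<Sum>j<m. \<Sum>k<m. c j k * (d k * d j)) / 2)
       + (\<Sum>j<m. partial j \<phi> z * (d j - I j)) + (\<Sum>j<m. \<Sum>k<m. c j k * (d k * d j - P j * P k)) / 2"
    unfolding RI by (simp add: right_diff_distrib sum_subtractf diff_divide_distrib)
  then have "\<bar>\<phi> w - \<phi> z - rough_increment n G X\<bar> \<le> K' * E ^ 3 * h ^ 3 + K' * L * h ^ 3
      + real m * (real m * (K' * ((2 * (E * Q) + Q * Q) * h ^ 3)))"
    using T T1 T2 by linarith
  then show ?thesis by (simp only: distrib_right mult.assoc)
qed

end

section \<open>Paths that follow the Euler steps in a chart\<close>

context driven_coord_field
begin

text \<open>The threshold \<open>h0\<close> is there because for larger increments the Euler step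
  may leave the chart image, where neither Taylor expansion nor the almost flow property is
  available. Both constants may depend on the path.\<close>

definition follows :: "real \<Rightarrow> real \<Rightarrow> (real \<Rightarrow> vec) \<Rightarrow> bool" where
  "follows a b y \<longleftrightarrow> (\<exists>L\<ge>0. \<exists>h0>0. \<forall>s t. a \<le> s \<longrightarrow> s \<le> t \<longrightarrow> t \<le> b \<longrightarrow> scale s t \<le> h0 \<longrightarrow>
     l1_dist m (euler_step (incr s t) (y s)) (y t) \<le> L * scale s t ^ 3)"

text \<open>The end points lie in one ball around \<open>z\<close>, which is convex, even where the
  tube is not.\<close>

lemma tube_segment:
  assumes "z \<in> Z" "v \<in> topspace (Euclidean_space m)" "w \<in> topspace (Euclidean_space m)"
    "l1_dist m z v \<le> r" "l1_dist m z w \<le> r" "0 \<le> t" "t \<le> 1"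
  shows "segment_at v w t \<in> l1_tube m Z r"
  using assms by (auto simp: l1_tube_def intro!: bexI[of _ z] segment_at_Euclidean_space l1_dist_segment_at)

lemma tube_bounds:
  assumes "compact Z" "Z \<subseteq> W" "openin (Euclidean_space m) W" "W \<subseteq> V"
  obtains r K where "r > 0" "l1_tube m Z r \<subseteq> W" "bounded_derivs (l1_tube m Z r) K"
proof -
  obtain r where r: "r > 0" "l1_tube m Z r \<subseteq> W" using compact_l1_tube_in_open[OF assms(1-3)] by metis
  have "Z \<subseteq> topspace (Euclidean_space m)" using assms(2,3) openin_subset by blast
  then obtain K where "bounded_derivs (l1_tube m Z r) K"
    using bounded_derivs_compact[OF compact_l1_tube[OF assms(1)]] r(2) assms(4) by (metis order_trans)
  then show thesis using that r by blast
qed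

lemma follows_mono:
  assumes "follows a b y" "a \<le> a'" "b' \<le> b"
  shows "follows a' b' y"
proof -
  obtain L h0 where "L \<ge> 0" "h0 > 0" "\<forall>s t. a \<le> s \<longrightarrow> s \<le> t \<longrightarrow> t \<le> b \<longrightarrow> scale s t \<le> h0 \<longrightarrow>
     l1_dist m (euler_step (incr s t) (y s)) (y t) \<le> L * scale s t ^ 3"
    using assms(1) unfolding follows_def by blast
  then show ?thesis unfolding follows_def using assms(2,3)
    by (intro exI[of _ L] conjI exI[of _ h0]) auto
qed

text \<open>Only pairs of times with \<open>u\<close> between them need an argument: the step from
  \<open>s\<close> to \<open>t\<close> is compared with two steps through \<open>u\<close> by the
  almost flow property, the Lipschitz bound carries the first error over, and the second estimate
  finishes.\<close>

lemma follows_concat: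
  assumes ab: "S \<le> a" "b \<le> T" and Z: "compact Z" "Z \<subseteq> V" "\<And>t. a \<le> t \<Longrightarrow> t \<le> b \<Longrightarrow> y t \<in> Z"
    and f1: "follows a u y" and f2: "follows u b y"
  shows "follows a b y"
proof -
  obtain L1 h1 where 1: "L1 \<ge> 0" "h1 > 0" "\<And>s t. a \<le> s \<Longrightarrow> s \<le> t \<Longrightarrow> t \<le> u \<Longrightarrow> scale s t \<le> h1 \<Longrightarrow>
     l1_dist m (euler_step (incr s t) (y s)) (y t) \<le> L1 * scale s t ^ 3"
    using f1 unfolding follows_def by blast
  obtain L2 h2 where 2: "L2 \<ge> 0" "h2 > 0" "\<And>s t. u \<le> s \<Longrightarrow> s \<le> t \<Longrightarrow> t \<le> b \<Longrightarrow> scale s t \<le> h2 \<Longrightarrow>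
     l1_dist m (euler_step (incr s t) (y s)) (y t) \<le> L2 * scale s t ^ 3"
    using f2 unfolding follows_def by blast
  obtain r K where r: "r > 0" and BV: "l1_tube m Z r \<subseteq> V" and B: "bounded_derivs (l1_tube m Z r) K"
    using tube_bounds[OF Z(1,2) V] by blast
  obtain C where C: "C > 0" "\<And>s t. S \<le> s \<Longrightarrow> s \<le> t \<Longrightarrow> t \<le> T \<Longrightarrow> rough_size n C (scale s t) (incr s t)"
    using incr_size by blast
  have K: "K > 0" using B by (simp add: bounded_derivs_def)
  have ZE: "Z \<subseteq> topspace (Euclidean_space m)" using Z(2) V openin_subset by blast
  define K1 where "K1 = real m * (real (card (forests n)) * (K * C))"
  define K3 where "K3 = flow_defect_const K C"
  have K1: "0 \<le> K1" using K C by (simp add: K1_def)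
  have K3: "0 \<le> K3" using K C by (simp add: K3_def flow_defect_const_def Let_def)
  \<comment> \<open>The last entry keeps both the Euler step from \<open>s\<close> to
    \<open>u\<close> and the point \<open>y u\<close> within \<open>r\<close> of \<open>y s\<close>,
    hence in the tube where the bounds hold.\<close>
  define h0 where "h0 = min (min h1 h2) (min 1 (r / (K1 + L1 + 1)))"
  define L where "L = L1 + L2 + (K3 + (1 + K1) * L1)"
  have h0: "h0 > 0" using 1 2 r K1 by (simp add: h0_def)
  have L: "L1 \<le> L" "L2 \<le> L" "K3 + (1 + K1) * L1 + L2 \<le> L" "0 \<le> L"
    using 1 2 K1 K3 by (simp_all add: L_def)
  have "l1_dist m (euler_step (incr s t) (y s)) (y t) \<le> L * scale s t ^ 3"
    if st: "a \<le> s" "s \<le> t" "t \<le> b" "scale s t \<le> h0" for s t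
  proof -
    let ?h = "scale s t"
    have h: "?h \<le> h1" "?h \<le> h2" "?h \<le> 1" "0 \<le> ?h" using st(4) by (auto simp: h0_def)
    have h3: "0 \<le> ?h ^ 3" "?h ^ 3 \<le> ?h" using power_decreasing[of 1 3 ?h] h by auto
    consider "t \<le> u" | "u \<le> s" | "s \<le> u" "u \<le> t" by linarith
    then show ?thesis
    proof cases
      case 1
      then have "l1_dist m (euler_step (incr s t) (y s)) (y t) \<le> L1 * ?h ^ 3"
        using st h by (intro \<open>\<And>s t. a \<le> s \<Longrightarrow> s \<le> t \<Longrightarrow> t \<le> u \<Longrightarrow> scale s t \<le> h1 \<Longrightarrow> _\<close>) auto
      then show ?thesis using mult_right_mono[OF L(1) h3(1)] by linarith
    next
      case 2
      then have "l1_dist m (euler_step (incr s t) (y s)) (y t) \<le> L2 * ?h ^ 3"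
        using st h by (intro \<open>\<And>s t. u \<le> s \<Longrightarrow> s \<le> t \<Longrightarrow> t \<le> b \<Longrightarrow> scale s t \<le> h2 \<Longrightarrow> _\<close>) auto
      then show ?thesis using mult_right_mono[OF L(2) h3(1)] by linarith
    next
      case 3
      have su: "scale s u \<le> ?h" "scale u t \<le> ?h" using 3 st ab by (auto intro!: scale_mono)
      have su3: "scale s u ^ 3 \<le> ?h ^ 3" "scale u t ^ 3 \<le> ?h ^ 3" using su by (auto intro!: power_mono)
      have "h0 \<le> r / (K1 + L1 + 1)" by (simp add: h0_def)
      then have "?h \<le> r / (K1 + L1 + 1)" using st(4) by simp
      then have "(K1 + L1 + 1) * ?h \<le> r" using K1 \<open>0 \<le> L1\<close> by (simp add: field_simps)
      then have hr: "K1 * ?h + L1 * ?h \<le> r" using h(4) unfolding distrib_right by linarith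
      let ?v = "y s" and ?w = "euler_step (incr s u) (y s)"
      have yZ: "?v \<in> Z" "y u \<in> Z" using 3 st Z(3) by auto
      have yE: "?v \<in> topspace (Euclidean_space m)" "y u \<in> topspace (Euclidean_space m)" using yZ ZE by auto
      have vB: "?v \<in> l1_tube m Z r" using yZ yE r by (auto simp: l1_tube_def intro!: bexI[of _ ?v])
      have size: "rough_size n C ?h (incr s u)" "rough_size n C ?h (incr u t)"
        using 3 st ab C su by (auto intro!: rough_size_mono[OF C(2)[of s u]] rough_size_mono[OF C(2)[of u t]])
      have d1: "l1_dist m ?v ?w \<le> K1 * ?h"
        using euler_step_displacement[OF B vB size(1) h(4,3)] C by (simp add: K1_def mult_ac)
      have d2: "l1_dist m ?w (y u) \<le> L1 * ?h ^ 3"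
      proof -
        have "l1_dist m ?w (y u) \<le> L1 * scale s u ^ 3" using 3 st su h by (intro 1(3)) auto
        also have "\<dots> \<le> L1 * ?h ^ 3" using su3 1 by (intro mult_left_mono) auto
        finally show ?thesis .
      qed
      have L1h: "L1 * ?h ^ 3 \<le> L1 * ?h" using h3 1 by (intro mult_left_mono) auto
      have L1h0: "0 \<le> L1 * ?h" using h 1 by simp
      have dvw: "l1_dist m ?v ?w \<le> r" using d1 hr L1h0 by linarith
      have dvu: "l1_dist m ?v (y u) \<le> r" using d1 d2 L1h hr l1_dist_triangle[of m ?v "y u" ?w] by linarith
      have wB: "?w \<in> l1_tube m Z r" "y u \<in> l1_tube m Z r"
        using yZ yE dvw dvu by (auto simp: l1_tube_def intro!: bexI[of _ ?v])
      have e1: "l1_dist m (euler_step (incr u t) ?w) (euler_step (incr s t) ?v) \<le> K3 * ?h ^ 3"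
        unfolding K3_def
        using euler_step_almost_flow[OF B vB refl tube_segment[OF yZ(1) yE(1) _ _ dvw] size incr_chen[of s u t] h(4,3)]
          3 st ab C r by auto
      have e2: "l1_dist m (euler_step (incr u t) ?w) (euler_step (incr u t) (y u)) \<le> (1 + K1) * (L1 * ?h ^ 3)"
      proof -
        have "l1_dist m (euler_step (incr u t) ?w) (euler_step (incr u t) (y u)) \<le> (1 + K1 * ?h) * l1_dist m ?w (y u)"
          using euler_step_lipschitz[OF B wB tube_segment[OF yZ(1) _ yE(2) dvw dvu] size(2) h(4,3)] C
          by (simp add: K1_def mult_ac)
        also have "\<dots> \<le> (1 + K1) * (L1 * ?h ^ 3)"
          using d2 mult_left_mono[OF h(3) K1] K1 by (intro mult_mono) auto
        finally show ?thesis .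
      qed
      have e3: "l1_dist m (euler_step (incr u t) (y u)) (y t) \<le> L2 * ?h ^ 3"
      proof -
        have "l1_dist m (euler_step (incr u t) (y u)) (y t) \<le> L2 * scale u t ^ 3" using 3 st su h by (intro 2(3)) auto
        also have "\<dots> \<le> L2 * ?h ^ 3" using su3 2 by (intro mult_left_mono) auto
        finally show ?thesis .
      qed
      have "l1_dist m (euler_step (incr s t) ?v) (y t) \<le> K3 * ?h ^ 3 + ((1 + K1) * (L1 * ?h ^ 3) + L2 * ?h ^ 3)"
        using e1 e2 e3 l1_dist_triangle[of m "euler_step (incr s t) ?v" "y t" "euler_step (incr u t) ?w"]
          l1_dist_triangle[of m "euler_step (incr u t) ?w" "y t" "euler_step (incr u t) (y u)"]
        by (simp add: l1_dist_commute)
      also have "\<dots> = (K3 + (1 + K1) * L1 + L2) * ?h ^ 3" by (simp add: algebra_simps)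
      also have "\<dots> \<le> L * ?h ^ 3" using L(3) h3(1) by (rule mult_right_mono)
      finally show ?thesis .
    qed
  qed
  then show ?thesis unfolding follows_def using L(4) h0 by blast
qed

text \<open>Beyond the threshold the left-hand side is merely bounded, as path and increments are,
  while \<open>scale s t ^ 3\<close> is at least \<open>h0 ^ 3\<close>; enlarging the constant
  covers this range.\<close>

lemma follows_bound:
  assumes ab: "S \<le> a" "b \<le> T" and Z: "compact Z" "Z \<subseteq> V" "\<And>t. a \<le> t \<Longrightarrow> t \<le> b \<Longrightarrow> y t \<in> Z"
    and f: "follows a b y"
  obtains C where "C > 0" "\<And>s t. a \<le> s \<Longrightarrow> s \<le> t \<Longrightarrow> t \<le> b \<Longrightarrow>
    l1_dist m (euler_step (incr s t) (y s)) (y t) \<le> C * scale s t ^ 3"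
proof -
  obtain L h0 where L: "L \<ge> 0" "h0 > 0" "\<And>s t. a \<le> s \<Longrightarrow> s \<le> t \<Longrightarrow> t \<le> b \<Longrightarrow> scale s t \<le> h0 \<Longrightarrow>
     l1_dist m (euler_step (incr s t) (y s)) (y t) \<le> L * scale s t ^ 3"
    using f unfolding follows_def by blast
  obtain K where K: "bounded_derivs Z K" using bounded_derivs_compact[OF Z(1,2)] .
  obtain R where R: "R > 0" "\<And>i v. i \<in> {..<m} \<Longrightarrow> v \<in> Z \<Longrightarrow> \<bar>v i\<bar> \<le> R"
    by (rule compact_finite_bounded_real[OF Z(1), of "{..<m}" "\<lambda>i v. v i"])
       (simp_all add: continuous_on_product_then_coordinatewise[OF continuous_on_id])
  obtain C where C: "C > 0" "\<And>s t. S \<le> s \<Longrightarrow> s \<le> t \<Longrightarrow> t \<le> T \<Longrightarrow> rough_size n C (scale s t) (incr s t)"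
    using incr_size by blast
  \<comment> \<open>At least 1, so that \<open>H\<^sup>2\<close> dominates the sizes of forests of
    both degrees.\<close>
  define H where "H = max 1 (scale S T)"
  have X: "\<bar>X \<tau> s t\<bar> \<le> C * H\<^sup>2" if "S \<le> s" "s \<le> t" "t \<le> T" "\<tau> \<in> forests n" for \<tau> s t
  proof -
    have "scale s t \<le> H" using scale_mono[of S s t T] that by (simp add: H_def)
    then have "rough_size n C H (incr s t)" using C(1) that by (intro rough_size_mono[OF C(2)]) auto
    then have "\<bar>X \<tau> s t\<bar> \<le> C * H ^ forest_degree \<tau>" using that by (simp add: rough_size_def)
    also have "\<dots> \<le> C * H\<^sup>2"
      using C(1) by (intro mult_left_mono power_increasing; cases \<tau>; simp add: H_def)
    finally show ?thesis .
  qed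
  define M0 where "M0 = real m * (2 * R + real (card (forests n)) * (K * (C * H\<^sup>2)))"
  have M0: "0 \<le> M0" using R K C by (simp add: M0_def bounded_derivs_def)
  have bd: "l1_dist m (euler_step (incr s t) (y s)) (y t) \<le> M0" if st: "a \<le> s" "s \<le> t" "t \<le> b" for s t
  proof -
    have "\<bar>euler_step (incr s t) (y s) i - y t i\<bar> \<le> 2 * R + real (card (forests n)) * (K * (C * H\<^sup>2))" if i: "i < m" for i
    proof -
      have "\<bar>rough_increment n (\<lambda>\<tau>. F \<tau> i (y s)) (incr s t)\<bar> \<le> real (card (forests n)) * (K * (C * H\<^sup>2))"
        using K Z(3)[of s] X st ab i by (intro rough_increment_bound) (auto simp: bounded_derivs_def)
      moreover have "\<bar>y s i\<bar> \<le> R" "\<bar>y t i\<bar> \<le> R" using R(2) Z(3) st i by auto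
      ultimately show ?thesis using i by (simp add: euler_step_def)
    qed
    then show ?thesis unfolding l1_dist_def M0_def
      using sum_bounded_above[of "{..<m}" "\<lambda>i. \<bar>euler_step (incr s t) (y s) i - y t i\<bar>"] by simp
  qed
  define c where "c = L + M0 / h0 ^ 3 + 1"
  have c: "c > 0" "L \<le> c" "M0 / h0 ^ 3 \<le> c" using L M0 by (simp_all add: c_def add_nonneg_pos)
  show thesis
  proof (rule that[OF c(1)])
    fix s t assume st: "a \<le> s" "s \<le> t" "t \<le> b"
    show "l1_dist m (euler_step (incr s t) (y s)) (y t) \<le> c * scale s t ^ 3"
    proof (cases "scale s t \<le> h0")
      case True
      have "L * scale s t ^ 3 \<le> c * scale s t ^ 3" using c(2) by (intro mult_right_mono) auto
      then show ?thesis using L(3)[OF st True] by linarith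
    next
      case False
      have "M0 = M0 / h0 ^ 3 * h0 ^ 3" using L(2) by simp
      also have "\<dots> \<le> c * scale s t ^ 3" using False L(2) c M0 by (intro mult_mono power_mono) auto
      finally show ?thesis using bd[OF st] by linarith
    qed
  qed
qed

text \<open>The displacement of an Euler step and the error of the path are both at most of the
  order of the scale, which tends to zero uniformly with the length of the time interval.\<close>

lemma solution_continuous:
  assumes ab: "S \<le> a" "b \<le> T" and Z: "compact Z" "Z \<subseteq> V" "\<And>t. a \<le> t \<Longrightarrow> t \<le> b \<Longrightarrow> y t \<in> Z"
    and f: "follows a b y"
  shows "continuous_on {a..b} y"
proof (rule continuous_on_coordinatewise_then_product)
  fix i
  have ZE: "Z \<subseteq> topspace (Euclidean_space m)" using Z(2) V openin_subset by blast
  obtain L h0 where L: "L \<ge> 0" "h0 > 0" "\<And>s t. a \<le> s \<Longrightarrow> s \<le> t \<Longrightarrow> t \<le> b \<Longrightarrow> scale s t \<le> h0 \<Longrightarrow>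
     l1_dist m (euler_step (incr s t) (y s)) (y t) \<le> L * scale s t ^ 3"
    using f unfolding follows_def by blast
  obtain K where B: "bounded_derivs Z K" using bounded_derivs_compact[OF Z(1,2)] .
  obtain C where C: "C > 0" "\<And>s t. S \<le> s \<Longrightarrow> s \<le> t \<Longrightarrow> t \<le> T \<Longrightarrow> rough_size n C (scale s t) (incr s t)"
    using incr_size by blast
  define K1 where "K1 = real m * (real (card (forests n)) * (K * C))"
  have K1: "0 \<le> K1" using B C by (simp add: K1_def bounded_derivs_def)
  show "continuous_on {a..b} (\<lambda>t. y t i)"
  proof (cases "i < m")
    case False
    then have "continuous_on {a..b} (\<lambda>t. y t i) \<longleftrightarrow> continuous_on {a..b} (\<lambda>t. 0::real)"
      using Z(3) ZE by (intro continuous_on_cong) (auto simp: topspace_Euclidean_space subset_iff)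
    then show ?thesis by simp
  next
    case True
    show ?thesis
      unfolding continuous_on_iff
    proof (intro ballI allI impI)
      fix s e assume s: "s \<in> {a..b}" and e: "(e::real) > 0"
      \<comment> \<open>Displacement plus error is at most \<open>(K1 + L) * h\<close>, which this
        choice puts below \<open>e\<close>; \<open>h0\<close> keeps the estimate applicable.\<close>
      define h where "h = min (min 1 h0) (e / (2 * (K1 + L + 1)))"
      have h: "0 < h" "h \<le> 1" "h \<le> h0" using L K1 e by (auto simp: h_def)
      have "h \<le> e / (2 * (K1 + L + 1))" by (simp add: h_def)
      then have "2 * (K1 + L + 1) * h \<le> e" using K1 L by (simp add: field_simps)
      then have "2 * ((K1 + L) * h) + 2 * h \<le> e" by (simp add: algebra_simps)
      moreover have "0 \<le> (K1 + L) * h" using K1 L(1) h(1) by (intro mult_nonneg_nonneg) auto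
      ultimately have he: "(K1 + L) * h < e" using h(1) by linarith
      obtain \<delta> where \<delta>: "\<delta> > 0" "\<And>s t. S \<le> s \<Longrightarrow> s \<le> t \<Longrightarrow> t \<le> T \<Longrightarrow> t - s < \<delta> \<Longrightarrow> \<omega> s t < h powr p"
        using w_uniformly_small[of "h powr p"] h(1) by auto
      have near: "\<bar>y t i - y s i\<bar> < e" if "s \<in> {a..b}" "t \<in> {a..b}" "s \<le> t" "t - s < \<delta>" for s t
      proof -
        let ?h = "scale s t"
        have sh: "?h \<le> h" using that ab h(1) \<delta>(2)[of s t] by (intro scale_le) auto
        have h3: "?h ^ 3 \<le> ?h" using power_decreasing[of 1 3 ?h] sh h by simp
        have st: "a \<le> s" "s \<le> t" "t \<le> b" using that by auto
        have yE: "y s \<in> Z" using Z(3) that by auto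
        have "l1_dist m (y s) (euler_step (incr s t) (y s)) \<le> K1 * ?h"
          using euler_step_displacement[OF B yE C(2)[of s t]] sh h st ab C(1) by (simp add: K1_def mult_ac)
        moreover have "l1_dist m (euler_step (incr s t) (y s)) (y t) \<le> L * ?h ^ 3"
          using L(3)[OF st] sh h by auto
        moreover have "L * ?h ^ 3 \<le> L * ?h" using h3 L(1) by (rule mult_left_mono)
        ultimately have "l1_dist m (y s) (y t) \<le> K1 * ?h + L * ?h"
          using l1_dist_triangle[of m "y s" "y t" "euler_step (incr s t) (y s)"] by linarith
        also have "\<dots> = (K1 + L) * ?h" by (simp add: distrib_right)
        also have "\<dots> \<le> (K1 + L) * h" using sh K1 L(1) by (intro mult_left_mono) auto
        finally have "l1_dist m (y s) (y t) < e" using he by linarith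
        then show ?thesis using coord_le_l1_dist[OF True, of "y s" "y t"] by linarith
      qed
      have "dist (y t i) (y s i) < e" if "t \<in> {a..b}" "dist t s < \<delta>" for t
        using near[of s t] near[of t s] s that by (cases "s \<le> t") (auto simp: dist_real_def)
      then show "\<exists>d>0. \<forall>t\<in>{a..b}. dist t s < d \<longrightarrow> dist (y t i) (y s i) < e" using \<delta>(1) by blast
    qed
  qed
qed

end

section \<open>Integral curves on the manifold\<close>

context manifold
begin

lemma chart_image_topology: "(U, x) \<in> A \<Longrightarrow> subtopology (Euclidean_space m) (x ` U) = top_of_set (x ` U)"
  by (rule subtopology_Euclidean_space_eq[OF openin_subset[OF chart_image_open]])

lemma chart_homeomorphic: "(U, x) \<in> A \<Longrightarrow> homeomorphic_map (subtopology M U) (top_of_set (x ` U)) x"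
  using chart[of "(U, x)"] chart_image_topology[of U x] by (simp add: is_chart_def)

lemma chart_continuous: "(U, x) \<in> A \<Longrightarrow> continuous_map (subtopology M U) euclidean x"
  by (rule continuous_map_into_fulltopology[OF homeomorphic_imp_continuous_map[OF chart_homeomorphic]])

lemma topspace_chart: "(U, x) \<in> A \<Longrightarrow> topspace (subtopology M U) = U"
  by (metis chart_open openin_subset topspace_subtopology_subset)

lemma chart_curve_continuous:
  assumes "(U, x) \<in> A" "continuous_map (top_of_set {a..b}) M Y" "Y ` {a..b} \<subseteq> U"
  shows "continuous_on {a..b} (\<lambda>t. x (Y t))"
proof -
  have "continuous_map (top_of_set {a..b}) (subtopology M U) Y"
    using assms(2,3) by (auto simp: continuous_map_in_subtopology)
  from continuous_map_compose[OF this chart_continuous[OF assms(1)]]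
  show ?thesis by (simp add: comp_def)
qed

text \<open>The inverse supplied by the homeomorphism agrees with \<open>inv_into U x\<close> along
  the curve, which therefore inherits its continuity.\<close>

lemma chart_inverse_curve_continuous:
  assumes "(U, x) \<in> A" "continuous_on {a..b} y" "y ` {a..b} \<subseteq> x ` U"
  shows "continuous_map (top_of_set {a..b}) M (\<lambda>t. inv_into U x (y t))"
proof -
  obtain g where g: "homeomorphic_maps (subtopology M U) (top_of_set (x ` U)) x g"
    using chart_homeomorphic[OF assms(1)] homeomorphic_map_maps by blast
  have "continuous_map (top_of_set {a..b}) (top_of_set (x ` U)) y"
    using assms(2,3) by (auto simp: continuous_map_in_subtopology)
  moreover have "continuous_map (top_of_set (x ` U)) M g"
    using g continuous_map_into_fulltopology unfolding homeomorphic_maps_def by blast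
  ultimately have "continuous_map (top_of_set {a..b}) M (g \<circ> y)" by (rule continuous_map_compose)
  moreover have "(g \<circ> y) t = inv_into U x (y t)" if t: "t \<in> topspace (top_of_set {a..b})" for t
  proof -
    have "y t \<in> x ` U" using t assms(3) by auto
    then obtain q where q: "q \<in> U" "y t = x q" by blast
    have "g (x q) = q" using g q(1) topspace_chart[OF assms(1)] unfolding homeomorphic_maps_def by blast
    then show ?thesis using q assms(1) by simp
  qed
  ultimately show ?thesis by (rule continuous_map_eq)
qed

end

section \<open>Euler estimates for paths on the manifold, in varying charts\<close>

locale driven_manifold = rough_field m M A n f + rough_driver n S T p \<omega> X
  for m and M :: "'a topology" and A n f S T p \<omega> X +
  assumes adm: "admissible m n M A f"
begin

lemma chart_field: "(U, x) \<in> A \<Longrightarrow> driven_coord_field m n (x ` U) (coord U x) S T p \<omega> X"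
  using chart_image_open coord_smooth admissible_in_chart[OF adm]
  by (intro driven_coord_field.intro coord_field.intro rough_driver_axioms) auto

abbreviation follows_in :: "'a set \<Rightarrow> ('a \<Rightarrow> vec) \<Rightarrow> real \<Rightarrow> real \<Rightarrow> (real \<Rightarrow> 'a) \<Rightarrow> bool" where
  "follows_in U x a b Y \<equiv> driven_coord_field.follows m n (coord U x) p \<omega> X a b (\<lambda>t. x (Y t))"

text \<open>The clause of \<open>integral_curve\<close> for a single chart and interval, isolated so
  that it can be exchanged with \<open>follows_in\<close>.\<close>

definition chart_estimate :: "'a set \<Rightarrow> ('a \<Rightarrow> vec) \<Rightarrow> real \<Rightarrow> real \<Rightarrow> (real \<Rightarrow> 'a) \<Rightarrow> bool" where
  "chart_estimate U x a b Y \<longleftrightarrow> (\<exists>C>0. \<forall>i<m. \<forall>(s, t) \<in> time_simplex {a..b}.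
     \<bar>x (Y t) i - x (Y s) i - rough_increment n (\<lambda>\<tau>. fibre_coords m A x (f (Y s)) \<tau> i) (incr s t)\<bar>
       \<le> C * \<omega> s t powr (3 / p))"

lemma integral_curve_iff:
  "integral_curve m n M A f a b p \<omega> X Y \<longleftrightarrow> continuous_map (top_of_set {a..b}) M Y \<and>
     (\<forall>a' b'. {a'..b'} \<subseteq> {a..b} \<longrightarrow> (\<forall>(U, x)\<in>A. Y ` {a'..b'} \<subseteq> U \<longrightarrow> chart_estimate U x a' b' Y))"
  unfolding integral_curve_def chart_estimate_def rough_increment_def by simp

lemma chart_estimate_cong:
  assumes "\<And>t. a \<le> t \<Longrightarrow> t \<le> b \<Longrightarrow> Y t = Y' t"
  shows "chart_estimate U x a b Y \<longleftrightarrow> chart_estimate U x a b Y'"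
  unfolding chart_estimate_def
  by (intro ex_cong1 conj_cong all_cong1 imp_cong refl ball_cong) (auto simp: time_simplex_def assms)

text \<open>Summation over the coordinates; the hypothesis covers all scales, so the threshold is
  set to 1 arbitrarily.\<close>

lemma chart_estimate_imp_follows:
  assumes x: "(U, x) \<in> A" and Y: "Y ` {a..b} \<subseteq> U" and est: "chart_estimate U x a b Y"
  shows "follows_in U x a b Y"
proof -
  interpret C: driven_coord_field m n "x ` U" "coord U x" S T p \<omega> X by (rule chart_field[OF x])
  obtain c where c: "c > 0" "\<And>i s t. i < m \<Longrightarrow> a \<le> s \<Longrightarrow> s \<le> t \<Longrightarrow> t \<le> b \<Longrightarrow>
     \<bar>x (Y t) i - x (Y s) i - rough_increment n (\<lambda>\<tau>. fibre_coords m A x (f (Y s)) \<tau> i) (incr s t)\<bar>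
       \<le> c * \<omega> s t powr (3 / p)"
    using est unfolding chart_estimate_def time_simplex_def by fastforce
  have "l1_dist m (C.euler_step (incr s t) (x (Y s))) (x (Y t)) \<le> real m * c * scale s t ^ 3"
    if st: "a \<le> s" "s \<le> t" "t \<le> b" for s t
  proof -
    have q: "Y s \<in> U" using Y st by auto
    have "\<bar>C.euler_step (incr s t) (x (Y s)) i - x (Y t) i\<bar> \<le> c * scale s t ^ 3" if "i < m" for i
      using c(2)[OF that st] that scale_power[of 3 s t]
      by (simp add: C.euler_step_def coord_at[OF x q] abs_minus_commute algebra_simps)
    then show ?thesis
      unfolding l1_dist_def
      using sum_bounded_above[of "{..<m}" "\<lambda>i. \<bar>C.euler_step (incr s t) (x (Y s)) i - x (Y t) i\<bar>"] by (simp add: mult.assoc)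
  qed
  then show ?thesis unfolding C.follows_def using c(1)
    by (intro exI[of _ "real m * c"] conjI exI[of _ 1]) auto
qed

text \<open>The threshold is removed by \<open>follows_bound\<close>, for which continuity of
  \<open>Y\<close> provides a compact image.\<close>

lemma follows_imp_chart_estimate:
  assumes x: "(U, x) \<in> A" and Y: "continuous_map (top_of_set {a..b}) M Y" "Y ` {a..b} \<subseteq> U"
    and ab: "S \<le> a" "b \<le> T" and f: "follows_in U x a b Y"
  shows "chart_estimate U x a b Y"
proof -
  interpret C: driven_coord_field m n "x ` U" "coord U x" S T p \<omega> X by (rule chart_field[OF x])
  have Z: "compact ((\<lambda>t. x (Y t)) ` {a..b})" "(\<lambda>t. x (Y t)) ` {a..b} \<subseteq> x ` U"
    using chart_curve_continuous[OF x Y] Y(2) by (auto intro: compact_continuous_image)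
  obtain c where c: "c > 0" "\<And>s t. a \<le> s \<Longrightarrow> s \<le> t \<Longrightarrow> t \<le> b \<Longrightarrow>
    l1_dist m (C.euler_step (incr s t) (x (Y s))) (x (Y t)) \<le> c * scale s t ^ 3"
    by (rule C.follows_bound[OF ab Z _ f]) auto
  have "\<bar>x (Y t) i - x (Y s) i - rough_increment n (\<lambda>\<tau>. fibre_coords m A x (f (Y s)) \<tau> i) (incr s t)\<bar>
       \<le> c * \<omega> s t powr (3 / p)" if i: "i < m" and st: "a \<le> s" "s \<le> t" "t \<le> b" for i s t
  proof -
    have q: "Y s \<in> U" using Y st by auto
    have "\<bar>C.euler_step (incr s t) (x (Y s)) i - x (Y t) i\<bar> \<le> c * scale s t ^ 3"
      using coord_le_l1_dist[OF i] c(2)[OF st] order_trans by blast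
    then show ?thesis using i scale_power[of 3 s t]
      by (simp add: C.euler_step_def coord_at[OF x q] abs_minus_commute algebra_simps)
  qed
  then show ?thesis unfolding chart_estimate_def time_simplex_def using c(1) by auto
qed

text \<open>The path has compact image in the overlap, so the transition map has uniform derivative
  bounds up to order three on a tube around it. \<open>chart_change_estimate\<close> then applies to
  each pair of times of small scale, and the transition laws of the components identify its
  \<open>G\<close> with the field in the new chart.\<close>

lemma follows_change_chart:
  assumes x: "(U, x) \<in> A" and y: "(V, y) \<in> A"
    and Y: "continuous_map (top_of_set {a..b}) M Y" "Y ` {a..b} \<subseteq> U" "Y ` {a..b} \<subseteq> V"
    and ab: "S \<le> a" "b \<le> T" and f: "follows_in U x a b Y"
  shows "follows_in V y a b Y"
proof -
  interpret C: driven_coord_field m n "x ` U" "coord U x" S T p \<omega> X by (rule chart_field[OF x])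
  interpret D: driven_coord_field m n "y ` V" "coord V y" S T p \<omega> X by (rule chart_field[OF y])
  let ?O = "x ` (U \<inter> V)" and ?\<phi> = "\<lambda>i v. y (inv_into U x v) i"
  define Z where "Z = (\<lambda>t. x (Y t)) ` {a..b}"
  have O: "openin (Euclidean_space m) ?O" by (rule overlap_open[OF x chart_open[OF y]])
  have Z: "compact Z" "Z \<subseteq> ?O"
    using chart_curve_continuous[OF x Y(1,2)] Y by (auto simp: Z_def intro: compact_continuous_image)
  have "?O \<subseteq> x ` U" by auto
  then obtain r K where r: "r > 0" and BO: "l1_tube m Z r \<subseteq> ?O" and B: "C.bounded_derivs (l1_tube m Z r) K"
    using C.tube_bounds[OF Z O] by blast
  have ZE: "Z \<subseteq> topspace (Euclidean_space m)" using Z(2) O openin_subset by blast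
  have tube: "compact (l1_tube m Z r)" by (rule compact_l1_tube[OF Z(1) ZE])
  have sm: "smooth_on m ?O (?\<phi> i)" if "i < m" for i using transition_smooth[OF x y that] .
  have cont: "continuous_on (l1_tube m Z r) G" if "smooth_on m ?O G" for G
    using smooth_on_continuous[OF that O] BO continuous_on_subset by blast
  \<comment> \<open>Indexing by tuples that include the component \<open>i\<close> gives one bound
    per order of differentiation, valid for all components of the transition map.\<close>
  let ?J = "{..<m} \<times> {..<m}"
  obtain K1 where K1: "K1 > 0" "\<And>q u. q \<in> ?J \<Longrightarrow> u \<in> l1_tube m Z r \<Longrightarrow> \<bar>(\<lambda>(i, j). partial j (?\<phi> i)) q u\<bar> \<le> K1"
    by (rule compact_finite_bounded_real[OF tube, of ?J "\<lambda>(i, j). partial j (?\<phi> i)"])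
       (auto intro!: cont smooth_on_partial sm)
  obtain K2 where K2: "K2 > 0" "\<And>q u. q \<in> ?J \<times> {..<m} \<Longrightarrow> u \<in> l1_tube m Z r \<Longrightarrow>
      \<bar>(\<lambda>((i, j), k). partial k (partial j (?\<phi> i))) q u\<bar> \<le> K2"
    by (rule compact_finite_bounded_real[OF tube, of "?J \<times> {..<m}" "\<lambda>((i, j), k). partial k (partial j (?\<phi> i))"])
       (auto intro!: cont smooth_on_partial sm)
  obtain K3 where K3: "K3 > 0" "\<And>q u. q \<in> (?J \<times> {..<m}) \<times> {..<m} \<Longrightarrow> u \<in> l1_tube m Z r \<Longrightarrow>
      \<bar>(\<lambda>(((i, j), k), l). partial l (partial k (partial j (?\<phi> i)))) q u\<bar> \<le> K3"
    by (rule compact_finite_bounded_real[OF tube, of "(?J \<times> {..<m}) \<times> {..<m}"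
          "\<lambda>(((i, j), k), l). partial l (partial k (partial j (?\<phi> i)))"])
       (auto intro!: cont smooth_on_partial sm)
  define K' where "K' = K1 + K2 + K3"
  have K': "0 \<le> K'" using K1 K2 K3 by (simp add: K'_def)
  have d1: "\<bar>partial j (?\<phi> i) u\<bar> \<le> K'" if "i < m" "j < m" "u \<in> l1_tube m Z r" for i j u
    using K1(2)[of "(i, j)" u] K2(1) K3(1) that by (simp add: K'_def)
  have d2: "\<bar>partial k (partial j (?\<phi> i)) u\<bar> \<le> K'" if "i < m" "j < m" "k < m" "u \<in> l1_tube m Z r" for i j k u
    using K2(2)[of "((i, j), k)" u] K1(1) K3(1) that by (simp add: K'_def)
  have d3: "\<bar>partial l (partial k (partial j (?\<phi> i))) u\<bar> \<le> K'"
    if "i < m" "j < m" "k < m" "l < m" "u \<in> l1_tube m Z r" for i j k l u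
    using K3(2)[of "(((i, j), k), l)" u] K1(1) K2(1) that by (simp add: K'_def)
  obtain L h0 where L: "L \<ge> 0" "h0 > 0" "\<And>s t. a \<le> s \<Longrightarrow> s \<le> t \<Longrightarrow> t \<le> b \<Longrightarrow> scale s t \<le> h0 \<Longrightarrow>
     l1_dist m (C.euler_step (incr s t) (x (Y s))) (x (Y t)) \<le> L * scale s t ^ 3"
    using f unfolding C.follows_def by blast
  obtain c where c: "c > 0" "\<And>s t. S \<le> s \<Longrightarrow> s \<le> t \<Longrightarrow> t \<le> T \<Longrightarrow> rough_size n c (scale s t) (incr s t)"
    using incr_size by blast
  define N where "N = real (card (forests n))"
  define E where "E = real m * (N * (K * c)) + L"
  define Q where "Q = L + N * (K * c)"
  define D where "D = K' * E ^ 3 + K' * L + real m * (real m * (K' * (2 * (E * Q) + Q * Q)))"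
  have pos: "0 \<le> E" "0 \<le> Q" using B c(1) L(1) by (simp_all add: E_def Q_def N_def C.bounded_derivs_def)
  then have D: "0 \<le> D" using K' L(1) by (simp add: D_def)
  \<comment> \<open>Below this scale the path moves by at most \<open>r\<close>, so the segment
    joining its two positions stays in the tube.\<close>
  define h1 where "h1 = min h0 (min 1 (r / (E + 1)))"
  have h1: "h1 > 0" using L r pos by (simp add: h1_def)
  have "l1_dist m (D.euler_step (incr s t) (y (Y s))) (y (Y t)) \<le> real m * D * scale s t ^ 3"
    if st: "a \<le> s" "s \<le> t" "t \<le> b" "scale s t \<le> h1" for s t
  proof -
    let ?h = "scale s t" and ?z = "x (Y s)" and ?w = "x (Y t)"
    have h: "?h \<le> h0" "?h \<le> 1" "0 \<le> ?h" "?h \<le> r / (E + 1)" using st(4) by (auto simp: h1_def)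
    have zZ: "?z \<in> Z" "?w \<in> Z" using st by (auto simp: Z_def)
    have zE: "?z \<in> topspace (Euclidean_space m)" "?w \<in> topspace (Euclidean_space m)" using zZ ZE by auto
    have zB: "?z \<in> l1_tube m Z r" using zZ zE r by (auto simp: l1_tube_def intro!: bexI[of _ ?z])
    have size: "rough_size n c ?h (incr s t)" using c(2) st ab by auto
    have est: "l1_dist m (C.euler_step (incr s t) ?z) ?w \<le> L * ?h ^ 3" using L(3) st h by auto
    have h3: "?h ^ 3 \<le> ?h" using power_decreasing[of 1 3 ?h] h by simp
    have "l1_dist m ?z ?w \<le> real m * (N * (K * (c * ?h))) + L * ?h ^ 3"
      using l1_dist_triangle[of m ?z ?w "C.euler_step (incr s t) ?z"] est
        C.euler_step_displacement[OF B zB size h(3,2)] c(1) by (simp add: N_def)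
    also have "\<dots> \<le> E * ?h" using mult_left_mono[OF h3 L(1)] by (simp add: E_def distrib_right mult.assoc)
    also have "\<dots> \<le> (E + 1) * ?h" using h(3) by (simp add: distrib_right)
    also have "\<dots> \<le> r" using h(4) pos by (simp add: field_simps)
    finally have zw: "l1_dist m ?z ?w \<le> r" .
    have seg: "segment_at ?z ?w v \<in> l1_tube m Z r" if "0 \<le> v" "v \<le> 1" for v
      using C.tube_segment[OF zZ(1) zE _ zw that] r by simp
    have qU: "Y s \<in> U" "Y s \<in> V" "Y t \<in> U" "Y t \<in> V" using Y st by auto
    have dots: "X (Dots (Upair \<alpha> \<beta>)) s t = X (Vertex \<alpha>) s t * X (Vertex \<beta>) s t"
      if "\<alpha> \<in> {1..n}" "\<beta> \<in> {1..n}" for \<alpha> \<beta>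
    proof -
      have "S \<le> s \<and> s \<le> s \<and> s \<le> t \<and> t \<le> T" using st ab by auto
      then show ?thesis using path that unfolding branched_rough_path_def by blast
    qed
    have "\<bar>D.euler_step (incr s t) (y (Y s)) i - y (Y t) i\<bar> \<le> D * ?h ^ 3" if i: "i < m" for i
    proof -
      have "\<bar>?\<phi> i ?w - ?\<phi> i ?z - rough_increment n (\<lambda>\<tau>. coord V y \<tau> i (y (Y s))) (incr s t)\<bar> \<le> D * ?h ^ 3"
        unfolding D_def
        by (rule C.chart_change_estimate[OF B zB zE(2) seg sm[OF i] O BO d1[OF i] d2[OF i] d3[OF i] K'
              size h(3,2) _ L(1) dots est coord_change_Vertex[OF x y qU(1,2) i]
              coord_change_Dots[OF x y qU(1,2) i] coord_change_Stack[OF x y qU(1,2) i] N_def E_def Q_def])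
           (use c(1) in auto)
      then show ?thesis using qU x i by (simp add: D.euler_step_def abs_minus_commute algebra_simps)
    qed
    then show ?thesis
      unfolding l1_dist_def
      using sum_bounded_above[of "{..<m}" "\<lambda>i. \<bar>D.euler_step (incr s t) (y (Y s)) i - y (Y t) i\<bar>"] by (simp add: mult.assoc)
  qed
  then show ?thesis unfolding D.follows_def using h1 D
    by (intro exI[of _ "real m * D"] conjI exI[of _ h1]) auto
qed

text \<open>One chart containing the whole path suffices to test all others: on a subinterval that
  also lands in \<open>V\<close>, the estimate is transferred and the threshold then
  removed.\<close>

lemma integral_curve_in_chart:
  assumes x: "(U, x) \<in> A" and Y: "continuous_map (top_of_set {a..b}) M Y" "Y ` {a..b} \<subseteq> U"
    and ab: "S \<le> a" "b \<le> T" and f: "follows_in U x a b Y"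
  shows "integral_curve m n M A f a b p \<omega> X Y"
  unfolding integral_curve_iff
proof (intro conjI allI impI Y(1), clarify)
  fix a' b' V y
  assume sub: "{a'..b'} \<subseteq> {a..b}" and y: "(V, y) \<in> A" and YV: "Y ` {a'..b'} \<subseteq> V"
  interpret C: driven_coord_field m n "x ` U" "coord U x" S T p \<omega> X by (rule chart_field[OF x])
  show "chart_estimate V y a' b' Y"
  proof (cases "a' \<le> b'")
    case True
    then have ab': "a \<le> a'" "b' \<le> b" using sub by auto
    have cont: "continuous_map (top_of_set {a'..b'}) M Y"
      using continuous_map_from_subtopology_mono[OF Y(1) sub] .
    have YU: "Y ` {a'..b'} \<subseteq> U" using Y(2) sub by auto
    have "follows_in U x a' b' Y" by (rule C.follows_mono[OF f ab'])
    then have "follows_in V y a' b' Y" using ab ab' by (intro follows_change_chart[OF x y cont YU YV]) auto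
    then show ?thesis using ab ab' by (intro follows_imp_chart_estimate[OF y cont YV]) auto
  next
    case False
    then show ?thesis unfolding chart_estimate_def time_simplex_def by (auto intro!: exI[of _ 1])
  qed
qed

section \<open>Existence near a point, concatenation and passage to the whole interval\<close>

lemma local_integral_curves:
  assumes q: "q \<in> topspace M"
  obtains W \<delta> where "openin M W" "q \<in> W" "\<delta> > 0"
    "\<And>y0 a b. y0 \<in> W \<Longrightarrow> S \<le> a \<Longrightarrow> a \<le> b \<Longrightarrow> b \<le> T \<Longrightarrow> \<omega> a b \<le> \<delta> \<Longrightarrow>
       \<exists>Y. integral_curve m n M A f a b p \<omega> X Y \<and> Y a = y0"
proof -
  obtain U x where x: "(U, x) \<in> A" "q \<in> U"
    using mfd q unfolding smooth_manifold_def by blast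
  interpret C: driven_coord_field m n "x ` U" "coord U x" S T p \<omega> X by (rule chart_field[OF x(1)])
  have "x q \<in> x ` U" using x by auto
  then obtain \<rho> \<delta> where \<rho>: "\<rho> > 0" "\<delta> > 0" and sol:
    "\<And>a b y0. S \<le> a \<Longrightarrow> a \<le> b \<Longrightarrow> b \<le> T \<Longrightarrow> \<omega> a b \<le> \<delta> \<Longrightarrow> y0 \<in> topspace (Euclidean_space m) \<Longrightarrow>
       l1_dist m (x q) y0 \<le> \<rho> \<Longrightarrow> \<exists>Y L Z. Y a = y0 \<and> compact Z \<and> Z \<subseteq> x ` U \<and> (\<forall>t. Y t \<in> Z) \<and> 0 \<le> L \<and>
       (\<forall>s t. a \<le> s \<longrightarrow> s \<le> t \<longrightarrow> t \<le> b \<longrightarrow> l1_dist m (C.euler_step (incr s t) (Y s)) (Y t) \<le> L * \<omega> s t powr (3 / p))"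
    by (rule C.local_solution_exists) blast
  \<comment> \<open>Preimage of an open ball, giving an open set of starting points to which the
    coordinate existence result applies with the same \<delta>.\<close>
  define W where "W = {q' \<in> U. x q' \<in> {v. l1_dist m (x q) v < \<rho>}}"
  have "open {v. l1_dist m (x q) v < \<rho>}"
    unfolding l1_dist_def by (intro open_Collect_less continuous_intros) auto
  then have "openin (subtopology M U) {q' \<in> topspace (subtopology M U). x q' \<in> {v. l1_dist m (x q) v < \<rho>}}"
    by (intro openin_continuous_map_preimage[OF chart_continuous[OF x(1)]]) simp
  then have "openin (subtopology M U) W" unfolding W_def topspace_chart[OF x(1)] .
  then have W: "openin M W" using chart_open[OF x(1)] openin_trans_full by blast
  show thesis
  proof (rule that[OF W])
    show "q \<in> W" using x \<rho> by (simp add: W_def)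
    show "\<delta> > 0" by fact
    fix y0 a b assume y0: "y0 \<in> W" and ab: "S \<le> a" "a \<le> b" "b \<le> T" "\<omega> a b \<le> \<delta>"
    have U0: "y0 \<in> U" "l1_dist m (x q) (x y0) \<le> \<rho>" using y0 by (auto simp: W_def)
    obtain y L Z where y: "y a = x y0" "compact Z" "Z \<subseteq> x ` U" "\<And>t. y t \<in> Z" "0 \<le> L"
      "\<And>s t. a \<le> s \<Longrightarrow> s \<le> t \<Longrightarrow> t \<le> b \<Longrightarrow> l1_dist m (C.euler_step (incr s t) (y s)) (y t) \<le> L * \<omega> s t powr (3 / p)"
      using sol[OF ab chart_point_Euclidean[OF x(1) U0(1)] U0(2)] by blast
    have f: "C.follows a b y"
      unfolding C.follows_def
      using y(5,6) scale_power[of 3] by (intro exI[of _ L] conjI exI[of _ 1]) auto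
    have cont: "continuous_on {a..b} y"
      by (rule C.solution_continuous[OF ab(1,3) y(2,3) _ f]) (rule y(4))
    define Y where "Y t = inv_into U x (y t)" for t
    have yU: "y t \<in> x ` U" for t using y(3,4) by auto
    have xY: "x (Y t) = y t" for t unfolding Y_def by (rule f_inv_into_f[OF yU])
    have "continuous_map (top_of_set {a..b}) M Y"
      unfolding Y_def[abs_def] using yU by (intro chart_inverse_curve_continuous[OF x(1) cont]) auto
    moreover have "Y ` {a..b} \<subseteq> U" using inv_into_into[OF yU] by (auto simp: Y_def)
    ultimately have "integral_curve m n M A f a b p \<omega> X Y"
      using f ab by (intro integral_curve_in_chart[OF x(1)]) (simp_all add: xY)
    moreover have "Y a = y0" using U0 x(1) by (simp add: Y_def y(1))
    ultimately show "\<exists>Y. integral_curve m n M A f a b p \<omega> X Y \<and> Y a = y0" by blast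
  qed
qed

text \<open>Intervals on one side of \<open>u\<close> inherit the estimate. An interval through
  \<open>u\<close> whose image lies in a chart splits into two pieces in that same chart, so
  concatenation in its coordinates applies, whatever charts the two curves were built in.\<close>

lemma integral_curve_concat:
  assumes Y1: "integral_curve m n M A f a u p \<omega> X Y1" and Y2: "integral_curve m n M A f u b p \<omega> X Y2"
    and eq: "Y1 u = Y2 u" and ab: "S \<le> a" "a \<le> u" "u \<le> b" "b \<le> T"
  shows "integral_curve m n M A f a b p \<omega> X (\<lambda>t. if t \<le> u then Y1 t else Y2 t)"
proof -
  let ?Y = "\<lambda>t. if t \<le> u then Y1 t else Y2 t"
  have sets: "{a..b} \<inter> {t \<in> {a..b}. t \<le> u} = {a..u}" "{a..b} \<inter> {t \<in> {a..b}. u \<le> t} = {u..b}" using ab by auto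
  have cont: "continuous_map (top_of_set {a..b}) M ?Y"
  proof (rule continuous_map_cases_le)
    show "continuous_map (subtopology (top_of_set {a..b}) {t \<in> topspace (top_of_set {a..b}). t \<le> u}) M Y1"
      using Y1 by (simp only: topspace_euclidean_subtopology subtopology_subtopology sets integral_curve_iff)
    show "continuous_map (subtopology (top_of_set {a..b}) {t \<in> topspace (top_of_set {a..b}). u \<le> t}) M Y2"
      using Y2 by (simp only: topspace_euclidean_subtopology subtopology_subtopology sets integral_curve_iff)
  qed (use eq in auto)
  have Y1_eq: "?Y t = Y1 t" if "t \<le> u" for t using that by simp
  \<comment> \<open>At \<open>t = u\<close> the first branch is taken, and the matching condition
    identifies it with \<open>Y2\<close>.\<close>
  have Y2_eq: "?Y t = Y2 t" if "u \<le> t" for t using that eq by (cases "t = u") auto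
  have est1: "chart_estimate U x a' b' ?Y" if "a \<le> a'" "b' \<le> u" "(U, x) \<in> A" "?Y ` {a'..b'} \<subseteq> U" for a' b' U x
  proof -
    have "Y1 ` {a'..b'} \<subseteq> U" using that Y1_eq by (force simp: image_subset_iff)
    moreover have "{a'..b'} \<subseteq> {a..u}" using that by auto
    ultimately have "chart_estimate U x a' b' Y1" using Y1 that(3) unfolding integral_curve_iff by blast
    then show ?thesis using chart_estimate_cong[of a' b' ?Y Y1] Y1_eq that(2) by auto
  qed
  have est2: "chart_estimate U x a' b' ?Y" if "u \<le> a'" "b' \<le> b" "(U, x) \<in> A" "?Y ` {a'..b'} \<subseteq> U" for a' b' U x
  proof -
    have "Y2 ` {a'..b'} \<subseteq> U" using that Y2_eq by (force simp: image_subset_iff)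
    moreover have "{a'..b'} \<subseteq> {u..b}" using that by auto
    ultimately have "chart_estimate U x a' b' Y2" using Y2 that(3) unfolding integral_curve_iff by blast
    then show ?thesis using chart_estimate_cong[of a' b' ?Y Y2] Y2_eq that(1) by auto
  qed
  show ?thesis
    unfolding integral_curve_iff
  proof (intro conjI allI impI cont, clarify)
    fix a' b' U x
    assume sub: "{a'..b'} \<subseteq> {a..b}" and x: "(U, x) \<in> A" and YU: "?Y ` {a'..b'} \<subseteq> U"
    interpret C: driven_coord_field m n "x ` U" "coord U x" S T p \<omega> X by (rule chart_field[OF x])
    show "chart_estimate U x a' b' ?Y"
    proof (cases "a' \<le> b'")
      case True
      then have ab': "a \<le> a'" "b' \<le> b" using sub by auto
      consider "b' \<le> u" | "u \<le> a'" | "a' \<le> u" "u \<le> b'" by linarith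
      then show ?thesis
      proof cases
        case 1 then show ?thesis using est1 ab' x YU by blast
      next
        case 2 then show ?thesis using est2 ab' x YU by blast
      next
        case 3
        have c': "continuous_map (top_of_set {a'..b'}) M ?Y"
          using continuous_map_from_subtopology_mono[OF cont sub] .
        have s: "?Y ` {a'..u} \<subseteq> U" "?Y ` {u..b'} \<subseteq> U"
          using YU 3 by (meson atLeastatMost_subset_iff image_mono order_refl order_trans)+
        have "follows_in U x a' u ?Y"
          by (rule chart_estimate_imp_follows[OF x s(1) est1[OF ab'(1) order_refl x s(1)]])
        moreover have "follows_in U x u b' ?Y"
          by (rule chart_estimate_imp_follows[OF x s(2) est2[OF order_refl ab'(2) x s(2)]])
        moreover have "compact ((\<lambda>t. x (?Y t)) ` {a'..b'})"
          by (rule compact_continuous_image[OF chart_curve_continuous[OF x c' YU] compact_Icc])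
        moreover have "(\<lambda>t. x (?Y t)) ` {a'..b'} \<subseteq> x ` U"
          using image_mono[OF YU, of x] by (simp only: image_image)
        ultimately have "follows_in U x a' b' ?Y"
          using ab ab' by (intro C.follows_concat[of a' b' "(\<lambda>t. x (?Y t)) ` {a'..b'}" _ u]) auto
        then show ?thesis using ab ab' by (intro follows_imp_chart_estimate[OF x c' YU]) auto
      qed
    next
      case False
      then show ?thesis unfolding chart_estimate_def time_simplex_def by (auto intro!: exI[of _ 1])
    qed
  qed
qed

text \<open>Off the support every coefficient vanishes in every chart, so both the displacement and
  the rough increment are zero.\<close>

lemma integral_curve_const:
  assumes q: "q \<in> topspace M" "q \<notin> field_support m n M A f"
  shows "integral_curve m n M A f a b p \<omega> X (\<lambda>_. q)"
  unfolding integral_curve_iff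
proof (intro conjI allI impI, use q in simp, clarify)
  fix a' b' :: real and U x
  assume x: "(U, x) \<in> A" and qU: "(\<lambda>_. q) ` {a'..b'} \<subseteq> U"
  let ?N = "{q. \<exists>(U, x)\<in>A. q \<in> U \<and> (\<exists>\<tau>\<in>forests n. \<exists>i<m. fibre_coords m A x (f q) \<tau> i \<noteq> 0)}"
  have "?N \<subseteq> topspace M" using chart_in_space by blast
  then have "q \<notin> ?N" using q closure_of_subset unfolding field_support_def by blast
  then have zero: "fibre_coords m A x (f q) \<tau> i = 0" if "\<tau> \<in> forests n" "i < m" "q \<in> U" for \<tau> i
    using that x by blast
  have "rough_increment n (\<lambda>\<tau>. fibre_coords m A x (f q) \<tau> i) Z = 0"
    if "i < m" "a' \<le> s" "s \<le> t" "t \<le> b'" for i Z s t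
  proof -
    have "q \<in> U" using qU that(2-4) by (auto simp: image_subset_iff)
    then show ?thesis
      unfolding rough_increment_def using zero that(1) by (intro sum.neutral) auto
  qed
  then show "chart_estimate U x a' b' (\<lambda>_. q)"
    unfolding chart_estimate_def time_simplex_def using qU by (auto intro!: exI[of _ 1])
qed

lemma uniform_integral_curves:
  assumes comp: "compactin M (field_support m n M A f)"
  obtains \<delta> where "\<delta> > 0"
    "\<And>y0 a b. y0 \<in> topspace M \<Longrightarrow> S \<le> a \<Longrightarrow> a \<le> b \<Longrightarrow> b \<le> T \<Longrightarrow> \<omega> a b \<le> \<delta> \<Longrightarrow>
       \<exists>Y. integral_curve m n M A f a b p \<omega> X Y \<and> Y a = y0"
proof -
  let ?K = "field_support m n M A f"
  have KM: "?K \<subseteq> topspace M" using comp compactin_subset_topspace by blast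
  have "\<exists>W \<delta>. openin M W \<and> q \<in> W \<and> \<delta> > 0 \<and> (\<forall>y0\<in>W. \<forall>a b. S \<le> a \<longrightarrow> a \<le> b \<longrightarrow> b \<le> T \<longrightarrow> \<omega> a b \<le> \<delta> \<longrightarrow>
       (\<exists>Y. integral_curve m n M A f a b p \<omega> X Y \<and> Y a = y0))" if q: "q \<in> ?K" for q
  proof -
    have "q \<in> topspace M" using q KM by auto
    then show ?thesis by (rule local_integral_curves) blast
  qed
  then obtain W \<delta> where W: "\<And>q. q \<in> ?K \<Longrightarrow> openin M (W q) \<and> q \<in> W q \<and> \<delta> q > 0 \<and>
     (\<forall>y0\<in>W q. \<forall>a b. S \<le> a \<longrightarrow> a \<le> b \<longrightarrow> b \<le> T \<longrightarrow> \<omega> a b \<le> \<delta> q \<longrightarrow>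
       (\<exists>Y. integral_curve m n M A f a b p \<omega> X Y \<and> Y a = y0))"
    by metis
  have "\<exists>\<F>. finite \<F> \<and> \<F> \<subseteq> W ` ?K \<and> ?K \<subseteq> \<Union>\<F>"
    using W by (intro compactinD[OF comp]) auto
  then obtain Q where Q: "Q \<subseteq> ?K" "finite Q" "?K \<subseteq> \<Union>(W ` Q)"
    using finite_subset_image by (metis (no_types, lifting))
  \<comment> \<open>The inserted 1 covers the case of an empty support.\<close>
  define d where "d = Min (insert 1 (\<delta> ` Q))"
  have d: "d > 0" using Q W by (auto simp: d_def)
  show thesis
  proof (rule that[OF d])
    fix y0 a b assume y0: "y0 \<in> topspace M" and ab: "S \<le> a" "a \<le> b" "b \<le> T" "\<omega> a b \<le> d"
    show "\<exists>Y. integral_curve m n M A f a b p \<omega> X Y \<and> Y a = y0"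
    proof (cases "y0 \<in> ?K")
      case True
      then obtain q where q: "q \<in> Q" "y0 \<in> W q" using Q(3) by blast
      have "d \<le> \<delta> q" unfolding d_def using Q(2) q(1) by (intro Min_le) auto
      then have "\<omega> a b \<le> \<delta> q" using ab by simp
      then show ?thesis using W[of q] q Q(1) ab by blast
    next
      case False
      then show ?thesis using integral_curve_const[OF y0] by blast
    qed
  qed
qed

text \<open>The bound on the control does not depend on the starting point, so finitely many pieces
  of fixed length in time reach \<open>T\<close>, wherever the earlier pieces end.\<close>

lemma integral_curve_exists:
  assumes comp: "compactin M (field_support m n M A f)" and y0: "y0 \<in> topspace M" and ST: "S \<le> T"
  shows "\<exists>Y. integral_curve m n M A f S T p \<omega> X Y \<and> Y S = y0"
proof -
  obtain \<delta> where \<delta>: "\<delta> > 0" "\<And>y0 a b. y0 \<in> topspace M \<Longrightarrow> S \<le> a \<Longrightarrow> a \<le> b \<Longrightarrow> b \<le> T \<Longrightarrow> \<omega> a b \<le> \<delta> \<Longrightarrow>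
       \<exists>Y. integral_curve m n M A f a b p \<omega> X Y \<and> Y a = y0"
    using uniform_integral_curves[OF comp] by blast
  obtain \<eta> where \<eta>: "\<eta> > 0" "\<And>s t. S \<le> s \<Longrightarrow> s \<le> t \<Longrightarrow> t \<le> T \<Longrightarrow> t - s < \<eta> \<Longrightarrow> \<omega> s t < \<delta>"
    using w_uniformly_small[OF \<delta>(1)] by blast
  \<comment> \<open>Steps of length \<open>\<eta> / 2\<close>, strictly shorter than \<eta>, cut off
    at \<open>T\<close>; from some index on they are trivial.\<close>
  define t where "t k = min T (S + real k * (\<eta> / 2))" for k
  have "\<exists>Y. integral_curve m n M A f S (t k) p \<omega> X Y \<and> Y S = y0" for k
  proof (induction k)
    case 0
    have "t 0 = S" using ST by (simp add: t_def)
    then show ?case using \<delta>(2)[OF y0, of S S] ST w_diag[of S] \<delta>(1) by simp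
  next
    case (Suc k)
    then obtain Y1 where Y1: "integral_curve m n M A f S (t k) p \<omega> X Y1" "Y1 S = y0" by blast
    have t: "S \<le> t k" "t k \<le> t (Suc k)" "t (Suc k) \<le> T" "t (Suc k) - t k < \<eta>"
    proof -
      define B where "B = real k * (\<eta> / 2)"
      have "0 \<le> B" using \<eta>(1) by (simp add: B_def)
      moreover have "t k = min T (S + B)" "t (Suc k) = min T (S + B + \<eta> / 2)"
        by (simp_all add: t_def B_def distrib_right add_divide_distrib add_ac)
      ultimately show "S \<le> t k" "t k \<le> t (Suc k)" "t (Suc k) \<le> T" "t (Suc k) - t k < \<eta>"
        using \<eta>(1) ST by (auto simp: min_def)
    qed
    have "Y1 (t k) \<in> topspace M"
      using Y1(1) t(1) unfolding integral_curve_iff continuous_map_def by auto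
    then obtain Y2 where Y2: "integral_curve m n M A f (t k) (t (Suc k)) p \<omega> X Y2" "Y2 (t k) = Y1 (t k)"
      using \<delta>(2) t \<eta>(2)[OF t] by (meson less_imp_le)
    have "integral_curve m n M A f S (t (Suc k)) p \<omega> X (\<lambda>r. if r \<le> t k then Y1 r else Y2 r)"
      using t Y2(2) by (intro integral_curve_concat[OF Y1(1) Y2(1)]) auto
    then show ?case using Y1(2) t(1)
      by (intro exI[of _ "\<lambda>r. if r \<le> t k then Y1 r else Y2 r"] conjI) simp_all
  qed
  moreover obtain k where "real k * (\<eta> / 2) > T - S"
    using reals_Archimedean3[of "\<eta> / 2"] \<eta>(1) by (metis half_gt_zero)
  then have "t k = T" by (simp add: t_def min_def)
  ultimately show ?thesis by metis
qed

end

theorem theorem4p30: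
  fixes S T p :: real and n m :: nat
    and \<omega> :: "real \<Rightarrow> real \<Rightarrow> real" and X :: "forest \<Rightarrow> real \<Rightarrow> real \<Rightarrow> real"
    and M :: "'a topology" and A :: "'a chart set" and f :: "'a \<Rightarrow> 'a velocity"
  assumes "S \<le> T"
    and "1 \<le> p" and "p < 3"
    and "control_function S T \<omega>"
    and "branched_rough_path n S T p \<omega> X"
    and "smooth_manifold m M A"
    and "rough_velocity_field m n M A f"
    and "admissible m n M A f"
    and "compactin M (field_support m n M A f)"
  shows "\<forall>Y0 \<in> topspace M. \<exists>Y. integral_curve m n M A f S T p \<omega> X Y \<and> Y S = Y0"
proof -
  interpret driven_manifold m M A n f S T p \<omega> X
    using assms by unfold_locales auto
  show ?thesis using integral_curve_exists assms by blast
qed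

end
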